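(* Let $0<q<1$, $t>0$, and let $a_1,\dots,a_N,b_1,\dots,b_M>0$ with $a_ib_j<1$ for all $i,j$. Let $\mu$ be a random partition with law $M_{qW}$, $\lambda$ a random partition with law $M_{pS}$, and let $\chi$, $S$ be random variables independent of $\mu$, $\lambda$ and of each other, with the laws given below. Then for every $n\in\mathbb{Z}_{\ge 0}$: (a) $\mathbb{P}(\mu_1+\chi\le n)=\mathbb{P}(\lambda_1\le n)$; (b) $\mathbb{E}\big[1/(-t q^{\frac12+n-\mu_1};q)_\infty\big]=\mathbb{P}(\lambda_1+S\le n)$. Moreover (a) and (b) are equivalent.
   Context: Notation: $(x;q)_\infty=\prod_{j\ge0}(1-xq^j)$, $(x;q)_n=(x;q)_\infty/(xq^n;q)_\infty$, $\theta(x)=(x;q)_\infty(q/x;q)_\infty$. $\mathcal{P}$ is the set of integer partitions, $|\rho|=\sum\rho_i$, $\rho\subset\lambda$ means $\rho_i\le\lambda_i$ for all $i$. $P_\mu$ is the $q$-Whittaker polynomial (Macdonald $P_\mu(\cdot;q,t)$ at $t=0$), $Q_\mu=\prod_{j\ge1}(q;q)^{-1}_{\mu_j-\mu_{j+1}}P_\mu$, and $s_{\lambda/\rho}$ is the skew Schur polynomial. The $q$-Whittaker measure is $M_{qW}(\mu)=P_\mu(a_1,\dots,a_N)Q_\mu(b_1,\dots,b_M)\prod_{i,j}(a_ib_j;q)_\infty$. The periodic Schur measure is $M_{pS}(\lambda)=(q;q)_\infty\prod_{i,j}(a_ib_j;q)_\infty\sum_{\rho\subset\lambda}q^{|\rho|}s_{\lambda/\rho}(a_1,\dots,a_N)s_{\lambda/\rho}(b_1,\dots,b_M)$.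 $\chi$ takes values in $\mathbb{Z}_{\ge0}$ with $\mathbb{P}(\chi=n)=\frac{q^n}{(q;q)_n}(q;q)_\infty$. $S$ takes values in $\mathbb{Z}$ with $\mathbb{P}(S=\ell)=\frac{t^\ell q^{\ell^2/2}}{(q;q)_\infty\,\theta(-tq^{1/2})}$. *)

theory Defs
  imports "HOL-Analysis.Analysis"
begin

definition qpoch_inf :: "real \<Rightarrow> real \<Rightarrow> real" where
  "qpoch_inf x q = prodinf (\<lambda>j. 1 - x * q ^ j)"

definition qpoch :: "real \<Rightarrow> real \<Rightarrow> nat \<Rightarrow> real" where
  "qpoch x q n = (\<Prod>j<n. 1 - x * q ^ j)"

definition qtheta :: "real \<Rightarrow> real \<Rightarrow> real" where
  "qtheta q x = qpoch_inf x q * qpoch_inf (q / x) q"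

definition qbinom :: "real \<Rightarrow> nat \<Rightarrow> nat \<Rightarrow> real" where
  "qbinom q n k = qpoch q q n / (qpoch q q k * qpoch q q (n - k))"

text \<open>A partition is a weakly decreasing finitely supported function nat => nat;
  the part lambda_i (i >= 1) of the paper is lam (i - 1) here.\<close>
definition is_partition :: "(nat \<Rightarrow> nat) \<Rightarrow> bool" where
  "is_partition lam \<longleftrightarrow> (\<forall>i. lam (Suc i) \<le> lam i) \<and> finite {i. lam i \<noteq> 0}"

definition partitions :: "(nat \<Rightarrow> nat) set" where
  "partitions = {lam. is_partition lam}"

definition psize :: "(nat \<Rightarrow> nat) \<Rightarrow> nat" where
  "psize lam = (\<Sum>i\<in>{i. lam i \<noteq> 0}. lam i)"

definition psubseteq :: "(nat \<Rightarrow> nat) \<Rightarrow> (nat \<Rightarrow> nat) \<Rightarrow> bool" where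
  "psubseteq rho lam \<longleftrightarrow> (\<forall>i. rho i \<le> lam i)"

definition interlace :: "(nat \<Rightarrow> nat) \<Rightarrow> (nat \<Rightarrow> nat) \<Rightarrow> bool" where
  "interlace mu lam \<longleftrightarrow> (\<forall>i. mu i \<le> lam i \<and> lam (Suc i) \<le> mu i)"

text \<open>schur_rev [x_N, ..., x_1] lam rho = s_{lam/rho}(x_1,...,x_N), peeling off the last variable:
  s_{lam/rho}(x_1..x_N) = sum over nu with lam/nu horizontal strip of s_{nu/rho}(x_1..x_{N-1}) x_N^{|lam|-|nu|}.\<close>
fun schur_rev :: "real list \<Rightarrow> (nat \<Rightarrow> nat) \<Rightarrow> (nat \<Rightarrow> nat) \<Rightarrow> real" where
  "schur_rev [] lam rho = (if lam = rho then 1 else 0)"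
| "schur_rev (x # xs) lam rho =
     (\<Sum>nu\<in>{nu. is_partition nu \<and> interlace nu lam \<and> psubseteq rho nu}.
        x ^ (psize lam - psize nu) * schur_rev xs nu rho)"

definition skew_schur :: "real list \<Rightarrow> (nat \<Rightarrow> nat) \<Rightarrow> (nat \<Rightarrow> nat) \<Rightarrow> real" where
  "skew_schur xs lam rho = schur_rev (rev xs) lam rho"

section \<open>q-Whittaker polynomials (Macdonald P at t = 0, branching rule)\<close>

definition qw_psi :: "real \<Rightarrow> (nat \<Rightarrow> nat) \<Rightarrow> (nat \<Rightarrow> nat) \<Rightarrow> real" where
  "qw_psi q lam mu = (\<Prod>i\<in>{i. lam i \<noteq> 0}. qbinom q (lam i - lam (Suc i)) (lam i - mu i))"

fun qwP_rev :: "real \<Rightarrow> real list \<Rightarrow> (nat \<Rightarrow> nat) \<Rightarrow> real" where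
  "qwP_rev q [] lam = (if (\<forall>i. lam i = 0) then 1 else 0)"
| "qwP_rev q (x # xs) lam =
     (\<Sum>mu\<in>{mu. is_partition mu \<and> interlace mu lam}.
        x ^ (psize lam - psize mu) * qw_psi q lam mu * qwP_rev q xs mu)"

definition qW_P :: "real \<Rightarrow> real list \<Rightarrow> (nat \<Rightarrow> nat) \<Rightarrow> real" where
  "qW_P q xs mu = qwP_rev q (rev xs) mu"

definition qW_Q :: "real \<Rightarrow> real list \<Rightarrow> (nat \<Rightarrow> nat) \<Rightarrow> real" where
  "qW_Q q xs mu = (\<Prod>j\<in>{j. mu j \<noteq> 0}. 1 / qpoch q q (mu j - mu (Suc j))) * qW_P q xs mu"

definition cauchy_prod :: "real \<Rightarrow> real list \<Rightarrow> real list \<Rightarrow> real" where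
  "cauchy_prod q as bs = prod_list [qpoch_inf (a * b) q. a \<leftarrow> as, b \<leftarrow> bs]"

definition M_qW :: "real \<Rightarrow> real list \<Rightarrow> real list \<Rightarrow> (nat \<Rightarrow> nat) \<Rightarrow> real" where
  "M_qW q as bs mu = qW_P q as mu * qW_Q q bs mu * cauchy_prod q as bs"

definition M_pS :: "real \<Rightarrow> real list \<Rightarrow> real list \<Rightarrow> (nat \<Rightarrow> nat) \<Rightarrow> real" where
  "M_pS q as bs lam = qpoch_inf q q * cauchy_prod q as bs *
     (\<Sum>rho\<in>{rho. is_partition rho \<and> psubseteq rho lam}.
        q ^ psize rho * skew_schur as lam rho * skew_schur bs lam rho)"

definition P_chi :: "real \<Rightarrow> nat \<Rightarrow> real" where
  "P_chi q n = q ^ n / qpoch q q n * qpoch_inf q q"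

definition P_S :: "real \<Rightarrow> real \<Rightarrow> int \<Rightarrow> real" where
  "P_S q t l = t powi l * q powr (real_of_int l ^ 2 / 2)
                / (qpoch_inf q q * qtheta q (- t * q powr (1/2)))"

definition identity_a :: "real \<Rightarrow> real list \<Rightarrow> real list \<Rightarrow> nat \<Rightarrow> bool" where
  "identity_a q as bs n \<longleftrightarrow> (\<exists>p.
     ((\<lambda>mu. M_qW q as bs mu * (if mu 0 \<le> n then (\<Sum>k\<le>n - mu 0. P_chi q k) else 0)) has_sum p) partitions
   \<and> ((\<lambda>lam. M_pS q as bs lam * (if lam 0 \<le> n then 1 else 0)) has_sum p) partitions)"

definition identity_b :: "real \<Rightarrow> real \<Rightarrow> real list \<Rightarrow> real list \<Rightarrow> nat \<Rightarrow> bool" where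
  "identity_b q t as bs n \<longleftrightarrow> (\<exists>p.
     ((\<lambda>mu. M_qW q as bs mu / qpoch_inf (- t * q powr (1/2 + real n - real (mu 0))) q) has_sum p) partitions
   \<and> ((\<lambda>lam. M_pS q as bs lam * infsum (P_S q t) {l::int. l \<le> int n - int (lam 0)}) has_sum p) partitions)"

end

theory Submission
  imports Defs "HOL-Complex_Analysis.Complex_Analysis" "HOL-Real_Asymp.Real_Asymp"
    "Jordan_Normal_Form.Determinant"
begin

text \<open>
  Fix \<open>n\<close> and index the columns of a partition with first row at most \<open>n\<close> by \<open>n\<close> points \<open>p 0, ..., p (n - 1)\<close>
  on the unit circle. Expand \<open>\<Prod>\<^sub>i \<Prod>\<^sub>a (1 + a p\<^sub>i) \<Prod>\<^sub>b (1 + b / p\<^sub>i)\<close> and pair it with a kernel \<open>B\<close>.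
  If the Fourier coefficients \<open>f\<close> of \<open>B\<close> satisfy \<open>f(..., c, c+1, ...) = q f(..., c+1, c, ...)\<close>, then
  sorting the 0/1-vectors produced by one factor inside each block of equal columns yields
  \<open>q\<close>-binomial coefficients, i.e. exactly the \<open>q\<close>-Whittaker branching rule; for \<open>q = 0\<close> it is the Schur
  branching rule. Hence the constant term computes a sum over pairs of patterns. The kernel
  \<open>\<Prod>\<^bsub>i<j\<^esub> (1 - p\<^sub>j/p\<^sub>i) / (1 - q p\<^sub>j/p\<^sub>i)\<close> gives the \<open>q\<close>-Whittaker side and an alternant gives
  \<open>\<Sum>\<^bsub>\<lambda>\<^esub> s\<^bsub>\<lambda>/\<rho>\<^esub>(a) s\<^bsub>\<lambda>/\<rho>\<^esub>(b)\<close>. After symmetrization over the points, the first kernel becomes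
  a multiple of \<open>\<Prod>\<^bsub>i\<noteq>j\<^esub> (1 - p\<^sub>j/p\<^sub>i) / (1 - q p\<^sub>j/p\<^sub>i)\<close> by Lagrange interpolation, and the alternants
  summed with weight \<open>q\<^bsup>|\<rho>|\<^esup>\<close> give the same function by Cauchy-Binet and the Cauchy determinant; this is (a).
  Constant terms are limits of averages over \<open>N\<close>-th roots of unity, so that every manipulation at
  finite \<open>N\<close> is a finite sum.

  For (b), Euler's identity and the quasi-periodicity of \<open>\<theta>\<close> show
  \<open>P(\<chi> + S \<le> m) = 1 / (- t q\<^bsup>1/2 + m\<^esup>; q)\<^sub>\<infinity>\<close> for every integer \<open>m\<close>, so (b) is the average of (a) over \<open>S\<close>.
\<close>

section \<open>Removing boxes from blocks of equal columns\<close>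

text \<open>Columns make (a) finite-dimensional: \<open>n\<close> bounds the number of points, and
  the cumulative law of chi contributes \<open>qpoch_inf q q / qpoch q q (n - mu 0)\<close>, exactly
  the factor that the weights in \<open>qW_Q\<close> would gain if a row of length \<open>n\<close>
  were put on top of \<open>mu\<close>. The same extension \<open>case_nat n lam\<close> makes
  adding boxes complementary to removing them, and the extended weight converts one kind of
  branching coefficient into the other. The obstacle is that coefficients occur at vectors which are
  not partitions: a box taken from an empty column leaves height -1. Both kernels extend
  holomorphically in the last point beyond the unit disc, so such coefficients vanish, but only as N
  grows, because averages over roots of unity see exponents modulo N. The exchange relation needs
  only the permutation invariance of the torus and holds at each N. Hence the factors in
  \<open>b\<close> are absorbed exactly at finite N, the factors in \<open>a\<close> only in the
  limit, and the infinite sum over \<open>rho\<close> is interchanged with that limit by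
  domination.\<close>

lemma qpoch_0 [simp]: "qpoch x q 0 = 1"
  by (simp add: qpoch_def)

lemma qpoch_Suc: "qpoch x q (Suc n) = qpoch x q n * (1 - x * q ^ n)"
  by (simp add: qpoch_def)

lemma qpoch_pos:
  assumes "0 \<le> q" "q < 1"
  shows "0 < qpoch q q n"
proof -
  have "q * q ^ j < 1" for j
    using assms power_Suc_less_one[of q j] by (cases "q = 0") auto
  thus ?thesis unfolding qpoch_def by (intro prod_pos) (simp add: assms)
qed

lemma qbinom_0 [simp]: "0 \<le> q \<Longrightarrow> q < 1 \<Longrightarrow> qbinom q n 0 = 1"
  using qpoch_pos[of q n] by (simp add: qbinom_def qpoch_0)

lemma qbinom_self: "0 \<le> q \<Longrightarrow> q < 1 \<Longrightarrow> qbinom q n n = 1"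
  using qpoch_pos[of q n] by (simp add: qbinom_def qpoch_0)

text \<open>Of the two q-Pascal rules, this is the one where the power counts the free positions
  that a chosen first element must cross; \<open>sum_block\<close> produces it in this form.\<close>

lemma qbinom_pascal:
  assumes "0 \<le> q" "q < 1" "k < m"
  shows "qbinom q (Suc m) (Suc k) = qbinom q m (Suc k) + q ^ (m - k) * qbinom q m k"
proof -
  obtain d where d: "m = Suc (k + d)" using assms(3) less_iff_Suc_add by auto
  note pos = qpoch_pos[OF assms(1,2), THEN less_imp_neq, THEN not_sym]
  have nz: "1 - q * q ^ k \<noteq> 0" "1 - q * q ^ d \<noteq> 0"
    using pos[of "Suc k"] pos[of "Suc d"] by (auto simp: qpoch_Suc)
  have e: "m - k = Suc d" "Suc m - Suc k = Suc d" "m - Suc k = d" using d by auto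
  have 1: "qbinom q m (Suc k) = qpoch q q m / (qpoch q q k * (1 - q * q ^ k) * qpoch q q d)"
    by (simp add: qbinom_def e qpoch_Suc)
  have 2: "qbinom q m k = qpoch q q m / (qpoch q q k * (qpoch q q d * (1 - q * q ^ d)))"
    by (simp add: qbinom_def e qpoch_Suc)
  have 3: "qbinom q (Suc m) (Suc k) = qpoch q q m * (1 - q * q ^ m)
       / (qpoch q q k * (1 - q * q ^ k) * (qpoch q q d * (1 - q * q ^ d)))"
    by (simp add: qbinom_def e qpoch_Suc)
  have 4: "1 - q * q ^ m = (1 - q * q ^ d) + q ^ Suc d * (1 - q * q ^ k)"
    by (simp add: d algebra_simps power_add)
  show ?thesis
    unfolding 1 2 3 4 e using nz pos[of k] pos[of d] by (simp add: divide_simps) (simp add: algebra_simps)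
qed

text \<open>Functions of 0/1-vectors are encoded as functions \<open>g\<close> of the support \<open>D\<close> of the vector.\<close>

lemma shift_through_block:
  fixes g :: "nat set \<Rightarrow> complex"
  assumes ex: "\<And>D j. s \<le> j \<Longrightarrow> Suc j < e \<Longrightarrow> j \<in> D \<Longrightarrow> Suc j \<notin> D \<Longrightarrow>
                g D = c * g (insert (Suc j) (D - {j}))"
    and "Y \<inter> {s..s+d} = {}" "s + d < e"
  shows "g (insert s Y) = c ^ d * g (insert (s + d) Y)"
  using assms(2,3)
proof (induction d)
  case (Suc d)
  have "g (insert (s + d) Y) = c * g (insert (Suc (s + d)) (insert (s + d) Y - {s + d}))"
    using Suc.prems by (intro ex) auto
  also have "insert (s + d) Y - {s + d} = Y" using Suc.prems by auto
  finally have 1: "g (insert (s + d) Y) = c * g (insert (Suc (s + d)) Y)" .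
  have "Y \<inter> {s..s+d} = {}" using Suc.prems by auto
  hence "g (insert s Y) = c ^ d * g (insert (s + d) Y)" using Suc by auto
  thus ?case using 1 by simp
qed simp

lemma sum_subsets_insert:
  fixes h :: "nat set \<Rightarrow> complex"
  assumes "finite R" "s \<notin> R"
  shows "(\<Sum>D | D \<subseteq> insert s R \<and> card D = Suc k. h D) =
    (\<Sum>D | D \<subseteq> R \<and> card D = Suc k. h D) + (\<Sum>D | D \<subseteq> R \<and> card D = k. h (insert s D))"
proof -
  have eq: "{D. D \<subseteq> insert s R \<and> card D = Suc k} =
     {D. D \<subseteq> R \<and> card D = Suc k} \<union> insert s ` {D. D \<subseteq> R \<and> card D = k}" (is "?L = ?A \<union> ?B")
  proof (intro equalityI subsetI)
    fix D assume D: "D \<in> ?L"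
    show "D \<in> ?A \<union> ?B"
    proof (cases "s \<in> D")
      case True
      have "finite D" using D assms finite_subset by auto
      have "D = insert s (D - {s})" "D - {s} \<subseteq> R" "card (D - {s}) = k"
        using True D \<open>finite D\<close> by (auto simp: card_Diff_singleton)
      thus ?thesis by blast
    qed (use D in auto)
  next
    fix D assume "D \<in> ?A \<union> ?B"
    thus "D \<in> ?L" using assms
      by (auto simp: card_insert_if finite_subset)
  qed
  have inj: "inj_on (insert s) {D. D \<subseteq> R \<and> card D = k}"
    using assms(2) by (intro inj_onI) (metis (lifting) insert_ident mem_Collect_eq subset_iff)
  have fin: "finite {D. D \<subseteq> R \<and> card D = k}" for k
    by (rule finite_subset[of _ "Pow R"]) (use assms in auto)
  show ?thesis unfolding eq
    by (subst sum.union_disjoint) (use fin inj assms in \<open>auto simp: sum.reindex finite_subset\<close>)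
qed

text \<open>Every \<open>D\<close> is sorted to the right end of the block, and the powers of
  \<open>q\<close> collected on the way add up to the q-binomial coefficient. The induction decides
  whether the leftmost position belongs to \<open>D\<close>.\<close>

lemma sum_block:
  fixes g :: "nat set \<Rightarrow> complex" and q :: real
  assumes q: "0 \<le> q" "q < 1"
    and ex: "\<And>D j. s \<le> j \<Longrightarrow> Suc j < s + m \<Longrightarrow> j \<in> D \<Longrightarrow> Suc j \<notin> D \<Longrightarrow>
                g D = of_real q * g (insert (Suc j) (D - {j}))"
    and "X \<inter> {s..<s+m} = {}" "k \<le> m"
  shows "(\<Sum>D | D \<subseteq> {s..<s+m} \<and> card D = k. g (X \<union> D)) =
           of_real (qbinom q m k) * g (X \<union> {s+m-k..<s+m})"
  using assms(3-)
proof (induction m arbitrary: s X k)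
  case 0
  have "{D. D \<subseteq> {s..<s+0} \<and> card D = k} = {{}}" using 0 by auto
  thus ?case using 0 q by simp
next
  case (Suc m)
  let ?R = "{Suc s..<Suc s + m}"
  have R: "{s..<s + Suc m} = insert s ?R" by auto
  show ?case
  proof (cases k)
    case 0
    have "{D. D \<subseteq> {s..<s+Suc m} \<and> card D = k} = {{}}" using 0 by (auto dest: finite_subset)
    thus ?thesis using 0 q by simp
  next
    case (Suc k')
    have ex': "g D = of_real q * g (insert (Suc j) (D - {j}))"
      if "Suc s \<le> j" "Suc j < Suc s + m" "j \<in> D" "Suc j \<notin> D" for D j
      using that Suc.prems(1)[of j D] by simp
    have split: "(\<Sum>D | D \<subseteq> {s..<s+Suc m} \<and> card D = k. g (X \<union> D)) =
        (\<Sum>D | D \<subseteq> ?R \<and> card D = Suc k'. g (X \<union> D)) + (\<Sum>D | D \<subseteq> ?R \<and> card D = k'. g (X \<union> insert s D))"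
      unfolding R Suc by (rule sum_subsets_insert) auto
    have "(\<Sum>D | D \<subseteq> ?R \<and> card D = k'. g (insert s X \<union> D)) =
        of_real (qbinom q m k') * g (insert s X \<union> {Suc s+m-k'..<Suc s+m})"
      using Suc.prems Suc by (intro Suc.IH ex') auto
    also have "g (insert s X \<union> {Suc s+m-k'..<Suc s+m}) = g (insert s (X \<union> {Suc s+m-k'..<Suc s+m}))" by simp
    \<comment> \<open>The other \<open>k'\<close> elements already occupy the right end, so the
      element at \<open>s\<close> crosses exactly \<open>m - k'\<close> free positions.\<close>
    also have "\<dots> = of_real q ^ (m - k') * g (insert (s + (m - k')) (X \<union> {Suc s+m-k'..<Suc s+m}))"
    proof (rule shift_through_block[where e = "s + Suc m"])
      show "(X \<union> {Suc s+m-k'..<Suc s+m}) \<inter> {s..s+(m-k')} = {}"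
      proof -
        have "{s..s+(m-k')} \<subseteq> {s..<s+Suc m}" by auto
        hence "X \<inter> {s..s+(m-k')} = {}" using Suc.prems(2) by blast
        thus ?thesis using Suc.prems(3) Suc by auto
      qed
    next
      show "s + (m - k') < s + Suc m" by simp
    qed (rule Suc.prems(1))
    also have "insert (s + (m - k')) (X \<union> {Suc s+m-k'..<Suc s+m}) = X \<union> {s + Suc m - k..<s + Suc m}"
      using Suc.prems Suc by auto
    finally have 2: "(\<Sum>D | D \<subseteq> ?R \<and> card D = k'. g (X \<union> insert s D)) =
       of_real (q ^ (m - k') * qbinom q m k') * g (X \<union> {s + Suc m - k..<s + Suc m})" by simp
    show ?thesis
    proof (cases "k' < m")
      case True
      have "(\<Sum>D | D \<subseteq> ?R \<and> card D = Suc k'. g (X \<union> D)) =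
          of_real (qbinom q m (Suc k')) * g (X \<union> {Suc s+m-Suc k'..<Suc s+m})"
        using Suc.prems Suc True by (intro Suc.IH ex') auto
      moreover have "{Suc s+m-Suc k'..<Suc s+m} = {s + Suc m - k..<s + Suc m}" using Suc True by auto
      ultimately show ?thesis unfolding split 2 unfolding Suc
        by (subst qbinom_pascal[OF q True]) (simp add: distrib_right)
    next
      case False
      hence km: "k' = m" using Suc.prems(3) Suc by simp
      have "card D \<le> m" if "D \<subseteq> ?R" for D
        using card_mono[OF _ that] by simp
      hence empty: "{D. D \<subseteq> ?R \<and> card D = Suc k'} = {}"
        unfolding km by (metis (mono_tags, lifting) Collect_empty_eq not_less_eq_eq order_refl)
      show ?thesis unfolding split 2 empty sum.empty unfolding Suc km by (simp add: qbinom_self q)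
    qed
  qed
qed

section \<open>Partitions, their sizes and interlacing\<close>

lemma is_partition_antimono: "is_partition lam \<Longrightarrow> i \<le> j \<Longrightarrow> lam j \<le> lam i"
  by (simp add: is_partition_def lift_Suc_antimono_le)

lemma is_partition_eventually_0:
  assumes "is_partition lam" obtains r where "lam r = 0"
  using assms unfolding is_partition_def
  by (metis (mono_tags, lifting) infinite_UNIV_nat mem_Collect_eq UNIV_I finite_subset subsetI)

lemma is_partitionI:
  assumes "\<And>i. lam (Suc i) \<le> lam i" "lam r = 0"
  shows "is_partition lam"
proof -
  have "lam i = 0" if "r \<le> i" for i
    using lift_Suc_antimono_le[of lam, OF assms(1) that] assms(2) by simp
  hence "{i. lam i \<noteq> 0} \<subseteq> {..<r}" by (metis (mono_tags, lifting) lessThan_iff mem_Collect_eq not_le subsetI)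
  thus ?thesis unfolding is_partition_def using assms(1) finite_subset by blast
qed

lemma is_partition_tail: "is_partition lam \<Longrightarrow> is_partition (\<lambda>i. lam (Suc i))"
proof -
  assume p: "is_partition lam"
  then obtain r where "lam r = 0" using is_partition_eventually_0 by blast
  thus ?thesis using p by (intro is_partitionI[of _ r]) (auto simp: is_partition_def, metis le_0_eq)
qed

lemma is_partition_case_nat:
  "is_partition (case_nat k lam) \<longleftrightarrow> is_partition lam \<and> lam 0 \<le> k"
proof
  assume p: "is_partition (case_nat k lam)"
  show "is_partition lam \<and> lam 0 \<le> k"
    using is_partition_tail[OF p] is_partition_antimono[OF p, of 0 1] by simp
next
  assume p: "is_partition lam \<and> lam 0 \<le> k"
  then obtain r where "lam r = 0" using is_partition_eventually_0 by blast
  thus "is_partition (case_nat k lam)"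
    using p by (intro is_partitionI[of _ "Suc r"]) (auto simp: is_partition_def split: nat.splits)
qed

lemma psize_eq:
  assumes "is_partition lam" "lam r = 0"
  shows "psize lam = (\<Sum>i<r. lam i)"
proof -
  have "lam i = 0" if "r \<le> i" for i
    using is_partition_antimono[OF assms(1) that] assms(2) by simp
  thus ?thesis unfolding psize_def
    by (intro sum.mono_neutral_left) (auto simp: lessThan_def, metis not_le less_irrefl)
qed

text \<open>Empty rows contribute \<open>qbinom q 0 0 = 1\<close>, so any \<open>r\<close> beyond
  the last row gives a common range for partitions of different support.\<close>

lemma qw_psi_eq:
  assumes "is_partition lam" "lam r = 0" "0 \<le> q" "q < 1"
  shows "qw_psi q lam mu = (\<Prod>i<r. qbinom q (lam i - lam (Suc i)) (lam i - mu i))"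
proof -
  have z: "lam i = 0" if "r \<le> i" for i
    using is_partition_antimono[OF assms(1) that] assms(2) by simp
  show ?thesis unfolding qw_psi_def
    using z assms(3,4) by (intro prod.mono_neutral_left) (auto simp: lessThan_def, metis not_le less_irrefl)
qed

lemma interlaced_is_partition:
  assumes "interlace mu lam" "is_partition lam" shows "is_partition mu"
proof -
  obtain r where "lam r = 0" using is_partition_eventually_0 assms(2) by blast
  hence "mu r = 0" using assms(1) unfolding interlace_def by (metis le_0_eq)
  thus ?thesis using assms(1) unfolding interlace_def
    by (intro is_partitionI[of mu r]) (meson le_trans)+
qed

lemma interlace_psize_le:
  assumes "interlace mu lam" "is_partition lam" shows "psize mu \<le> psize lam"
proof -
  obtain r where r: "lam r = 0" using is_partition_eventually_0 assms(2) by blast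
  hence "mu r = 0" using assms(1) unfolding interlace_def by (metis le_0_eq)
  thus ?thesis using assms r interlaced_is_partition[OF assms]
    by (simp add: psize_eq[of _ r] sum_mono interlace_def)
qed

lemma interlace_Suc:
  "interlace mu lam \<longleftrightarrow> mu 0 \<in> {lam (Suc 0)..lam 0} \<and> interlace (\<lambda>i. mu (Suc i)) (\<lambda>i. lam (Suc i))"
  unfolding interlace_def by (metis atLeastAtMost_iff not0_implies_Suc)

lemma finite_interlaced:
  assumes "is_partition lam" shows "finite {mu. interlace mu lam}"
proof -
  obtain r where r: "lam r = 0" using is_partition_eventually_0 assms by blast
  have "{mu. interlace mu lam} \<subseteq> {mu. \<forall>i. (i \<in> {..<r} \<longrightarrow> mu i \<in> {..lam 0}) \<and> (i \<notin> {..<r} \<longrightarrow> mu i = 0)}"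
  proof (intro subsetI CollectI allI conjI impI)
    fix mu i assume mu: "mu \<in> {mu. interlace mu lam}"
    show "mu i \<in> {..lam 0}"
      using mu is_partition_antimono[OF assms, of 0 i] by (auto simp: interlace_def intro: le_trans)
    show "mu i = 0" if "i \<notin> {..<r}"
    proof -
      have "lam i = 0" using is_partition_antimono[OF assms, of r i] r that by simp
      moreover have "mu i \<le> lam i" using mu by (simp add: interlace_def)
      ultimately show ?thesis by simp
    qed
  qed
  thus ?thesis by (rule finite_subset) (intro finite_set_of_finite_funs, auto)
qed

lemma bij_betw_interlaced_case_nat:
  "bij_betw (\<lambda>(k, nu). case_nat k nu) ({lam (Suc 0)..lam 0} \<times> {nu. interlace nu (\<lambda>i. lam (Suc i))})
     {mu. interlace mu lam}"
  by (rule bij_betwI[where g = "\<lambda>mu. (mu 0, \<lambda>i. mu (Suc i))"])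
     (auto simp: interlace_Suc[of _ lam] fun_eq_iff split: nat.splits)

text \<open>The columns \<open>lam (Suc i)..<lam i\<close> have equal height, so the set of columns in which a box is removed
  can be sorted within each such block; the sorted set with \<open>lam i - mu i\<close> elements is \<open>mu i..<lam i\<close>.\<close>

lemma sum_remove_boxes:
  fixes g :: "nat set \<Rightarrow> complex" and q y :: real
  assumes q: "0 \<le> q" "q < 1" and "is_partition lam" "lam r = 0"
    and "\<And>D i j. lam (Suc i) \<le> j \<Longrightarrow> Suc j < lam i \<Longrightarrow> j \<in> D \<Longrightarrow> Suc j \<notin> D \<Longrightarrow>
                g D = of_real q * g (insert (Suc j) (D - {j}))"
    and "X \<inter> {..<lam 0} = {}"
  shows "(\<Sum>D\<in>Pow {..<lam 0}. of_real y ^ card D * g (X \<union> D)) =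
    (\<Sum>mu | interlace mu lam. of_real (y ^ (psize lam - psize mu) * qw_psi q lam mu) * g (X \<union> (\<Union>i. {mu i..<lam i})))"
  using assms(3-)
proof (induction r arbitrary: lam X)
  case 0
  have z: "lam i = 0" for i using is_partition_antimono[OF 0(1), of 0 i] 0(2) by simp
  have "{mu. interlace mu lam} = {lam}" using z by (auto simp: interlace_def fun_eq_iff)
  thus ?case unfolding \<open>{mu. interlace mu lam} = {lam}\<close> using z by (simp add: qw_psi_def psize_def)
next
  case (Suc r)
  define nu where "nu = (\<lambda>i. lam (Suc i))"
  have nu: "is_partition nu" "nu r = 0" "nu 0 \<le> lam 0"
    using is_partition_tail[OF Suc.prems(1)] Suc.prems(2) is_partition_antimono[OF Suc.prems(1), of 0 1]
    by (simp_all add: nu_def)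
  let ?m = "lam 0 - nu 0"
  \<comment> \<open>The columns of height one. They are treated by \<open>sum_block\<close>; the
    remaining columns are those of \<open>nu\<close>, which is \<open>lam\<close> without its first
    row.\<close>
  let ?B = "{nu 0..<nu 0 + ?m}"
  have B: "nu 0 + ?m = lam 0" using nu by simp
  have un: "{..<lam 0} = ?B \<union> {..<nu 0}" using nu by auto
  have bij: "bij_betw (\<lambda>(D1,D2). D1 \<union> D2) (Pow ?B \<times> Pow {..<nu 0}) (Pow {..<lam 0})"
    by (rule bij_betwI[where g = "\<lambda>D. (D \<inter> ?B, D \<inter> {..<nu 0})"]) (use un in auto)
  have cd: "card (D1 \<union> D2) = card D1 + card D2" if "D1 \<subseteq> ?B" "D2 \<subseteq> {..<nu 0}" for D1 D2
    using that by (intro card_Un_disjoint) (auto intro: finite_subset, fastforce)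
  have ps: "psize lam = lam 0 + psize nu"
    using psize_eq[OF Suc.prems(1,2)] psize_eq[OF nu(1,2)] by (simp del: sum.lessThan_Suc add: sum.lessThan_Suc_shift nu_def)
  have "(\<Sum>D\<in>Pow {..<lam 0}. of_real y ^ card D * g (X \<union> D)) =
     (\<Sum>(D1,D2)\<in>Pow ?B \<times> Pow {..<nu 0}. of_real y ^ card (D1 \<union> D2) * g (X \<union> (D1 \<union> D2)))"
    by (subst sum.reindex_bij_betw[OF bij, symmetric]) (simp add: case_prod_unfold)
  also have "\<dots> = (\<Sum>D2\<in>Pow {..<nu 0}. \<Sum>D1\<in>Pow ?B. of_real y ^ card D2 * (of_real y ^ card D1 * g ((X \<union> D2) \<union> D1)))"
    unfolding sum.cartesian_product[symmetric]
    by (subst sum.swap) (auto intro!: sum.cong simp: cd power_add Un_ac)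
  also have "\<dots> = (\<Sum>D2\<in>Pow {..<nu 0}. \<Sum>k\<le>?m. of_real y ^ card D2 * (of_real y ^ k * of_real (qbinom q ?m k) * g ((X \<union> D2) \<union> {lam 0 - k..<lam 0})))"
  proof (intro sum.cong refl, goal_cases)
    case (1 D2)
    have fin: "finite (Pow ?B)" by simp
    have "card ` Pow ?B \<subseteq> {..?m}" using card_mono[of ?B] by fastforce
    hence "(\<Sum>D1\<in>Pow ?B. of_real y ^ card D1 * g ((X \<union> D2) \<union> D1)) =
      (\<Sum>k\<le>?m. \<Sum>D1 | D1 \<in> Pow ?B \<and> card D1 = k. of_real y ^ card D1 * g ((X \<union> D2) \<union> D1))"
      by (subst sum.group) auto
    also have "\<dots> = (\<Sum>k\<le>?m. of_real y ^ k * (\<Sum>D1 | D1 \<subseteq> ?B \<and> card D1 = k. g ((X \<union> D2) \<union> D1)))"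
      by (simp add: sum_distrib_left)
    also have "\<dots> = (\<Sum>k\<le>?m. of_real y ^ k * (of_real (qbinom q ?m k) * g ((X \<union> D2) \<union> {nu 0 + ?m - k..<nu 0 + ?m})))"
    proof (intro sum.cong refl arg_cong2[where f = times] sum_block[OF q])
      fix D j assume "nu 0 \<le> j" "Suc j < nu 0 + ?m" "j \<in> D" "Suc j \<notin> D"
      thus "g D = of_real q * g (insert (Suc j) (D - {j}))"
        by (intro Suc.prems(3)[of 0]) (auto simp: nu_def)
    qed (use 1 Suc.prems(4) nu in auto)
    finally show ?case unfolding B by (simp only: sum_distrib_left[symmetric] mult.assoc)
  qed
  also have "\<dots> = (\<Sum>k\<le>?m. of_real y ^ k * of_real (qbinom q ?m k) *
        (\<Sum>D2\<in>Pow {..<nu 0}. of_real y ^ card D2 * g ((X \<union> {lam 0 - k..<lam 0}) \<union> D2)))"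
    by (subst sum.swap) (simp add: sum_distrib_left mult_ac Un_ac)
  \<comment> \<open>The sorted block joins the fixed set, which is why the statement carries a set
    \<open>X\<close> outside the columns of the partition.\<close>
  also have "\<dots> = (\<Sum>k\<le>?m. of_real y ^ k * of_real (qbinom q ?m k) *
        (\<Sum>mu | interlace mu nu. of_real (y ^ (psize nu - psize mu) * qw_psi q nu mu) * g ((X \<union> {lam 0 - k..<lam 0}) \<union> (\<Union>i. {mu i..<nu i}))))"
  proof (intro sum.cong refl arg_cong2[where f = times] Suc.IH nu)
    fix k D i j assume "nu (Suc i) \<le> j" "Suc j < nu i" "j \<in> D" "Suc j \<notin> D"
    thus "g D = of_real q * g (insert (Suc j) (D - {j}))"
      by (intro Suc.prems(3)[of "Suc i"]) (auto simp: nu_def)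
  next
    fix k assume "k \<in> {..?m}"
    thus "(X \<union> {lam 0 - k..<lam 0}) \<inter> {..<nu 0} = {}" using Suc.prems(4) nu by auto
  qed
  \<comment> \<open>From here on \<open>k\<close> is the length of the first row after the removal,
    no longer the number of boxes removed.\<close>
  also have "\<dots> = (\<Sum>k\<in>{nu 0..lam 0}. of_real y ^ (lam 0 - k) * of_real (qbinom q ?m (lam 0 - k)) *
        (\<Sum>mu | interlace mu nu. of_real (y ^ (psize nu - psize mu) * qw_psi q nu mu) * g ((X \<union> {k..<lam 0}) \<union> (\<Union>i. {mu i..<nu i}))))"
    by (rule sum.reindex_bij_witness[where i = "\<lambda>k. lam 0 - k" and j = "\<lambda>k. lam 0 - k"]) (use nu in auto)
  also have "\<dots> = (\<Sum>(k,mu)\<in>{lam (Suc 0)..lam 0} \<times> {mu. interlace mu (\<lambda>i. lam (Suc i))}. of_real (y ^ (lam 0 - k) * qbinom q ?m (lam 0 - k) * (y ^ (psize nu - psize mu) * qw_psi q nu mu)) * g ((X \<union> {k..<lam 0}) \<union> (\<Union>i. {mu i..<nu i})))"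
    by (simp add: sum.cartesian_product[symmetric] sum_distrib_left mult_ac nu_def)
  also have "\<dots> = (\<Sum>(k,mu)\<in>{lam (Suc 0)..lam 0} \<times> {mu. interlace mu (\<lambda>i. lam (Suc i))}.
       of_real (y ^ (psize lam - psize (case_nat k mu)) * qw_psi q lam (case_nat k mu)) * g (X \<union> (\<Union>i. {case_nat k mu i..<lam i})))"
  proof (intro sum.cong refl, clarify, goal_cases)
    case (1 k mu)
    have mu: "is_partition mu" "psize mu \<le> psize nu" "mu r = 0" "mu 0 \<le> nu 0"
      using 1 interlaced_is_partition[of mu nu] interlace_psize_le[of mu nu] nu
      by (auto simp: nu_def interlace_def) (metis le_0_eq)
    have p: "is_partition (case_nat k mu)" using 1 mu by (auto simp: is_partition_case_nat nu_def)
    have "psize (case_nat k mu) = k + psize mu"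
      using psize_eq[OF p, of "Suc r"] psize_eq[OF mu(1,3)] mu(3) by (simp del: sum.lessThan_Suc add: sum.lessThan_Suc_shift)
    hence e: "psize lam - psize (case_nat k mu) = (lam 0 - k) + (psize nu - psize mu)"
      using ps mu(2) 1 by auto
    have ps: "qw_psi q lam (case_nat k mu) = qbinom q ?m (lam 0 - k) * qw_psi q nu mu"
      using qw_psi_eq[OF Suc.prems(1,2) q] qw_psi_eq[OF nu(1,2) q] by (simp del: prod.lessThan_Suc add: prod.lessThan_Suc_shift nu_def)
    have "(\<Union>i. {case_nat k mu i..<lam i}) = {k..<lam 0} \<union> (\<Union>i. {mu i..<nu i})"
      by (subst UNIV_nat_eq) (simp add: nu_def image_image)
    thus ?case unfolding e ps by (simp add: power_add Un_ac mult_ac)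
  qed
  also have "\<dots> = (\<Sum>mu | interlace mu lam. of_real (y ^ (psize lam - psize mu) * qw_psi q lam mu) * g (X \<union> (\<Union>i. {mu i..<lam i})))"
    by (subst sum.reindex_bij_betw[OF bij_betw_interlaced_case_nat, symmetric]) (simp add: case_prod_unfold)
  finally show ?case .
qed

section \<open>Functions of column heights and the exchange relation\<close>

definition conj_part :: "(nat \<Rightarrow> nat) \<Rightarrow> nat \<Rightarrow> int" where
  "conj_part lam j = int (card {i. j < lam i})"

text \<open>Turning an ascent into a descent costs \<open>q\<close>. Only ascents by one matter,
  since the vectors in question are column heights of a partition altered by a 0/1-vector.\<close>

definition exchange :: "real \<Rightarrow> nat \<Rightarrow> ((nat \<Rightarrow> int) \<Rightarrow> complex) \<Rightarrow> bool" where
  "exchange q n f \<longleftrightarrow> (\<forall>v i. Suc i < n \<longrightarrow> v (Suc i) = v i + 1 \<longrightarrow>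
      f v = of_real q * f (v(i := v i + 1, Suc i := v i)))"

lemma finite_rows:
  assumes "is_partition lam" shows "finite {i. j < lam i}"
  using assms unfolding is_partition_def by (auto elim: rev_finite_subset)

lemma conj_part_eq:
  assumes "is_partition lam" "\<And>i. j < lam i \<longleftrightarrow> i < m"
  shows "conj_part lam j = int m"
proof -
  have "{i. j < lam i} = {..<m}" using assms(2) by auto
  thus ?thesis by (simp add: conj_part_def)
qed

lemma conj_part_case_nat:
  assumes "is_partition lam"
  shows "conj_part (case_nat n lam) j = conj_part lam j + of_bool (j < n)"
proof -
  have "{i. j < case_nat n lam i} = (if j < n then {0} else {}) \<union> Suc ` {i. j < lam i}"
  proof (rule Set.set_eqI)
    fix i show "i \<in> {i. j < case_nat n lam i} \<longleftrightarrow> i \<in> (if j < n then {0} else {}) \<union> Suc ` {i. j < lam i}"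
      by (cases i) auto
  qed
  thus ?thesis using finite_rows[OF assms, of j]
    by (auto simp: conj_part_def card_insert_if card_image)
qed

text \<open>The intervals \<open>mu i..<lam i\<close> are disjoint because
  \<open>lam (Suc i) \<le> mu i\<close>, so each column loses at most one box.\<close>

lemma conj_part_interlaced:
  assumes "is_partition lam" "interlace mu lam"
  shows "conj_part lam j - of_bool (j \<in> (\<Union>i. {mu i..<lam i})) = conj_part mu j"
proof -
  have mu: "is_partition mu" using interlaced_is_partition assms by blast
  have sub: "{i. j < mu i} \<subseteq> {i. j < lam i}"
    using assms(2) by (auto simp: interlace_def intro: less_le_trans)
  have diff: "conj_part lam j - conj_part mu j = int (card ({i. j < lam i} - {i. j < mu i}))"
    using card_Diff_subset[OF finite_rows[OF mu] sub] card_mono[OF finite_rows[OF assms(1)] sub]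
    by (simp add: conj_part_def)
  have uniq: "i = i'" if "mu i \<le> j" "j < lam i" "mu i' \<le> j" "j < lam i'" for i i'
  proof (rule ccontr)
    have *: False if "i < i'" "mu i \<le> j" "j < lam i'" for i i'
    proof -
      have "lam i' \<le> lam (Suc i)" using that by (intro is_partition_antimono[OF assms(1)]) auto
      also have "\<dots> \<le> mu i" using assms(2) by (simp add: interlace_def)
      finally show False using that by simp
    qed
    assume "i \<noteq> i'" thus False using *[of i i'] *[of i' i] that by (metis nat_neq_iff)
  qed
  have eq: "{i. j < lam i} - {i. j < mu i} = {i. mu i \<le> j \<and> j < lam i}" by auto
  show ?thesis
  proof (cases "j \<in> (\<Union>i. {mu i..<lam i})")
    case True
    then obtain i where i: "mu i \<le> j" "j < lam i" by auto
    have "{i. mu i \<le> j \<and> j < lam i} = {i}" using i uniq by blast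
    thus ?thesis using diff eq True by simp
  next
    case False
    hence empty: "{i. mu i \<le> j \<and> j < lam i} = {}" by auto
    show ?thesis using diff False unfolding eq empty by simp
  qed
qed

text \<open>A row of length \<open>n\<close> is put on top of \<open>lam\<close> and taken off
  again. With it all \<open>n\<close> columns, including the empty ones of \<open>lam\<close>, lie
  in blocks of a partition, and the possible height -1 is recorded as an honest partition
  \<open>mu\<close> minus one box in each column.\<close>

lemma sum_remove_boxes_exchange:
  fixes q y :: real
  assumes q: "0 \<le> q" "q < 1" and lam: "is_partition lam" "lam 0 \<le> n" and ex: "exchange q n f"
  shows "(\<Sum>D\<in>Pow {..<n}. of_real y ^ card D * f (\<lambda>j. conj_part lam j - of_bool (j \<in> D))) =
    (\<Sum>mu | interlace mu (case_nat n lam). of_real (y ^ (psize (case_nat n lam) - psize mu) * qw_psi q (case_nat n lam) mu)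
       * f (\<lambda>j. conj_part mu j - of_bool (j < n)))"
proof -
  let ?P = "case_nat n lam"
  have P: "is_partition ?P" using lam by (simp add: is_partition_case_nat)
  define g where "g D = f (\<lambda>j. conj_part lam j - of_bool (j \<in> D))" for D
  obtain r where r: "?P r = 0" using is_partition_eventually_0 P by blast
  have "(\<Sum>D\<in>Pow {..<?P 0}. of_real y ^ card D * g ({} \<union> D)) =
    (\<Sum>mu | interlace mu ?P. of_real (y ^ (psize ?P - psize mu) * qw_psi q ?P mu) * g ({} \<union> (\<Union>i. {mu i..<?P i})))"
  proof (rule sum_remove_boxes[OF q P r])
    fix D i j assume j: "?P (Suc i) \<le> j" "Suc j < ?P i" "j \<in> D" "Suc j \<notin> D"
    have jn: "Suc j < n" using j(2) is_partition_antimono[OF P, of 0 i] by simp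
    \<comment> \<open>Columns \<open>j\<close> and \<open>Suc j\<close> lie in the same block: both
      have height \<open>i + 1\<close> in \<open>?P\<close>, hence height \<open>i\<close> in
      \<open>lam\<close>.\<close>
    have "k < i'" if "j < lam k" "Suc j < ?P i'" "?P (Suc i') \<le> j" for k i'
      using that is_partition_antimono[OF P, of "Suc i'" "Suc k"] by (metis Suc_le_mono le_less_linear less_le_trans not_less nat.case(2))
    moreover have "Suc j < lam k" if "k < i" for k
      using that j is_partition_antimono[OF P, of "Suc k" i] by (simp add: Suc_le_eq)
    ultimately have "conj_part lam j = int i" "conj_part lam (Suc j) = int i"
      using j by (intro conj_part_eq[OF lam(1)]; meson Suc_lessD)+
    hence c: "conj_part lam (Suc j) = conj_part lam j" by simp
    let ?v = "\<lambda>k. conj_part lam k - of_bool (k \<in> D)"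
    have "f ?v = of_real q * f (?v(j := ?v j + 1, Suc j := ?v j))"
      using ex jn j c unfolding exchange_def by simp
    also have "?v(j := ?v j + 1, Suc j := ?v j) = (\<lambda>k. conj_part lam k - of_bool (k \<in> insert (Suc j) (D - {j})))"
      using j c by (auto simp: fun_eq_iff)
    finally show "g D = of_real q * g (insert (Suc j) (D - {j}))" unfolding g_def .
  qed simp
  moreover have "g (\<Union>i. {mu i..<?P i}) = f (\<lambda>j. conj_part mu j - of_bool (j < n))" if "interlace mu ?P" for mu
  proof -
    have "conj_part lam j - of_bool (j \<in> (\<Union>i. {mu i..<?P i})) = conj_part mu j - of_bool (j < n)" for j
      using conj_part_interlaced[OF P that, of j] conj_part_case_nat[OF lam(1), of n j] by linarith
    thus ?thesis unfolding g_def by presburger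
  qed
  ultimately show ?thesis by (simp add: g_def)
qed

lemma interlace_case_nat: "interlace mu (case_nat n lam) \<longleftrightarrow> interlace lam mu \<and> mu 0 \<le> n"
proof -
  have "(\<forall>i. mu i \<le> case_nat n lam i) \<longleftrightarrow> mu 0 \<le> n \<and> (\<forall>i. mu (Suc i) \<le> lam i)"
    by (metis nat.case(1) nat.case(2) not0_implies_Suc)
  thus ?thesis unfolding interlace_def by auto
qed

lemma psize_case_nat:
  assumes "is_partition lam" "lam 0 \<le> n" shows "psize (case_nat n lam) = n + psize lam"
proof -
  obtain r where r: "lam r = 0" using is_partition_eventually_0 assms by blast
  show ?thesis using psize_eq[of "case_nat n lam" "Suc r"] psize_eq[of lam r] assms r
    by (simp add: is_partition_case_nat sum.lessThan_Suc_shift del: sum.lessThan_Suc)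
qed

text \<open>Adding boxes in \<open>D\<close> is the same as adding a full row and removing boxes
  outside \<open>D\<close>. This reduces the sum to a removal with the variable
  \<open>inverse y\<close>, applied to the shifted function \<open>f'\<close>, which inherits the
  exchange relation.\<close>

lemma sum_add_boxes:
  fixes q y :: real
  assumes q: "0 \<le> q" "q < 1" and lam: "is_partition lam" "lam 0 \<le> n" and ex: "exchange q n f" and "y \<noteq> 0"
  shows "(\<Sum>D\<in>Pow {..<n}. of_real y ^ card D * f (\<lambda>j. conj_part lam j + of_bool (j \<in> D))) =
    (\<Sum>mu | interlace lam mu \<and> mu 0 \<le> n. of_real (y ^ (psize mu - psize lam) * qw_psi q (case_nat n lam) mu)
       * f (conj_part mu))"
proof -
  define f' where "f' = (\<lambda>v. f (\<lambda>j. v j + of_bool (j < n)))"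
  have ex': "exchange q n f'" unfolding exchange_def
  proof (intro allI impI)
    fix v :: "nat \<Rightarrow> int" and i assume i: "Suc i < n" "v (Suc i) = v i + 1"
    let ?w = "\<lambda>j. v j + of_bool (j < n)"
    have "f ?w = of_real q * f (?w(i := ?w i + 1, Suc i := ?w i))"
      using ex i unfolding exchange_def by simp
    also have "?w(i := ?w i + 1, Suc i := ?w i) = (\<lambda>j. (v(i := v i + 1, Suc i := v i)) j + of_bool (j < n))"
      using i by (auto simp: fun_eq_iff)
    finally show "f' v = of_real q * f' (v(i := v i + 1, Suc i := v i))" unfolding f'_def .
  qed
  have "(\<Sum>D\<in>Pow {..<n}. of_real y ^ card D * f (\<lambda>j. conj_part lam j + of_bool (j \<in> D))) =
     (\<Sum>D\<in>Pow {..<n}. of_real y ^ n * (of_real (inverse y) ^ card D * f' (\<lambda>j. conj_part lam j - of_bool (j \<in> D))))"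
  proof (rule sum.reindex_bij_witness[where i = "\<lambda>D. {..<n} - D" and j = "\<lambda>D. {..<n} - D"])
    fix D assume D: "D \<in> Pow {..<n}"
    hence fin: "finite D" and cd: "card D \<le> n" using finite_subset card_mono[of "{..<n}" D] by auto
    have "card ({..<n} - D) = n - card D" using D fin by (simp add: card_Diff_subset)
    hence "of_real y ^ n * of_real (inverse y) ^ card ({..<n} - D) = (of_real y ^ card D :: complex)"
      using cd \<open>y \<noteq> 0\<close> by (simp add: power_diff field_simps)
    moreover have "f' (\<lambda>j. conj_part lam j - of_bool (j \<in> {..<n} - D)) = f (\<lambda>j. conj_part lam j + of_bool (j \<in> D))"
      unfolding f'_def using D by (intro arg_cong[where f = f]) (auto simp: fun_eq_iff)
    ultimately show "of_real y ^ n * (of_real (inverse y) ^ card ({..<n} - D) * f' (\<lambda>j. conj_part lam j - of_bool (j \<in> {..<n} - D)))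
      = of_real y ^ card D * f (\<lambda>j. conj_part lam j + of_bool (j \<in> D))"
      by (simp only: mult.assoc[symmetric])
  qed auto
  also have "\<dots> = of_real y ^ n * (\<Sum>mu | interlace mu (case_nat n lam).
      of_real (inverse y ^ (psize (case_nat n lam) - psize mu) * qw_psi q (case_nat n lam) mu)
       * f' (\<lambda>j. conj_part mu j - of_bool (j < n)))"
    by (simp only: sum_distrib_left[symmetric] sum_remove_boxes_exchange[OF q lam ex'])
  also have "\<dots> = (\<Sum>mu | interlace mu (case_nat n lam). of_real (y ^ (psize mu - psize lam) * qw_psi q (case_nat n lam) mu)
       * f (conj_part mu))"
    unfolding sum_distrib_left
  proof (intro sum.cong refl, clarify)
    fix mu assume mu: "interlace mu (case_nat n lam)"
    have P: "is_partition (case_nat n lam)" using lam by (simp add: is_partition_case_nat)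
    have pm: "is_partition mu" using interlaced_is_partition[OF mu P] .
    have le: "psize mu \<le> n + psize lam" "psize lam \<le> psize mu"
      using interlace_psize_le[OF mu P] interlace_psize_le[of lam mu] mu pm psize_case_nat[OF lam]
      by (auto simp: interlace_case_nat)
    have "y ^ n * inverse y ^ (psize (case_nat n lam) - psize mu) = y ^ (psize mu - psize lam)"
    proof -
      have "n = (psize mu - psize lam) + (n + psize lam - psize mu)" using le by simp
      hence "y ^ n = y ^ (psize mu - psize lam) * y ^ (n + psize lam - psize mu)"
        by (metis power_add)
      thus ?thesis using \<open>y \<noteq> 0\<close> by (simp add: psize_case_nat[OF lam] power_inverse)
    qed
    hence "of_real y ^ n * (of_real (inverse y ^ (psize (case_nat n lam) - psize mu) * qw_psi q (case_nat n lam) mu) :: complex)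
       = of_real (y ^ (psize mu - psize lam) * qw_psi q (case_nat n lam) mu)"
      by (metis mult.assoc of_real_mult of_real_power)
    moreover have "f' (\<lambda>j. conj_part mu j - of_bool (j < n)) = f (conj_part mu)"
      by (simp add: f'_def)
    ultimately show "of_real y ^ n * (of_real (inverse y ^ (psize (case_nat n lam) - psize mu) * qw_psi q (case_nat n lam) mu)
       * f' (\<lambda>j. conj_part mu j - of_bool (j < n))) = of_real (y ^ (psize mu - psize lam) * qw_psi q (case_nat n lam) mu)
       * f (conj_part mu)" by (simp only: mult.assoc[symmetric])
  qed
  also have "{mu. interlace mu (case_nat n lam)} = {mu. interlace lam mu \<and> mu 0 \<le> n}"
    by (simp add: interlace_case_nat)
  finally show ?thesis .
qed

text \<open>If \<open>mu 0 = n\<close> in the finite formula, the full first row cancels the shift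
  by one and a partition interlacing with \<open>lam\<close> remains. If \<open>mu 0 < n\<close>,
  the last column is empty, the last exponent is -1, and \<open>neg\<close> removes the term in the
  limit.\<close>

lemma tendsto_sum_remove_boxes:
  fixes q y :: real
  assumes q: "0 \<le> q" "q < 1" and lam: "is_partition lam" "lam 0 \<le> n"
    and ex: "\<And>N. exchange q n (F N)"
    and lim: "\<And>mu. is_partition mu \<Longrightarrow> mu 0 \<le> n \<Longrightarrow> (\<lambda>N. F N (conj_part mu)) \<longlonglongrightarrow> L mu"
    and neg: "\<And>v. 0 < n \<Longrightarrow> v (n - 1) < 0 \<Longrightarrow> (\<lambda>N. F N v) \<longlonglongrightarrow> 0"
  shows "(\<lambda>N. \<Sum>D\<in>Pow {..<n}. of_real y ^ card D * F N (\<lambda>j. conj_part lam j - of_bool (j \<in> D))) \<longlonglongrightarrow>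
    (\<Sum>mu | interlace mu lam. of_real (y ^ (psize lam - psize mu) * qw_psi q lam mu) * L mu)"
proof -
  let ?P = "case_nat n lam"
  have P: "is_partition ?P" using lam by (simp add: is_partition_case_nat)
  have fin: "finite {mu. interlace mu ?P}" by (rule finite_interlaced[OF P])
  define L' where "L' mu = (if mu 0 = n then L (\<lambda>i. mu (Suc i)) else 0)" for mu
  have t: "(\<lambda>N. F N (\<lambda>j. conj_part mu j - of_bool (j < n))) \<longlonglongrightarrow> L' mu" if mu: "interlace mu ?P" for mu
  proof (cases "mu 0 = n")
    case True
    let ?nu = "\<lambda>i. mu (Suc i)"
    have pm: "is_partition mu" using interlaced_is_partition[OF mu P] .
    have "mu = case_nat n ?nu" using True by (auto simp: fun_eq_iff split: nat.splits)
    hence "conj_part mu j - of_bool (j < n) = conj_part ?nu j" for j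
      using conj_part_case_nat[OF is_partition_tail[OF pm], of n j] by simp
    moreover have "?nu 0 \<le> n" using is_partition_antimono[OF pm, of 0 1] True by simp
    ultimately show ?thesis using lim[OF is_partition_tail[OF pm]] True by (simp add: L'_def)
  next
    case False
    have pm: "is_partition mu" using interlaced_is_partition[OF mu P] .
    have m: "mu 0 < n" using False mu by (simp add: interlace_case_nat)
    hence "\<not> n - 1 < mu i" for i using is_partition_antimono[OF pm, of 0 i] by simp
    hence "conj_part mu (n - 1) = 0" by (simp add: conj_part_def)
    thus ?thesis using neg[of "\<lambda>j. conj_part mu j - of_bool (j < n)"] m False by (simp add: L'_def)
  qed
  have limP: "(\<lambda>N. \<Sum>D\<in>Pow {..<n}. of_real y ^ card D * F N (\<lambda>j. conj_part lam j - of_bool (j \<in> D))) \<longlonglongrightarrow>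
    (\<Sum>mu | interlace mu ?P. of_real (y ^ (psize ?P - psize mu) * qw_psi q ?P mu) * L' mu)"
    unfolding sum_remove_boxes_exchange[OF q lam ex] by (intro tendsto_intros) (use t in simp)
  have "(\<Sum>mu | interlace mu ?P. of_real (y ^ (psize ?P - psize mu) * qw_psi q ?P mu) * L' mu) =
     (\<Sum>mu\<in>case_nat n ` {mu. interlace mu lam}. of_real (y ^ (psize ?P - psize mu) * qw_psi q ?P mu) * L' mu)"
  proof (rule sum.mono_neutral_right[OF fin])
    show "case_nat n ` {mu. interlace mu lam} \<subseteq> {mu. interlace mu ?P}"
      using lam by (auto simp: interlace_Suc[of _ ?P])
    show "\<forall>i\<in>{mu. interlace mu ?P} - case_nat n ` {mu. interlace mu lam}. of_real (y ^ (psize ?P - psize i) * qw_psi q ?P i) * L' i = 0"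
    proof
      fix mu assume mu: "mu \<in> {mu. interlace mu ?P} - case_nat n ` {mu. interlace mu lam}"
      have "mu 0 \<noteq> n"
      proof
        assume "mu 0 = n"
        hence "mu = case_nat n (\<lambda>i. mu (Suc i))" by (auto simp: fun_eq_iff split: nat.splits)
        thus False using mu by (auto simp: interlace_Suc[of _ ?P])
      qed
      thus "of_real (y ^ (psize ?P - psize mu) * qw_psi q ?P mu) * L' mu = 0" by (simp add: L'_def)
    qed
  qed
  also have "\<dots> = (\<Sum>mu | interlace mu lam. of_real (y ^ (psize ?P - psize (case_nat n mu)) * qw_psi q ?P (case_nat n mu)) * L' (case_nat n mu))"
  proof (subst sum.reindex)
    show "inj_on (case_nat n) {mu. interlace mu lam}"
      by (rule inj_on_inverseI[where g = "\<lambda>mu i. mu (Suc i)"]) simp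
  qed simp
  also have "\<dots> = (\<Sum>mu | interlace mu lam. of_real (y ^ (psize lam - psize mu) * qw_psi q lam mu) * L mu)"
  proof (intro sum.cong refl, clarify)
    fix mu assume mu: "interlace mu lam"
    have "mu 0 \<le> lam 0" using mu by (simp add: interlace_def)
    hence pm: "is_partition mu" "mu 0 \<le> n" using interlaced_is_partition[OF mu lam(1)] lam(2) by simp_all
    obtain r where r: "lam r = 0" using is_partition_eventually_0[OF lam(1)] by blast
    have "qw_psi q ?P (case_nat n mu) = qw_psi q lam mu"
      using qw_psi_eq[OF P, of "Suc r" q] qw_psi_eq[OF lam(1) r q] r q
      by (simp del: prod.lessThan_Suc add: prod.lessThan_Suc_shift)
    thus "of_real (y ^ (psize ?P - psize (case_nat n mu)) * qw_psi q ?P (case_nat n mu)) * L' (case_nat n mu)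
      = of_real (y ^ (psize lam - psize mu) * qw_psi q lam mu) * L mu"
      using psize_case_nat[OF lam] psize_case_nat[OF pm] by (simp add: L'_def)
  qed
  finally show ?thesis using limP by simp
qed

section \<open>Averages over the discrete torus\<close>

abbreviation transposition :: "nat \<Rightarrow> nat \<Rightarrow> nat \<Rightarrow> nat" where
  "transposition \<equiv> Transposition.transpose"

abbreviation roots_of_unity :: "nat \<Rightarrow> complex set" where
  "roots_of_unity N \<equiv> {z. z ^ N = 1}"

abbreviation empty_part :: "nat \<Rightarrow> nat" where
  "empty_part \<equiv> \<lambda>_. 0"

definition torus :: "nat \<Rightarrow> nat \<Rightarrow> (nat \<Rightarrow> complex) set" where
  "torus n N = PiE {..<n} (\<lambda>_. roots_of_unity N)"

definition tavg :: "nat \<Rightarrow> nat \<Rightarrow> ((nat \<Rightarrow> complex) \<Rightarrow> complex) \<Rightarrow> complex" where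
  "tavg n N F = (\<Sum>p\<in>torus n N. F p) / of_nat N ^ n"

text \<open>A discrete Fourier coefficient: exponents are seen modulo \<open>N\<close>, so the
  coefficient of the monomial with exponents \<open>v\<close> is recovered only as \<open>N\<close>
  grows.\<close>

definition tcoef :: "nat \<Rightarrow> nat \<Rightarrow> ((nat \<Rightarrow> complex) \<Rightarrow> complex) \<Rightarrow> (nat \<Rightarrow> int) \<Rightarrow> complex" where
  "tcoef n N B v = tavg n N (\<lambda>p. B p * (\<Prod>i<n. p i powi (- v i)))"

text \<open>Says that \<open>B p * (1 / p (Suc i) - q / p i)\<close> is antisymmetric in the points
  \<open>i\<close> and \<open>Suc i\<close>, written without dividing.\<close>

definition exchange_kernel :: "real \<Rightarrow> nat \<Rightarrow> ((nat \<Rightarrow> complex) \<Rightarrow> complex) \<Rightarrow> bool" where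
  "exchange_kernel q n B \<longleftrightarrow> (\<forall>p i. Suc i < n \<longrightarrow> (\<forall>j<n. norm (p j) = 1) \<longrightarrow>
     B (p \<circ> transposition i (Suc i)) * (1 / p i - of_real q / p (Suc i)) = - B p * (1 / p (Suc i) - of_real q / p i))"

lemma finite_torus: "0 < N \<Longrightarrow> finite (torus n N)"
  unfolding torus_def by (intro finite_PiE) (auto intro: finite_roots_unity)

lemma torus_norm: "p \<in> torus n N \<Longrightarrow> 0 < N \<Longrightarrow> j < n \<Longrightarrow> norm (p j) = 1"
proof -
  assume p: "p \<in> torus n N" "0 < N" "j < n"
  hence "p j ^ N = 1" unfolding torus_def by (auto dest: PiE_mem)
  hence "norm (p j) ^ N = 1" by (metis norm_one norm_power)
  thus ?thesis using p(2) power_eq_imp_eq_base[of "norm (p j)" N 1] by simp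
qed

lemma torus_nz: "p \<in> torus n N \<Longrightarrow> 0 < N \<Longrightarrow> j < n \<Longrightarrow> p j \<noteq> 0"
  using torus_norm[of p n N j] by auto

lemma torus_permute:
  assumes "p \<in> torus n N" "s permutes {..<n}" shows "p \<circ> s \<in> torus n N"
  unfolding torus_def
proof (rule PiE_I)
  fix i assume "i \<in> {..<n}"
  hence "s i \<in> {..<n}" using permutes_in_image[OF assms(2)] by blast
  thus "(p \<circ> s) i \<in> {z. z ^ N = 1}" using assms(1) unfolding torus_def o_def by (rule PiE_mem[rotated])
next
  fix i assume i: "i \<notin> {..<n}"
  hence "s i = i" using assms(2) by (simp add: permutes_not_in)
  thus "(p \<circ> s) i = undefined" using assms(1) i unfolding torus_def o_def by (metis PiE_arb)
qed

lemma sum_torus_permute: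
  assumes "s permutes {..<n}" shows "(\<Sum>p\<in>torus n N. h (p \<circ> s)) = (\<Sum>p\<in>torus n N. h p)"
proof (rule sum.reindex_bij_witness[where i = "\<lambda>p. p \<circ> Hilbert_Choice.inv s" and j = "\<lambda>p. p \<circ> s"])
  fix p assume p: "p \<in> torus n N"
  show "p \<circ> s \<circ> Hilbert_Choice.inv s = p" using permutes_inv_o(1)[OF assms] by (simp add: o_assoc[symmetric])
  show "p \<circ> Hilbert_Choice.inv s \<circ> s = p" using permutes_inv_o(2)[OF assms] by (simp add: o_assoc[symmetric])
  show "p \<circ> s \<in> torus n N" using torus_permute[OF p assms] .
  show "p \<circ> Hilbert_Choice.inv s \<in> torus n N" using torus_permute[OF p permutes_inv[OF assms]] .
qed simp

text \<open>Both exponent vectors arise from \<open>w\<close>, which has equal entries at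
  \<open>i\<close> and \<open>Suc i\<close>, by raising one of these two entries. The difference of
  the two sides is therefore the average of an antisymmetric function times a monomial symmetric
  under the swap, and such an average is zero.\<close>

lemma exchange_tcoef:
  assumes N: "0 < N" and ex: "exchange_kernel q n B"
  shows "exchange q n (tcoef n N B)"
  unfolding exchange_def
proof (intro allI impI)
  fix v :: "nat \<Rightarrow> int" and i assume i: "Suc i < n" and v: "v (Suc i) = v i + 1"
  let ?t = "transposition i (Suc i)"
  have t: "?t permutes {..<n}" using i by (intro permutes_swap_id) auto
  define w where "w = v(Suc i := v i)"
  define C where "C p = (\<Prod>j<n. p j powi (- w j))" for p :: "nat \<Rightarrow> complex"
  define h where "h p = B p * C p * (1 / p (Suc i) - of_real q / p i)" for p
  have wt: "w (?t j) = w j" for j by (auto simp: w_def Transposition.transpose_def)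
  have Ct: "C (p \<circ> ?t) = C p" for p
    unfolding C_def using prod.permute[OF t, of "\<lambda>j. p j powi (- w j)"] by (simp add: o_def wt)
  have M: "(\<Prod>j<n. p j powi (- u j)) = C p / p k"
    if "p \<in> torus n N" "k < n" "u = w(k := w k + 1)" for p u k
  proof -
    have nz: "p k \<noteq> 0" using that torus_nz[OF _ N] by blast
    have "(\<Prod>j<n. p j powi (- u j)) = p k powi (- u k) * (\<Prod>j\<in>{..<n}-{k}. p j powi (- u j))"
      using that by (intro prod.remove) auto
    also have "(\<Prod>j\<in>{..<n}-{k}. p j powi (- u j)) = (\<Prod>j\<in>{..<n}-{k}. p j powi (- w j))"
      using that by (intro prod.cong) auto
    also have "p k powi (- u k) = p k powi (- w k) / p k"
    proof -
      have e: "- u k = - w k - 1" using that by simp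
      show ?thesis using nz unfolding e by (simp add: power_int_diff)
    qed
    also have "p k powi (- w k) / p k * (\<Prod>j\<in>{..<n}-{k}. p j powi (- w j)) = C p / p k"
      unfolding C_def using that by (subst (2) prod.remove[of _ k]) auto
    finally show ?thesis .
  qed
  have "(\<Sum>p\<in>torus n N. h p) = (\<Sum>p\<in>torus n N. h (p \<circ> ?t))"
    by (rule sum_torus_permute[OF t, symmetric])
  also have "\<dots> = (\<Sum>p\<in>torus n N. - h p)"
  proof (intro sum.cong refl)
    fix p assume p: "p \<in> torus n N"
    have e: "B (p \<circ> ?t) * (1 / p i - of_real q / p (Suc i)) = - B p * (1 / p (Suc i) - of_real q / p i)"
      using ex i torus_norm[OF p N] unfolding exchange_kernel_def by blast
    have "h (p \<circ> ?t) = C p * (B (p \<circ> ?t) * (1 / p i - of_real q / p (Suc i)))"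
      by (simp add: h_def Ct)
    thus "h (p \<circ> ?t) = - h p" unfolding e by (simp add: h_def)
  qed
  finally have h0: "(\<Sum>p\<in>torus n N. h p) = 0" by (simp add: sum_negf)
  let ?v' = "v(i := v i + 1, Suc i := v i)"
  have v1: "v = w(Suc i := w (Suc i) + 1)" and v2: "?v' = w(i := w i + 1)"
    using v by (auto simp: w_def fun_eq_iff)
  have e: "B p * (\<Prod>j<n. p j powi (- v j)) - of_real q * (B p * (\<Prod>j<n. p j powi (- ?v' j))) = h p" if p: "p \<in> torus n N" for p
    unfolding M[OF p i v1] M[OF p Suc_lessD[OF i] v2] h_def by (simp add: algebra_simps)
  have "tcoef n N B v - of_real q * tcoef n N B ?v' =
      (\<Sum>p\<in>torus n N. B p * (\<Prod>j<n. p j powi (- v j)) - of_real q * (B p * (\<Prod>j<n. p j powi (- ?v' j)))) / of_nat N ^ n"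
    unfolding tcoef_def tavg_def sum_subtractf by (simp add: diff_divide_distrib sum_distrib_left)
  also have "\<dots> = 0" using e h0 by simp
  finally show "tcoef n N B v = of_real q * tcoef n N B ?v'" by simp
qed

lemma tcoef_mult_prod:
  fixes x :: complex and e :: int
  assumes N: "0 < N"
  shows "tcoef n N (\<lambda>p. (\<Prod>i<n. 1 + x * p i powi e) * B p) v =
    (\<Sum>D\<in>Pow {..<n}. x ^ card D * tcoef n N B (\<lambda>j. v j - e * of_bool (j \<in> D)))"
proof -
  have *: "(\<Prod>i<n. 1 + x * p i powi e) * B p * (\<Prod>i<n. p i powi (- v i)) =
     (\<Sum>D\<in>Pow {..<n}. x ^ card D * (B p * (\<Prod>i<n. p i powi (- (v i - e * of_bool (i \<in> D))))))"
    if p: "p \<in> torus n N" for p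
  proof -
    have "(\<Prod>i<n. 1 + x * p i powi e) = (\<Prod>i<n. x * p i powi e + 1)" by (simp add: add.commute)
    also have "\<dots> = (\<Sum>D\<in>Pow {..<n}. (\<Prod>i\<in>D. x * p i powi e) * (\<Prod>i\<in>{..<n}-D. 1))"
      by (rule prod_add) simp
    also have "\<dots> = (\<Sum>D\<in>Pow {..<n}. x ^ card D * (\<Prod>i\<in>D. p i powi e))"
      by (simp add: prod.distrib)
    finally have 1: "(\<Prod>i<n. 1 + x * p i powi e) = (\<Sum>D\<in>Pow {..<n}. x ^ card D * (\<Prod>i\<in>D. p i powi e))" .
    have 2: "(\<Prod>i\<in>D. p i powi e) * (\<Prod>i<n. p i powi (- v i)) = (\<Prod>i<n. p i powi (- (v i - e * of_bool (i \<in> D))))"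
      if D: "D \<in> Pow {..<n}" for D
    proof -
      have "(\<Prod>i\<in>D. p i powi e) = (\<Prod>i<n. p i powi (e * of_bool (i \<in> D)))"
        using D by (intro prod.mono_neutral_cong_left) auto
      thus ?thesis using torus_nz[OF p N]
        by (simp add: prod.distrib[symmetric] power_int_add[symmetric] power_int_diff[symmetric] cong: prod.cong)
           (intro prod.cong refl, simp add: power_int_add[symmetric])
    qed
    show ?thesis unfolding 1 sum_distrib_right
    proof (intro sum.cong refl)
      fix D assume D: "D \<in> Pow {..<n}"
      show "x ^ card D * (\<Prod>i\<in>D. p i powi e) * B p * (\<Prod>i<n. p i powi (- v i)) =
         x ^ card D * (B p * (\<Prod>i<n. p i powi (- (v i - e * of_bool (i \<in> D)))))"
        unfolding 2[OF D, symmetric] by (simp only: mult_ac)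
    qed
  qed
  show ?thesis unfolding tcoef_def tavg_def
    by (simp add: * sum_distrib_left sum_divide_distrib sum.swap[of _ "torus n N"])
qed

text \<open>One recursion for both sides: at \<open>q = 0\<close> all q-binomials are 1 and it gives
  skew Schur polynomials, and for empty \<open>rho\<close> it gives q-Whittaker polynomials.\<close>

fun skew_qW :: "real \<Rightarrow> real list \<Rightarrow> (nat \<Rightarrow> nat) \<Rightarrow> (nat \<Rightarrow> nat) \<Rightarrow> real" where
  "skew_qW q [] lam rho = (if lam = rho then 1 else 0)"
| "skew_qW q (x # xs) lam rho =
     (\<Sum>mu | interlace mu lam. x ^ (psize lam - psize mu) * qw_psi q lam mu * skew_qW q xs mu rho)"

text \<open>The redundant exponent 1 lets \<open>tcoef_mult_prod\<close> treat this product and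
  \<open>prod_neg\<close> alike.\<close>

definition prod_pos :: "nat \<Rightarrow> real list \<Rightarrow> (nat \<Rightarrow> complex) \<Rightarrow> complex" where
  "prod_pos n xs p = (\<Prod>x\<leftarrow>xs. \<Prod>i<n. 1 + of_real x * p i powi 1)"

definition prod_neg :: "nat \<Rightarrow> real list \<Rightarrow> (nat \<Rightarrow> complex) \<Rightarrow> complex" where
  "prod_neg n ys p = (\<Prod>y\<leftarrow>ys. \<Prod>i<n. 1 + of_real y * p i powi (- 1))"

lemma exchange_kernel_mult:
  assumes "exchange_kernel q n B" "\<And>p s. s permutes {..<n} \<Longrightarrow> S (p \<circ> s) = S p"
  shows "exchange_kernel q n (\<lambda>p. S p * B p)"
  unfolding exchange_kernel_def
proof (intro allI impI)
  fix p :: "nat \<Rightarrow> complex" and i assume i: "Suc i < n" "\<forall>j<n. norm (p j) = 1"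
  have t: "transposition i (Suc i) permutes {..<n}" using i by (intro permutes_swap_id) auto
  have "B (p \<circ> transposition i (Suc i)) * (1 / p i - of_real q / p (Suc i)) = - B p * (1 / p (Suc i) - of_real q / p i)"
    using assms(1) i unfolding exchange_kernel_def by blast
  thus "S (p \<circ> transposition i (Suc i)) * B (p \<circ> transposition i (Suc i)) * (1 / p i - of_real q / p (Suc i)) =
      - (S p * B p) * (1 / p (Suc i) - of_real q / p i)"
    unfolding assms(2)[OF t] by (simp add: mult.assoc)
qed

lemma prod_permute: "s permutes {..<n} \<Longrightarrow> (\<Prod>i<n. f ((p \<circ> s) i)) = (\<Prod>i<n. f (p i) :: complex)"
  using prod.permute[of s "{..<n}" "\<lambda>i. f (p i)"] by (simp add: o_def)

lemma prod_pos_permute: "s permutes {..<n} \<Longrightarrow> prod_pos n xs (p \<circ> s) = prod_pos n xs p"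
  unfolding prod_pos_def by (intro arg_cong[where f = prod_list] map_cong refl prod_permute)

lemma prod_neg_permute: "s permutes {..<n} \<Longrightarrow> prod_neg n xs (p \<circ> s) = prod_neg n xs p"
  unfolding prod_neg_def by (intro arg_cong[where f = prod_list] map_cong refl prod_permute)

text \<open>Each factor in a variable \<open>x\<close> acts on coefficients by removing a set of
  boxes weighted by \<open>x\<close>, which is one step of the branching rule; \<open>base\<close>
  says that the kernel singles out \<open>rho\<close>. The vanishing \<open>neg\<close> is assumed
  for every list because the induction applies it to the kernel times the factors still to be
  absorbed.\<close>

lemma tendsto_skew_qW:
  assumes q: "0 \<le> q" "q < 1" and ex: "exchange_kernel q n B"
    and base: "\<And>lam. is_partition lam \<Longrightarrow> lam 0 \<le> n \<Longrightarrow>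
       (\<lambda>N. tcoef n (Suc N) B (conj_part lam)) \<longlonglongrightarrow> (if lam = rho then 1 else 0)"
    and neg: "\<And>xs v. 0 < n \<Longrightarrow> v (n - 1) < 0 \<Longrightarrow> (\<lambda>N. tcoef n (Suc N) (\<lambda>p. prod_pos n xs p * B p) v) \<longlonglongrightarrow> 0"
    and lam: "is_partition lam" "lam 0 \<le> n"
  shows "(\<lambda>N. tcoef n (Suc N) (\<lambda>p. prod_pos n xs p * B p) (conj_part lam)) \<longlonglongrightarrow> of_real (skew_qW q xs lam rho)"
  using lam
proof (induction xs arbitrary: lam)
  case Nil
  thus ?case using base[OF Nil] by (cases "lam = rho") (auto simp: prod_pos_def)
next
  case (Cons x xs)
  have eq: "(\<lambda>p. prod_pos n (x # xs) p * B p) =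
      (\<lambda>p. (\<Prod>i<n. 1 + of_real x * p i powi 1) * (prod_pos n xs p * B p))"
    by (simp add: prod_pos_def fun_eq_iff mult.assoc)
  have "tcoef n (Suc N) (\<lambda>p. prod_pos n (x # xs) p * B p) (conj_part lam) =
     (\<Sum>D\<in>Pow {..<n}. of_real x ^ card D *
       tcoef n (Suc N) (\<lambda>p. prod_pos n xs p * B p) (\<lambda>j. conj_part lam j - of_bool (j \<in> D)))" for N
    unfolding eq using tcoef_mult_prod[of "Suc N" n "of_real x" 1 "\<lambda>p. prod_pos n xs p * B p" "conj_part lam"] by simp
  moreover have "(\<lambda>N. \<Sum>D\<in>Pow {..<n}. of_real x ^ card D *
       tcoef n (Suc N) (\<lambda>p. prod_pos n xs p * B p) (\<lambda>j. conj_part lam j - of_bool (j \<in> D))) \<longlonglongrightarrow>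
     (\<Sum>mu | interlace mu lam. of_real (x ^ (psize lam - psize mu) * qw_psi q lam mu) * of_real (skew_qW q xs mu rho))"
    by (intro tendsto_sum_remove_boxes[OF q Cons.prems] Cons.IH neg exchange_tcoef
          exchange_kernel_mult[OF ex] prod_pos_permute) simp
  ultimately show ?case by simp
qed

text \<open>The ratio of \<open>qW_Q\<close> to \<open>qW_P\<close>, with one more factor for the
  gap between \<open>mu 0\<close> and \<open>n\<close>. Up to \<open>qpoch_inf q q\<close>, this
  extra factor is the probability that chi is at most \<open>n - mu 0\<close>.\<close>

definition qW_weight :: "real \<Rightarrow> nat \<Rightarrow> (nat \<Rightarrow> nat) \<Rightarrow> real" where
  "qW_weight q n mu = 1 / qpoch q q (n - mu 0) * (\<Prod>j\<in>{j. mu j \<noteq> 0}. 1 / qpoch q q (mu j - mu (Suc j)))"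

lemma qW_weight_eq:
  assumes "is_partition mu" "mu r = 0"
  shows "qW_weight q n mu = 1 / qpoch q q (n - mu 0) * (\<Prod>j<r. 1 / qpoch q q (mu j - mu (Suc j)))"
proof -
  have z: "mu i = 0" if "r \<le> i" for i
    using is_partition_antimono[OF assms(1) that] assms(2) by simp
  have "(\<Prod>j\<in>{j. mu j \<noteq> 0}. 1 / qpoch q q (mu j - mu (Suc j))) = (\<Prod>j<r. 1 / qpoch q q (mu j - mu (Suc j)))"
    by (intro prod.mono_neutral_left) (use z in \<open>auto simp: lessThan_def\<close>, metis not_le less_irrefl)
  thus ?thesis by (simp add: qW_weight_def)
qed

text \<open>Detailed balance. Both sides are the product of reciprocal q-factorials of all gaps in
  the common refinement \<open>n\<close>, \<open>mu 0\<close>, \<open>lam 0\<close>,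
  \<open>mu 1\<close>, \<open>lam 1\<close>, ...: each q-binomial replaces the factor of a coarse
  gap by the factors of the two gaps into which it is cut.\<close>

lemma qW_weight_balance:
  assumes q: "0 \<le> q" "q < 1" and lam: "is_partition lam" "lam 0 \<le> n"
    and mu: "is_partition mu" "interlace lam mu" "mu 0 \<le> n"
  shows "qW_weight q n lam * qw_psi q (case_nat n lam) mu = qW_weight q n mu * qw_psi q mu lam"
proof -
  let ?c = "qpoch q q"
  have pos: "?c k \<noteq> 0" for k using qpoch_pos[OF q, of k] by simp
  have P: "is_partition (case_nat n lam)" using lam by (simp add: is_partition_case_nat)
  obtain r where r: "mu r = 0" using is_partition_eventually_0[OF mu(1)] by blast
  have lr: "lam r = 0" using mu(2) r unfolding interlace_def by (metis le_0_eq)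
  have le: "lam i \<le> mu i" "mu (Suc i) \<le> lam i" for i using mu(2) by (auto simp: interlace_def)
  have 1: "qw_psi q (case_nat n lam) mu = qbinom q (n - lam 0) (n - mu 0) *
      (\<Prod>i<r. qbinom q (lam i - lam (Suc i)) (lam i - mu (Suc i)))"
    using qw_psi_eq[OF P, of "Suc r" q mu] lr q by (simp del: prod.lessThan_Suc add: prod.lessThan_Suc_shift)
  have 2: "qw_psi q mu lam = (\<Prod>i<r. qbinom q (mu i - mu (Suc i)) (mu i - lam i))"
    by (rule qw_psi_eq[OF mu(1) r q])
  have e1: "1 / ?c (lam i - lam (Suc i)) * qbinom q (lam i - lam (Suc i)) (lam i - mu (Suc i)) =
     1 / ?c (lam i - mu (Suc i)) * (1 / ?c (mu (Suc i) - lam (Suc i)))" for i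
  proof -
    have "lam i - lam (Suc i) - (lam i - mu (Suc i)) = mu (Suc i) - lam (Suc i)" using le[of i] le[of "Suc i"] by simp
    thus ?thesis using pos by (simp add: qbinom_def)
  qed
  have e2: "1 / ?c (mu i - mu (Suc i)) * qbinom q (mu i - mu (Suc i)) (mu i - lam i) =
     1 / ?c (mu i - lam i) * (1 / ?c (lam i - mu (Suc i)))" for i
  proof -
    have "mu i - mu (Suc i) - (mu i - lam i) = lam i - mu (Suc i)" using le[of i] by simp
    thus ?thesis using pos by (simp add: qbinom_def)
  qed
  have e3: "1 / ?c (n - lam 0) * qbinom q (n - lam 0) (n - mu 0) = 1 / ?c (n - mu 0) * (1 / ?c (mu 0 - lam 0))"
  proof -
    have "n - lam 0 - (n - mu 0) = mu 0 - lam 0" using le[of 0] mu(3) by simp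
    thus ?thesis using pos by (simp add: qbinom_def)
  qed
  have "qW_weight q n lam * qw_psi q (case_nat n lam) mu =
     (1 / ?c (n - lam 0) * qbinom q (n - lam 0) (n - mu 0)) *
      (\<Prod>i<r. 1 / ?c (lam i - lam (Suc i)) * qbinom q (lam i - lam (Suc i)) (lam i - mu (Suc i)))"
    unfolding 1 qW_weight_eq[OF lam(1) lr] prod.distrib by (simp only: mult_ac)
  also have "\<dots> = 1 / ?c (n - mu 0) * (1 / ?c (mu 0 - lam 0)) * ((\<Prod>i<r. 1 / ?c (lam i - mu (Suc i))) * (\<Prod>i<r. 1 / ?c (mu (Suc i) - lam (Suc i))))"
    unfolding e1 e3 prod.distrib ..
  also have "\<dots> = 1 / ?c (n - mu 0) * ((\<Prod>i<r. 1 / ?c (lam i - mu (Suc i))) * (\<Prod>i<Suc r. 1 / ?c (mu i - lam i)))"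
    unfolding prod.lessThan_Suc_shift by simp
  also have "(\<Prod>i<Suc r. 1 / ?c (mu i - lam i)) = (\<Prod>i<r. 1 / ?c (mu i - lam i))"
    using r lr by simp
  also have "1 / ?c (n - mu 0) * ((\<Prod>i<r. 1 / ?c (lam i - mu (Suc i))) * (\<Prod>i<r. 1 / ?c (mu i - lam i)))
     = 1 / ?c (n - mu 0) * (\<Prod>i<r. 1 / ?c (mu i - mu (Suc i)) * qbinom q (mu i - mu (Suc i)) (mu i - lam i))"
    unfolding e2 prod.distrib by (simp only: mult_ac)
  also have "\<dots> = qW_weight q n mu * qw_psi q mu lam"
    unfolding 2 qW_weight_eq[OF mu(1) r] prod.distrib by (simp only: mult_ac)
  finally show ?thesis .
qed

definition part_box :: "nat \<Rightarrow> nat \<Rightarrow> (nat \<Rightarrow> nat) set" where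
  "part_box n l = {mu. is_partition mu \<and> mu 0 \<le> n \<and> mu l = 0}"

lemma finite_part_box: "finite (part_box n l)"
proof -
  have "part_box n l \<subseteq> {mu. \<forall>i. (i \<in> {..<l} \<longrightarrow> mu i \<in> {..n}) \<and> (i \<notin> {..<l} \<longrightarrow> mu i = 0)}"
  proof (intro subsetI CollectI allI conjI impI)
    fix mu i assume mu: "mu \<in> part_box n l"
    hence p: "is_partition mu" "mu 0 \<le> n" "mu l = 0" by (auto simp: part_box_def)
    show "mu i \<in> {..n}" using is_partition_antimono[OF p(1), of 0 i] p(2) by simp
    show "mu i = 0" if "i \<notin> {..<l}" using is_partition_antimono[OF p(1), of l i] p(3) that by simp
  qed
  thus ?thesis by (rule finite_subset) (intro finite_set_of_finite_funs, auto)
qed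

text \<open>Each variable adds a horizontal strip and hence at most one row.\<close>

lemma skew_qW_eq_0:
  assumes "is_partition mu" "kap l = 0" "mu (l + length ys) \<noteq> 0"
  shows "skew_qW q ys mu kap = 0"
  using assms
proof (induction ys arbitrary: mu)
  case (Cons y ys)
  have "skew_qW q ys nu kap = 0" if nu: "interlace nu mu" for nu
  proof (rule Cons.IH)
    show "is_partition nu" using interlaced_is_partition[OF nu Cons.prems(1)] .
    have "mu (Suc (l + length ys)) \<le> nu (l + length ys)" using nu by (simp add: interlace_def)
    thus "nu (l + length ys) \<noteq> 0" using Cons.prems(3) by simp
  qed (fact Cons.prems(2))
  thus ?case by simp
qed auto

text \<open>After interchanging the sums over \<open>mu\<close> and the intermediate
  \<open>nu\<close>, the balance of weights turns the inner sum into the addition of boxes to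
  \<open>nu\<close>. That addition is the effect of one factor in \<open>1 / p i\<close> on a
  coefficient, so the variables of \<open>ys\<close> pass one by one into the kernel, which is why
  the induction varies \<open>B\<close>.\<close>

lemma sum_weight_skew_qW:
  assumes q: "0 \<le> q" "q < 1" and N: "0 < N" and ex: "exchange_kernel q n B"
    and kap: "kap \<in> part_box n l" and y: "\<forall>y\<in>set ys. y \<noteq> 0"
  shows "(\<Sum>mu\<in>part_box n (l + length ys). of_real (qW_weight q n mu * skew_qW q ys mu kap) * tcoef n N B (conj_part mu))
    = of_real (qW_weight q n kap) * tcoef n N (\<lambda>p. prod_neg n ys p * B p) (conj_part kap)"
  using ex y
proof (induction ys arbitrary: B)
  case Nil
  have "(\<Sum>mu\<in>part_box n l. of_real (qW_weight q n mu * skew_qW q [] mu kap) * tcoef n N B (conj_part mu)) =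
     (\<Sum>mu\<in>{kap}. of_real (qW_weight q n mu * skew_qW q [] mu kap) * tcoef n N B (conj_part mu))"
    using kap by (intro sum.mono_neutral_right finite_part_box) auto
  thus ?case by (simp add: prod_neg_def)
next
  case (Cons y ys)
  let ?L = "l + length ys" let ?PB = "part_box n (Suc ?L)" let ?f = "\<lambda>mu. tcoef n N B (conj_part mu)"
  define B' where "B' = (\<lambda>p. (\<Prod>i<n. 1 + of_real y * p i powi (-1)) * B p)"
  have sub: "part_box n ?L \<subseteq> ?PB"
    by (auto simp: part_box_def) (metis is_partition_def le_0_eq)
  have ex': "exchange_kernel q n B'" unfolding B'_def
    by (rule exchange_kernel_mult[OF Cons.prems(1)]) (rule prod_permute)
  have step: "(\<Sum>mu | interlace nu mu \<and> mu 0 \<le> n. of_real (qW_weight q n mu * (y ^ (psize mu - psize nu) * qw_psi q mu nu)) * ?f mu)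
     = of_real (qW_weight q n nu) * tcoef n N B' (conj_part nu)" if nu: "nu \<in> part_box n ?L" for nu
  proof -
    have pn: "is_partition nu" "nu 0 \<le> n" using nu by (auto simp: part_box_def)
    have P: "is_partition (case_nat n nu)" using pn by (simp add: is_partition_case_nat)
    have "tcoef n N B' (conj_part nu) = (\<Sum>D\<in>Pow {..<n}. of_real y ^ card D * tcoef n N B (\<lambda>j. conj_part nu j + of_bool (j \<in> D)))"
      unfolding B'_def by (subst tcoef_mult_prod[OF N]) simp
    also have "\<dots> = (\<Sum>mu | interlace nu mu \<and> mu 0 \<le> n. of_real (y ^ (psize mu - psize nu) * qw_psi q (case_nat n nu) mu) * ?f mu)"
      using Cons.prems by (intro sum_add_boxes[OF q pn] exchange_tcoef[OF N]) auto
    finally have 1: "tcoef n N B' (conj_part nu) = \<dots>" .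
    have 2: "qW_weight q n mu * (y ^ (psize mu - psize nu) * qw_psi q mu nu) =
       qW_weight q n nu * (y ^ (psize mu - psize nu) * qw_psi q (case_nat n nu) mu)" if mu: "interlace nu mu \<and> mu 0 \<le> n" for mu
    proof -
      have "is_partition mu" using interlaced_is_partition[OF _ P] mu by (simp add: interlace_case_nat)
      from qW_weight_balance[OF q pn this] mu show ?thesis by (simp add: mult_ac)
    qed
    show ?thesis unfolding 1 sum_distrib_left
      by (intro sum.cong refl) (simp add: 2 mult.assoc flip: of_real_mult)
  qed
  have inner: "{mu \<in> ?PB. interlace nu mu} = {mu. interlace nu mu \<and> mu 0 \<le> n}" if nu: "nu \<in> part_box n ?L" for nu
  proof -
    have pn: "is_partition nu" "nu 0 \<le> n" "nu ?L = 0" using nu by (auto simp: part_box_def)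
    have P: "is_partition (case_nat n nu)" using pn by (simp add: is_partition_case_nat)
    have "is_partition mu \<and> mu (Suc ?L) = 0" if mu: "interlace nu mu" "mu 0 \<le> n" for mu
    proof
      show "is_partition mu" using interlaced_is_partition[OF _ P] mu by (simp add: interlace_case_nat)
      have "mu (Suc ?L) \<le> nu ?L" using mu(1) unfolding interlace_def by blast
      thus "mu (Suc ?L) = 0" using pn(3) by simp
    qed
    thus ?thesis by (auto simp: part_box_def)
  qed
  have "(\<Sum>mu\<in>?PB. of_real (qW_weight q n mu * skew_qW q (y # ys) mu kap) * ?f mu) =
     (\<Sum>mu\<in>?PB. \<Sum>nu\<in>{nu\<in>part_box n ?L. interlace nu mu}.
        of_real (skew_qW q ys nu kap) * (of_real (qW_weight q n mu * (y ^ (psize mu - psize nu) * qw_psi q mu nu)) * ?f mu))"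
  proof (intro sum.cong refl)
    fix mu assume mu: "mu \<in> ?PB"
    hence pm: "is_partition mu" "mu 0 \<le> n" by (auto simp: part_box_def)
    have "skew_qW q (y # ys) mu kap = (\<Sum>nu | interlace nu mu. y ^ (psize mu - psize nu) * qw_psi q mu nu * skew_qW q ys nu kap)"
      by simp
    also have "\<dots> = (\<Sum>nu\<in>{nu\<in>part_box n ?L. interlace nu mu}. y ^ (psize mu - psize nu) * qw_psi q mu nu * skew_qW q ys nu kap)"
    proof (rule sum.mono_neutral_right)
      show "finite {nu. interlace nu mu}" by (rule finite_interlaced[OF pm(1)])
      show "\<forall>i\<in>{nu. interlace nu mu} - {nu\<in>part_box n ?L. interlace nu mu}. y ^ (psize mu - psize i) * qw_psi q mu i * skew_qW q ys i kap = 0"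
      proof
        fix nu assume nu: "nu \<in> {nu. interlace nu mu} - {nu\<in>part_box n ?L. interlace nu mu}"
        have pn: "is_partition nu" using nu interlaced_is_partition[OF _ pm(1)] by blast
        have "nu 0 \<le> mu 0" using nu by (simp add: interlace_def)
        hence "nu 0 \<le> n" using pm by simp
        hence "nu ?L \<noteq> 0" using nu pn pm by (auto simp: part_box_def)
        moreover have "kap l = 0" using kap by (simp add: part_box_def)
        ultimately have "skew_qW q ys nu kap = 0" using pn by (intro skew_qW_eq_0)
        thus "y ^ (psize mu - psize nu) * qw_psi q mu nu * skew_qW q ys nu kap = 0" by simp
      qed
    qed auto
    finally show "of_real (qW_weight q n mu * skew_qW q (y # ys) mu kap) * ?f mu =
      (\<Sum>nu\<in>{nu\<in>part_box n ?L. interlace nu mu}.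
        of_real (skew_qW q ys nu kap) * (of_real (qW_weight q n mu * (y ^ (psize mu - psize nu) * qw_psi q mu nu)) * ?f mu))"
      by (simp add: sum_distrib_left sum_distrib_right mult_ac)
  qed
  also have "\<dots> = (\<Sum>nu\<in>part_box n ?L. \<Sum>mu\<in>{mu\<in>?PB. interlace nu mu}.
        of_real (skew_qW q ys nu kap) * (of_real (qW_weight q n mu * (y ^ (psize mu - psize nu) * qw_psi q mu nu)) * ?f mu))"
    by (rule sum.swap_restrict) (simp_all add: finite_part_box)
  also have "\<dots> = (\<Sum>nu\<in>part_box n ?L. of_real (skew_qW q ys nu kap) * (of_real (qW_weight q n nu) * tcoef n N B' (conj_part nu)))"
    by (intro sum.cong refl) (simp only: sum_distrib_left[symmetric] inner step)
  also have "\<dots> = (\<Sum>nu\<in>part_box n ?L. of_real (qW_weight q n nu * skew_qW q ys nu kap) * tcoef n N B' (conj_part nu))"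
    by (simp add: mult_ac)
  also have "\<dots> = of_real (qW_weight q n kap) * tcoef n N (\<lambda>p. prod_neg n ys p * B' p) (conj_part kap)"
    using Cons.prems by (intro Cons.IH ex') auto
  also have "(\<lambda>p. prod_neg n ys p * B' p) = (\<lambda>p. prod_neg n (y # ys) p * B p)"
    by (simp add: prod_neg_def B'_def fun_eq_iff)
  finally show ?case by simp
qed

section \<open>Constant terms as limits of averages\<close>

lemma primitive_root:
  assumes "0 < N"
  obtains w :: complex where "w ^ N = 1" "norm w = 1" "\<And>k. 0 < k \<Longrightarrow> k < N \<Longrightarrow> w ^ k \<noteq> 1"
proof
  define w where "w = cis (2 * pi / real N)"
  have pw: "w ^ k = cis (2 * pi * real k / real N)" for k
    unfolding w_def by (subst Complex.DeMoivre) (simp add: field_simps)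
  show "w ^ N = 1" using assms by (simp add: pw)
  show "norm w = 1" by (simp add: w_def)
  have inj: "inj_on (\<lambda>k. cis (2 * pi * real k / real N)) {..<N}"
    using Complex.bij_betw_roots_unity[OF assms] by (simp add: bij_betw_def)
  show "w ^ k \<noteq> 1" if "0 < k" "k < N" for k
    using inj_onD[OF inj, of k 0] that by (auto simp: pw)
qed

lemma sum_roots_unity_power:
  assumes "0 < k" "k < N" shows "(\<Sum>u | u ^ N = (1::complex). u ^ k) = 0"
proof -
  obtain w :: complex where wN: "w ^ N = 1" and w1: "norm w = 1" and "\<And>k. 0 < k \<Longrightarrow> k < N \<Longrightarrow> w ^ k \<noteq> 1"
    using primitive_root[of N] assms by auto
  hence wk: "w ^ k \<noteq> 1" using assms by blast
  have w0: "w \<noteq> 0" using w1 by auto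
  have "(\<Sum>u | u ^ N = (1::complex). u ^ k) = (\<Sum>u | u ^ N = (1::complex). (w * u) ^ k)"
    by (rule sum.reindex_bij_witness[where i = "\<lambda>u. w * u" and j = "\<lambda>u. u / w"])
       (use wN w0 in \<open>auto simp: power_mult_distrib power_divide\<close>)
  also have "\<dots> = w ^ k * (\<Sum>u | u ^ N = (1::complex). u ^ k)"
    by (simp add: power_mult_distrib sum_distrib_left)
  finally show ?thesis using wk by (simp add: field_simps)
qed

text \<open>The average keeps only Taylor terms whose total exponent \<open>m + k\<close> is a
  multiple of \<open>N\<close>. Apart from exponent zero these have \<open>k\<close> at least
  \<open>N - m\<close>, and Cauchy's inequality on the circle of radius \<open>r\<close> makes them
  geometrically small.\<close>

lemma circle_avg:
  fixes phi :: "complex \<Rightarrow> complex"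
  assumes hol: "phi holomorphic_on ball 0 R" and r: "1 < r" "r < R"
    and Bd: "\<And>u. norm u = r \<Longrightarrow> norm (phi u) \<le> Bd" and mN: "m < N"
  shows "norm ((\<Sum>u | u ^ N = 1. u ^ m * phi u) / of_nat N - of_bool (m = 0) * phi 0)
      \<le> Bd * r ^ m * (r / (r - 1)) * (1 / r) ^ N"
proof -
  define a where "a k = (deriv ^^ k) phi 0 / fact k" for k
  \<comment> \<open>The first degree at which \<open>u ^ (m + k)\<close> can alias to a
    constant.\<close>
  define K where "K = N - m"
  have N0: "0 < N" using mN by simp
  have a: "norm (a k) \<le> Bd / r ^ k" for k
  proof -
    have "norm ((deriv ^^ k) phi 0) \<le> fact k * Bd / r ^ k"
    proof (rule Cauchy_inequality)
      show "phi holomorphic_on ball 0 r" using hol r by (auto elim!: holomorphic_on_subset)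
      show "continuous_on (cball 0 r) phi"
        using hol r by (intro holomorphic_on_imp_continuous_on) (auto elim!: holomorphic_on_subset)
    qed (use r Bd in auto)
    thus ?thesis by (simp add: a_def norm_divide field_simps)
  qed
  have tail: "norm (phi u - (\<Sum>k<K. a k * u ^ k)) \<le> Bd * (1 / r) ^ K * (r / (r - 1))" if u: "norm u = 1" for u
  proof -
    have s: "(\<lambda>k. a k * u ^ k) sums phi u"
      using holomorphic_power_series[OF hol, of u] u r by (simp add: a_def)
    have b: "norm (a (k + K) * u ^ (k + K)) \<le> Bd * (1 / r) ^ K * (1 / r) ^ k" for k
      using a[of "k + K"] u by (simp add: norm_mult norm_power power_add power_divide mult.commute)
    have g: "(\<lambda>k. Bd * (1 / r) ^ K * (1 / r) ^ k) sums (Bd * (1 / r) ^ K * (1 / (1 - 1 / r)))"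
      using r by (intro sums_mult geometric_sums) simp
    have "phi u - (\<Sum>k<K. a k * u ^ k) = (\<Sum>k. a (k + K) * u ^ (k + K))"
      using suminf_minus_initial_segment[of "\<lambda>k. a k * u ^ k" K] s by (simp add: sums_iff)
    also have "norm \<dots> \<le> (\<Sum>k. Bd * (1 / r) ^ K * (1 / r) ^ k)"
      by (rule norm_suminf_le[OF b]) (use g in \<open>simp add: sums_iff\<close>)
    also have "\<dots> = Bd * (1 / r) ^ K * (r / (r - 1))"
      using g r by (simp add: sums_iff field_simps)
    finally show ?thesis .
  qed
  let ?U = "roots_of_unity N"
  have U1: "norm u = 1" if "u \<in> ?U" for u
  proof -
    have "norm u ^ N = 1 ^ N" using that by (simp flip: norm_power)
    thus ?thesis using power_eq_imp_eq_base[of "norm u" N 1] N0 by simp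
  qed
  have cU: "card ?U = N" using card_roots_unity_eq[OF N0] .
  have "(\<Sum>u\<in>?U. u ^ m * (\<Sum>k<K. a k * u ^ k)) = (\<Sum>k<K. a k * (\<Sum>u\<in>?U. u ^ (m + k)))"
    by (simp add: sum_distrib_left sum.swap[of _ ?U] power_add mult_ac)
  also have "\<dots> = (\<Sum>k<K. if k = 0 then of_bool (m = 0) * of_nat N * a 0 else 0)"
  proof (intro sum.cong refl)
    fix k assume "k \<in> {..<K}"
    hence mk: "m + k < N" by (auto simp: K_def)
    show "a k * (\<Sum>u\<in>?U. u ^ (m + k)) = (if k = 0 then of_bool (m = 0) * of_nat N * a 0 else 0)"
      using sum_roots_unity_power[OF _ mk] cU by auto
  qed
  also have "\<dots> = of_bool (m = 0) * of_nat N * phi 0"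
    using mN by (simp add: K_def a_def)
  finally have poly: "(\<Sum>u\<in>?U. u ^ m * (\<Sum>k<K. a k * u ^ k)) = of_bool (m = 0) * of_nat N * phi 0" .
  have "(\<Sum>u\<in>?U. u ^ m * phi u) / of_nat N - of_bool (m = 0) * phi 0
     = (\<Sum>u\<in>?U. u ^ m * (phi u - (\<Sum>k<K. a k * u ^ k))) / of_nat N"
    using N0 by (simp add: right_diff_distrib sum_subtractf poly field_simps)
  also have "norm \<dots> \<le> (\<Sum>u\<in>?U. Bd * (1 / r) ^ K * (r / (r - 1))) / real N"
    unfolding norm_divide norm_of_nat
    by (intro divide_right_mono sum_norm_le) (use tail U1 in \<open>auto simp: norm_mult norm_power\<close>)
  also have "\<dots> = Bd * (1 / r) ^ K * (r / (r - 1))" using N0 cU by simp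
  also have "(1 / r) ^ K = r ^ m * (1 / r) ^ N"
    using r mN by (simp add: K_def power_diff power_divide)
  finally show ?thesis by (simp add: mult_ac)
qed

lemma sum_torus_coord:
  assumes "i0 < n"
  shows "(\<Sum>p\<in>torus n N. h p) =
    (\<Sum>g\<in>PiE ({..<n} - {i0}) (\<lambda>_. roots_of_unity N). \<Sum>u | u ^ N = 1. h (g(i0 := u)))"
proof -
  let ?U = "roots_of_unity N" and ?S = "{..<n} - {i0}"
  have "{..<n} = insert i0 ?S" using assms by auto
  hence "torus n N = PiE (insert i0 ?S) (\<lambda>_. ?U)" by (simp add: torus_def)
  also have "\<dots> = (\<lambda>(g, u). g(i0 := u)) ` (PiE ?S (\<lambda>_. ?U) \<times> ?U)"
    by (subst PiE_insert_eq, subst swap_product[symmetric]) (simp add: image_image case_prod_unfold)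
  finally have t: "torus n N = (\<lambda>(g, u). g(i0 := u)) ` (PiE ?S (\<lambda>_. ?U) \<times> ?U)" .
  have "inj_on (\<lambda>(g, u). g(i0 := u)) (PiE ?S (\<lambda>_. ?U) \<times> ?U)"
    by (rule inj_combinator') simp
  thus ?thesis unfolding t by (simp add: sum.reindex sum.cartesian_product case_prod_unfold)
qed

lemma card_torus: "0 < N \<Longrightarrow> finite S \<Longrightarrow> card (PiE S (\<lambda>_. roots_of_unity N)) = N ^ card S"
  by (subst card_PiE) (simp_all add: card_roots_unity_eq)

text \<open>Averages one coordinate with the others frozen. The single bound \<open>Bd\<close> for
  all frozen tuples keeps the error independent of them, so it survives the remaining
  average.\<close>

lemma tavg_coord:
  assumes i0: "i0 < n" and mN: "m < N" and r: "1 < r" "r < R"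
    and hol: "\<And>g. g \<in> PiE ({..<n} - {i0}) (\<lambda>_. roots_of_unity N) \<Longrightarrow> phi g holomorphic_on ball 0 R"
    and Bd: "\<And>g u. g \<in> PiE ({..<n} - {i0}) (\<lambda>_. roots_of_unity N) \<Longrightarrow> norm u = r \<Longrightarrow> norm (phi g u) \<le> Bd"
    and F: "\<And>g u. g \<in> PiE ({..<n} - {i0}) (\<lambda>_. roots_of_unity N) \<Longrightarrow> u ^ N = 1 \<Longrightarrow> F (g(i0 := u)) = u ^ m * phi g u"
  shows "norm (tavg n N F - (\<Sum>g\<in>PiE ({..<n} - {i0}) (\<lambda>_. roots_of_unity N). of_bool (m = 0) * phi g 0) / of_nat N ^ (n - 1))
      \<le> Bd * r ^ m * (r / (r - 1)) * (1 / r) ^ N"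
proof -
  let ?G = "PiE ({..<n} - {i0}) (\<lambda>_. roots_of_unity N)"
  let ?C = "Bd * r ^ m * (r / (r - 1)) * (1 / r) ^ N"
  have N0: "0 < N" using mN by simp
  have nn: "of_nat N ^ n = (of_nat N * of_nat N ^ (n - 1) :: complex)" using i0 by (cases n) auto
  have cG: "card ?G = N ^ (n - 1)" using card_torus[OF N0, of "{..<n} - {i0}"] i0 by simp
  have "tavg n N F = (\<Sum>g\<in>?G. (\<Sum>u | u ^ N = 1. u ^ m * phi g u) / of_nat N) / of_nat N ^ (n - 1)"
    unfolding tavg_def sum_torus_coord[OF i0] nn using F
    by (simp add: sum_divide_distrib)
  hence "tavg n N F - (\<Sum>g\<in>?G. of_bool (m = 0) * phi g 0) / of_nat N ^ (n - 1)
    = (\<Sum>g\<in>?G. (\<Sum>u | u ^ N = 1. u ^ m * phi g u) / of_nat N - of_bool (m = 0) * phi g 0) / of_nat N ^ (n - 1)"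
    by (simp add: sum_subtractf diff_divide_distrib)
  also have "norm \<dots> \<le> (\<Sum>g\<in>?G. ?C) / real N ^ (n - 1)"
    unfolding norm_divide norm_of_nat norm_power
    by (intro divide_right_mono sum_norm_le circle_avg[OF hol r _ mN] Bd) auto
  also have "\<dots> = ?C" using N0 by (simp add: cG)
  finally show ?thesis .
qed

section \<open>Uniform bounds and coefficients that vanish in the limit\<close>

definition bdd_on :: "'a set \<Rightarrow> ('a \<Rightarrow> complex) \<Rightarrow> bool" where
  "bdd_on S f \<longleftrightarrow> (\<exists>B. \<forall>s\<in>S. norm (f s) \<le> B)"

lemma bdd_onI: "(\<And>s. s \<in> S \<Longrightarrow> norm (f s) \<le> B) \<Longrightarrow> bdd_on S f"
  unfolding bdd_on_def by blast

lemma bdd_on_const: "bdd_on S (\<lambda>_. c)"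
  by (rule bdd_onI) (rule order_refl)

lemma bdd_on_mult: "bdd_on S f \<Longrightarrow> bdd_on S g \<Longrightarrow> bdd_on S (\<lambda>s. f s * g s)"
  unfolding bdd_on_def norm_mult
proof (elim exE)
  fix B C assume "\<forall>s\<in>S. norm (f s) \<le> B" "\<forall>s\<in>S. norm (g s) \<le> C"
  hence "\<forall>s\<in>S. norm (f s) * norm (g s) \<le> B * C"
    by (auto intro!: mult_mono intro: order_trans[OF norm_ge_zero])
  thus "\<exists>B. \<forall>s\<in>S. norm (f s) * norm (g s) \<le> B" by blast
qed

lemma bdd_on_add: "bdd_on S f \<Longrightarrow> bdd_on S g \<Longrightarrow> bdd_on S (\<lambda>s. f s + g s)"
  unfolding bdd_on_def by (metis norm_add_rule_thm)

lemma bdd_on_prod: "finite I \<Longrightarrow> (\<And>i. i \<in> I \<Longrightarrow> bdd_on S (f i)) \<Longrightarrow> bdd_on S (\<lambda>s. \<Prod>i\<in>I. f i s)"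
  by (induction I rule: finite_induct) (auto intro: bdd_on_const bdd_on_mult)

lemma bdd_on_sum: "finite I \<Longrightarrow> (\<And>i. i \<in> I \<Longrightarrow> bdd_on S (f i)) \<Longrightarrow> bdd_on S (\<lambda>s. \<Sum>i\<in>I. f i s)"
  by (induction I rule: finite_induct) (auto intro: bdd_on_const bdd_on_add)

lemma bdd_on_prod_list: "(\<And>x. x \<in> set xs \<Longrightarrow> bdd_on S (f x)) \<Longrightarrow> bdd_on S (\<lambda>s. \<Prod>x\<leftarrow>xs. f x s)"
  by (induction xs) (auto intro: bdd_on_const bdd_on_mult)

definition unit_tuples :: "nat \<Rightarrow> (nat \<Rightarrow> complex) set" where
  "unit_tuples n = {p. \<forall>i<n. norm (p i) = 1}"

lemma torus_unit: "0 < N \<Longrightarrow> p \<in> torus n N \<Longrightarrow> p \<in> unit_tuples n"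
  using torus_norm by (auto simp: unit_tuples_def)

lemma tendsto_geometric_bound:
  fixes f :: "nat \<Rightarrow> complex"
  assumes "1 < r" "\<And>N. m < N \<Longrightarrow> norm (f N) \<le> C * (1 / r) ^ N"
  shows "f \<longlonglongrightarrow> 0"
proof (rule Lim_null_comparison)
  show "\<forall>\<^sub>F N in sequentially. norm (f N) \<le> C * (1 / r) ^ N"
    using eventually_gt_at_top[of m] by eventually_elim (rule assms(2))
  have "(\<lambda>N. (1 / r) ^ N) \<longlonglongrightarrow> 0" using assms(1) by (intro LIMSEQ_power_zero) simp
  thus "(\<lambda>N. C * (1 / r) ^ N) \<longlonglongrightarrow> 0" using tendsto_mult_right_zero by blast
qed

text \<open>A negative last exponent supplies a factor \<open>u ^ m\<close> with
  \<open>m > 0\<close> in the last point \<open>u\<close>. The rest is holomorphic beyond the unit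
  disc, so the average tends to the value at \<open>u = 0\<close>, which is zero.\<close>

lemma tendsto_tcoef_neg:
  assumes r: "1 < r" "r < R"
    and hol: "\<And>g. g \<in> unit_tuples n \<Longrightarrow> phi g holomorphic_on ball 0 R"
    and bd: "bdd_on (unit_tuples n \<times> {u. norm u = r}) (\<lambda>(g, u). phi g u)"
    and B: "\<And>g u. g \<in> unit_tuples n \<Longrightarrow> norm u = 1 \<Longrightarrow> B (g(n := u)) = phi g u"
    and v: "v n < 0"
  shows "(\<lambda>N. tcoef (Suc n) N (\<lambda>p. prod_pos (Suc n) xs p * B p) v) \<longlonglongrightarrow> 0"
proof -
  define m where "m = nat (- v n)"
  have m: "0 < m" "int m = - v n" using v by (auto simp: m_def)
  define psi where "psi g u = (\<Prod>x\<leftarrow>xs. 1 + of_real x * u) * (prod_pos n xs g * (\<Prod>i<n. g i powi (- v i))) * phi g u" for g u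
  let ?S = "unit_tuples n \<times> {u::complex. norm u = r}"
  have "bdd_on ?S (\<lambda>(g, u). psi g u)"
    unfolding psi_def prod_pos_def case_prod_unfold
  proof (intro bdd_on_mult bdd_on_prod_list bdd_on_prod bdd_on_add bdd_on_const)
    fix x :: real
    show "bdd_on ?S (\<lambda>s. snd s)" by (rule bdd_onI[of _ _ r]) auto
  next
    fix x :: real and i assume "i \<in> {..<n}"
    thus "bdd_on ?S (\<lambda>s. fst s i powi 1)" by (intro bdd_onI[of _ _ 1]) (auto simp: unit_tuples_def norm_power_int)
  next
    fix i assume "i \<in> {..<n}"
    thus "bdd_on ?S (\<lambda>s. fst s i powi - v i)" by (intro bdd_onI[of _ _ 1]) (auto simp: unit_tuples_def norm_power_int)
  qed (use bd in \<open>auto simp: case_prod_unfold\<close>)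
  then obtain Bd where Bd: "\<And>g u. g \<in> unit_tuples n \<Longrightarrow> norm u = r \<Longrightarrow> norm (psi g u) \<le> Bd"
    unfolding bdd_on_def by fastforce
  have plist: "(\<lambda>u. \<Prod>x\<leftarrow>xs. 1 + complex_of_real x * u) holomorphic_on T" for T
    by (induction xs) (auto intro!: holomorphic_intros)
  show ?thesis
  proof (rule tendsto_geometric_bound[OF r(1)])
    fix N assume mN: "m < N"
    hence N0: "0 < N" by simp
    let ?G = "PiE ({..<Suc n} - {n}) (\<lambda>_. roots_of_unity N)"
    have G: "?G = torus n N" by (simp add: torus_def lessThan_Suc)
    let ?F = "\<lambda>p. prod_pos (Suc n) xs p * B p * (\<Prod>i<Suc n. p i powi (- v i))"
    have "norm (tavg (Suc n) N ?F - (\<Sum>g\<in>?G. of_bool (m = 0) * psi g 0) / of_nat N ^ (Suc n - 1))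
      \<le> Bd * r ^ m * (r / (r - 1)) * (1 / r) ^ N"
    proof (rule tavg_coord[OF _ mN r])
      fix g assume "g \<in> ?G"
      hence g: "g \<in> unit_tuples n" using torus_unit[OF N0] G by simp
      show "psi g holomorphic_on ball 0 R" unfolding psi_def
        by (intro holomorphic_intros plist hol g)
      show "norm (psi g u) \<le> Bd" if "norm u = r" for u using Bd[OF g that] .
      fix u :: complex assume u: "u ^ N = 1"
      hence "norm u ^ N = 1 ^ N" by (simp flip: norm_power)
      hence u1: "norm u = 1" using power_eq_imp_eq_base[of "norm u" N 1] N0 by simp
      have e1: "prod_pos (Suc n) xs (g(n := u)) = (\<Prod>x\<leftarrow>xs. 1 + of_real x * u) * prod_pos n xs g"
        unfolding prod_pos_def by (induction xs) (simp_all add: mult_ac)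
      have e2: "(\<Prod>i<Suc n. (g(n := u)) i powi (- v i)) = u ^ m * (\<Prod>i<n. g i powi (- v i))"
        using m by (simp add: power_int_of_nat[symmetric])
      show "?F (g(n := u)) = u ^ m * psi g u"
        unfolding e1 e2 B[OF g u1] psi_def by (simp only: mult_ac)
    qed simp
    thus "norm (tcoef (Suc n) N (\<lambda>p. prod_pos (Suc n) xs p * B p) v) \<le> Bd * r ^ m * (r / (r - 1)) * (1 / r) ^ N"
      using m(1) by (simp add: tcoef_def)
  qed
qed

text \<open>Rotating all points by a primitive root \<open>w\<close> permutes the torus and
  multiplies the sum by \<open>w powi d\<close>, which differs from 1 because \<open>d\<close> is
  nonzero and smaller than \<open>N\<close> in absolute value. The value \<open>undefined\<close>
  keeps the rotated tuple extensional.\<close>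

lemma tavg_homogeneous:
  assumes N: "nat \<bar>d\<bar> < N" and d: "d \<noteq> 0"
    and F: "\<And>p z. p \<in> torus n N \<Longrightarrow> norm z = 1 \<Longrightarrow> F (\<lambda>i. if i < n then z * p i else undefined) = z powi d * F p"
  shows "tavg n N F = 0"
proof -
  have N0: "0 < N" using N by simp
  obtain w :: complex where w: "w ^ N = 1" "norm w = 1" and wk: "\<And>k. 0 < k \<Longrightarrow> k < N \<Longrightarrow> w ^ k \<noteq> 1"
    using primitive_root[OF N0] by blast
  have w0: "w \<noteq> 0" using w by auto
  have wd: "w powi d \<noteq> 1"
    using wk[of "nat \<bar>d\<bar>"] N d by (cases "0 \<le> d") (auto simp: power_int_def power_inverse)
  let ?s = "\<lambda>z p i. if i < n then z * p i else undefined"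
  have "(\<Sum>p\<in>torus n N. F p) = (\<Sum>p\<in>torus n N. F (?s w p))"
  proof (rule sum.reindex_bij_witness[where i = "?s w" and j = "?s (1 / w)"])
    have st: "?s z p \<in> torus n N" if "p \<in> torus n N" "z ^ N = 1" for z p
      using that unfolding torus_def by (intro PiE_I) (auto simp: PiE_iff power_mult_distrib)
    fix p assume p: "p \<in> torus n N"
    show "?s w p \<in> torus n N" "?s (1 / w) p \<in> torus n N" using st[OF p] w by (auto simp: power_divide)
    show "?s w (?s (1 / w) p) = p" "?s (1 / w) (?s w p) = p"
      using w0 p by (auto simp: fun_eq_iff torus_def PiE_iff extensional_def)
    show "F (?s w (?s (1 / w) p)) = F p"
      using w0 p by (intro arg_cong[where f = F]) (auto simp: fun_eq_iff torus_def PiE_iff extensional_def)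
  qed
  also have "\<dots> = w powi d * (\<Sum>p\<in>torus n N. F p)"
    using F w by (simp add: sum_distrib_left)
  finally have "(\<Sum>p\<in>torus n N. F p) = 0" using wd by (simp add: field_simps)
  thus ?thesis by (simp add: tavg_def)
qed

section \<open>The q-Whittaker and Schur kernels\<close>

definition lt_pairs :: "nat \<Rightarrow> (nat \<times> nat) set" where
  "lt_pairs n = {(i, j). i < j \<and> j < n}"

definition qW_factor :: "real \<Rightarrow> complex \<Rightarrow> complex \<Rightarrow> complex" where
  "qW_factor q x y = (1 - y / x) / (1 - of_real q * (y / x))"

definition qW_kernel :: "real \<Rightarrow> nat \<Rightarrow> (nat \<Rightarrow> complex) \<Rightarrow> complex" where
  "qW_kernel q n p = (\<Prod>(i, j)\<in>lt_pairs n. qW_factor q (p i) (p j))"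

lemma finite_lt_pairs [simp]: "finite (lt_pairs n)"
  by (rule finite_subset[of _ "{..<n} \<times> {..<n}"]) (auto simp: lt_pairs_def)

lemma lt_pairs_Suc: "lt_pairs (Suc n) = lt_pairs n \<union> (\<lambda>i. (i, n)) ` {..<n}"
  by (auto simp: lt_pairs_def less_Suc_eq)

lemma qW_kernel_Suc: "qW_kernel q (Suc n) p = qW_kernel q n p * (\<Prod>i<n. qW_factor q (p i) (p n))"
proof -
  have "inj_on (\<lambda>i. (i, n)) {..<n}" by (auto simp: inj_on_def)
  moreover have "lt_pairs n \<inter> (\<lambda>i. (i, n)) ` {..<n} = {}" by (auto simp: lt_pairs_def)
  ultimately show ?thesis
    unfolding qW_kernel_def lt_pairs_Suc by (subst prod.union_disjoint) (auto simp: prod.reindex)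
qed

lemma qW_kernel_cong: "(\<And>i. i < n \<Longrightarrow> p i = p' i) \<Longrightarrow> qW_kernel q n p = qW_kernel q n p'"
  unfolding qW_kernel_def by (intro prod.cong) (auto simp: lt_pairs_def)

lemma one_minus_nz:
  fixes z :: complex assumes "0 \<le> q" "q < 1" "norm z = 1" shows "1 - of_real q * z \<noteq> 0"
proof
  assume "1 - of_real q * z = 0"
  hence "of_real q * z = 1" by simp
  hence "norm (of_real q * z) = 1" by simp
  thus False using assms by (simp add: norm_mult)
qed

text \<open>The factor is (x - y) / (x - q y), and multiplying it by 1/y - q/x = (x - q y) / (x y)
  leaves the antisymmetric (x - y) / (x y). All other pairs of the kernel are merely permuted by an
  adjacent swap.\<close>

lemma qW_factor_swap:
  assumes "0 \<le> q" "q < 1" "norm x = 1" "norm y = 1"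
  shows "qW_factor q y x * (1 / x - of_real q / y) = - qW_factor q x y * (1 / y - of_real q / x)"
proof -
  have nz: "x \<noteq> 0" "y \<noteq> 0" using assms by auto
  have "1 - of_real q * (y / x) \<noteq> 0" "1 - of_real q * (x / y) \<noteq> 0"
    using assms by (intro one_minus_nz; simp add: norm_divide)+
  hence "x - of_real q * y \<noteq> 0" "y - of_real q * x \<noteq> 0" using nz by (auto simp: field_simps)
  thus ?thesis using nz by (simp add: qW_factor_def divide_simps)
qed

lemma exchange_kernel_qW:
  assumes q: "0 \<le> q" "q < 1" shows "exchange_kernel q n (qW_kernel q n)"
  unfolding exchange_kernel_def
proof (intro allI impI)
  fix p :: "nat \<Rightarrow> complex" and i assume i: "Suc i < n" and p: "\<forall>j<n. norm (p j) = 1"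
  let ?t = "transposition i (Suc i)"
  let ?T = "lt_pairs n - {(i, Suc i)}"
  let ?f = "qW_factor q"
  have mem: "(i, Suc i) \<in> lt_pairs n" using i by (simp add: lt_pairs_def)
  have K: "qW_kernel q n p' = ?f (p' i) (p' (Suc i)) * (\<Prod>(a, b)\<in>?T. ?f (p' a) (p' b))" for p'
    unfolding qW_kernel_def by (subst prod.remove[OF _ mem]) auto
  have "(\<Prod>(a, b)\<in>?T. ?f (p (?t a)) (p (?t b))) = (\<Prod>(a, b)\<in>?T. ?f (p a) (p b))"
    by (rule prod.reindex_bij_witness[where i = "map_prod ?t ?t" and j = "map_prod ?t ?t"])
       (use i in \<open>auto simp: lt_pairs_def Transposition.transpose_def split: if_splits\<close>)
  hence "qW_kernel q n (p \<circ> ?t) = ?f (p (Suc i)) (p i) * (\<Prod>(a, b)\<in>?T. ?f (p a) (p b))"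
    by (simp add: K)
  moreover have "?f (p (Suc i)) (p i) * (1 / p i - of_real q / p (Suc i)) = - ?f (p i) (p (Suc i)) * (1 / p (Suc i) - of_real q / p i)"
    using qW_factor_swap[OF q, of "p i" "p (Suc i)"] i p by simp
  moreover have "f' * d' = - f * d \<Longrightarrow> f' * H * d' = - (f * H) * d" for f f' d d' H :: complex
    by (metis (no_types, lifting) mult.commute mult.left_commute mult_minus_left)
  ultimately show "qW_kernel q n (p \<circ> ?t) * (1 / p i - of_real q / p (Suc i)) = - qW_kernel q n p * (1 / p (Suc i) - of_real q / p i)"
    by (simp only: K[of p])
qed

text \<open>As a function of the last point, the kernel has its poles at modulus
  \<open>1 / q\<close>; \<open>r\<close> is the midpoint of 1 and that radius. At
  \<open>u = 0\<close> every factor with the last point equals 1, which leaves the kernel in one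
  point fewer.\<close>

lemma qW_kernel_last:
  assumes q: "0 < q" "q < 1"
  obtains r R phi where "1 < r" "r < R"
    "\<And>g. g \<in> unit_tuples n \<Longrightarrow> phi g holomorphic_on ball 0 R"
    "bdd_on (unit_tuples n \<times> {u. norm u = r}) (\<lambda>(g, u). phi g u)"
    "\<And>g u. g \<in> unit_tuples n \<Longrightarrow> norm u = 1 \<Longrightarrow> qW_kernel q (Suc n) (g(n := u)) = phi g u"
    "\<And>g. phi g 0 = qW_kernel q n g"
proof
  define r where "r = (1 + 1 / q) / 2"
  define phi where "phi = (\<lambda>g u. qW_kernel q n g * (\<Prod>i<n. (1 - u / g i) * (1 / (1 - of_real q * (u / g i)))))"
  show "1 < r" "r < 1 / q" using q by (auto simp: r_def field_simps)
  hence qr: "q * r < 1" "0 < r" using q by (auto simp: field_simps)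
  show "phi g holomorphic_on ball 0 (1 / q)" if g: "g \<in> unit_tuples n" for g
  proof -
    have "1 - of_real q * (u / g i) \<noteq> 0" if "i < n" "u \<in> ball 0 (1 / q)" for i u
    proof
      assume "1 - of_real q * (u / g i) = 0"
      hence "of_real q * (u / g i) = 1" by simp
      hence "norm (of_real q * (u / g i)) = 1" by simp
      thus False using that g q by (simp add: norm_mult norm_divide unit_tuples_def field_simps)
    qed
    moreover have "g i \<noteq> 0" if "i < n" for i using g that by (auto simp: unit_tuples_def)
    ultimately show ?thesis unfolding phi_def by (intro holomorphic_intros) auto
  qed
  show "bdd_on (unit_tuples n \<times> {u. norm u = r}) (\<lambda>(g, u). phi g u)" (is "bdd_on ?S _")
  proof -
    have 1: "bdd_on ?S (\<lambda>s. 1 - snd s / fst s i)" if "i < n" for i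
    proof (rule bdd_onI[of _ _ "1 + r"])
      fix s assume "s \<in> ?S"
      thus "norm (1 - snd s / fst s i) \<le> 1 + r"
        using norm_triangle_ineq4[of 1 "snd s / fst s i"] that by (auto simp: norm_divide unit_tuples_def)
    qed
    have 2: "bdd_on ?S (\<lambda>s. 1 / (1 - of_real q * (snd s / fst s i)))" if "i < n" for i
    proof (rule bdd_onI[of _ _ "1 / (1 - q * r)"])
      fix s assume "s \<in> ?S"
      hence "norm (of_real q * (snd s / fst s i)) = q * r" using that q by (auto simp: norm_divide norm_mult unit_tuples_def)
      hence "1 - q * r \<le> norm (1 - of_real q * (snd s / fst s i))"
        using norm_triangle_ineq2[of 1 "of_real q * (snd s / fst s i)"] by simp
      thus "norm (1 / (1 - of_real q * (snd s / fst s i))) \<le> 1 / (1 - q * r)"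
        using qr by (simp add: norm_divide frac_le)
    qed
    have 3: "bdd_on ?S (\<lambda>s. qW_kernel q n (fst s))"
    proof -
      have "norm (qW_factor q (fst s i) (fst s j)) \<le> 2 / (1 - q)" if s: "s \<in> ?S" and ij: "(i, j) \<in> lt_pairs n" for s i j
      proof -
        define w where "w = fst s j / fst s i"
        have "i < n" "j < n" using ij by (auto simp: lt_pairs_def)
        hence u: "norm w = 1" using s by (auto simp: unit_tuples_def norm_divide w_def)
        have "norm (1 - w) \<le> 2" using norm_triangle_ineq4[of 1 w] u by simp
        moreover have "1 - q \<le> norm (1 - of_real q * w)"
          using norm_triangle_ineq2[of 1 "of_real q * w"] u q by (simp add: norm_mult)
        ultimately show ?thesis using q unfolding qW_factor_def w_def[symmetric] norm_divide[of "1 - w"] by (intro frac_le) auto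
      qed
      thus ?thesis unfolding qW_kernel_def case_prod_unfold
        by (intro bdd_on_prod bdd_onI[of _ _ "2 / (1 - q)"]) auto
    qed
    show ?thesis unfolding phi_def case_prod_unfold
      by (intro bdd_on_mult 3 bdd_on_prod 1 2) auto
  qed
  show "phi g 0 = qW_kernel q n g" for g by (simp add: phi_def)
  show "qW_kernel q (Suc n) (g(n := u)) = phi g u" for g u
  proof -
    have "qW_kernel q n (g(n := u)) = qW_kernel q n g" by (rule qW_kernel_cong) simp
    thus ?thesis by (simp add: qW_kernel_Suc phi_def qW_factor_def)
  qed
qed

text \<open>Averaging over the last point replaces it by 0, up to a geometric error, so the constant
  term does not change with \<open>n\<close>.\<close>

lemma tendsto_tavg_qW_kernel:
  assumes q: "0 < q" "q < 1"
  shows "(\<lambda>N. tavg n N (qW_kernel q n)) \<longlonglongrightarrow> 1"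
proof (induction n)
  case 0
  have "torus 0 N = {\<lambda>_. undefined}" for N by (simp add: torus_def)
  thus ?case by (simp add: tavg_def qW_kernel_def lt_pairs_def)
next
  case (Suc n)
  obtain r R phi where r: "1 < r" "r < R"
    and hol: "\<And>g. g \<in> unit_tuples n \<Longrightarrow> phi g holomorphic_on ball 0 R"
    and bd: "bdd_on (unit_tuples n \<times> {u. norm u = r}) (\<lambda>(g, u). phi g u)"
    and B: "\<And>g u. g \<in> unit_tuples n \<Longrightarrow> norm u = 1 \<Longrightarrow> qW_kernel q (Suc n) (g(n := u)) = phi g u"
    and p0: "\<And>g. phi g 0 = qW_kernel q n g"
    by (rule qW_kernel_last[OF q, of n]) blast
  obtain Bd where Bd: "\<And>g u. g \<in> unit_tuples n \<Longrightarrow> norm u = r \<Longrightarrow> norm (phi g u) \<le> Bd"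
    using bd unfolding bdd_on_def by fastforce
  have "(\<lambda>N. tavg (Suc n) N (qW_kernel q (Suc n)) - tavg n N (qW_kernel q n)) \<longlonglongrightarrow> 0"
  proof (rule tendsto_geometric_bound[OF r(1)])
    fix N :: nat assume N: "0 < N"
    let ?G = "PiE ({..<Suc n} - {n}) (\<lambda>_. {z::complex. z ^ N = 1})"
    have G: "?G = torus n N" by (simp add: torus_def lessThan_Suc)
    have "norm (tavg (Suc n) N (qW_kernel q (Suc n)) - (\<Sum>g\<in>?G. of_bool (0 = (0::nat)) * phi g 0) / of_nat N ^ (Suc n - 1))
      \<le> Bd * r ^ 0 * (r / (r - 1)) * (1 / r) ^ N"
    proof (rule tavg_coord[OF _ N r])
      fix g assume "g \<in> ?G"
      hence g: "g \<in> unit_tuples n" using torus_unit[OF N] G by simp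
      show "phi g holomorphic_on ball 0 R" by (rule hol[OF g])
      show "norm (phi g u) \<le> Bd" if "norm u = r" for u using Bd[OF g that] .
      fix u :: complex assume u: "u ^ N = 1"
      hence "norm u ^ N = 1 ^ N" by (simp flip: norm_power)
      hence u1: "norm u = 1" using power_eq_imp_eq_base[of "norm u" N 1] N by simp
      show "qW_kernel q (Suc n) (g(n := u)) = u ^ 0 * phi g u" using B[OF g u1] by simp
    qed simp
    thus "norm (tavg (Suc n) N (qW_kernel q (Suc n)) - tavg n N (qW_kernel q n)) \<le> Bd * (r / (r - 1)) * (1 / r) ^ N"
      unfolding G p0 by (simp add: tavg_def)
  qed
  from tendsto_add[OF this Suc.IH] show ?case by simp
qed

lemma prod_power_int: "z \<noteq> 0 \<Longrightarrow> (\<Prod>i<(n::nat). z powi e i) = (z :: complex) powi (\<Sum>i<n. e i)"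
  by (induction n) (auto simp: power_int_add)

lemma conj_part_zero: "conj_part (\<lambda>_. 0) j = 0"
  by (simp add: conj_part_def)

text \<open>The kernel is homogeneous of degree zero, while the column heights of a nonempty
  partition have positive sum, so a common rotation of the points kills the average.\<close>

lemma tendsto_tcoef_qW_kernel:
  assumes q: "0 < q" "q < 1" and lam: "is_partition lam" "lam 0 \<le> n"
  shows "(\<lambda>N. tcoef n (Suc N) (qW_kernel q n) (conj_part lam)) \<longlonglongrightarrow> (if lam = (\<lambda>_. 0) then 1 else 0)"
proof (cases "lam = (\<lambda>_. 0)")
  case True
  show ?thesis using LIMSEQ_Suc[OF tendsto_tavg_qW_kernel[OF q, of n]]
    by (simp add: True tcoef_def conj_part_zero)
next
  case False
  define d where "d = (\<Sum>i<n. - conj_part lam i)"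
  have l0: "0 < lam 0"
  proof (rule ccontr)
    assume "\<not> 0 < lam 0"
    hence "lam i = 0" for i using is_partition_antimono[OF lam(1), of 0 i] by simp
    thus False using False by (simp add: fun_eq_iff)
  qed
  have "0 < conj_part lam 0"
    unfolding conj_part_def using l0 finite_rows[OF lam(1), of 0] by (auto simp: card_gt_0_iff)
  moreover have "0 \<le> conj_part lam i" for i by (simp add: conj_part_def)
  ultimately have "0 < (\<Sum>i<n. conj_part lam i)" using l0 lam(2) by (intro sum_pos2[of _ 0]) auto
  hence d: "d \<noteq> 0" by (simp add: d_def sum_negf)
  have "tcoef n (Suc N) (qW_kernel q n) (conj_part lam) = 0" if N: "nat \<bar>d\<bar> < N" for N
    unfolding tcoef_def
  proof (rule tavg_homogeneous[OF _ d])
    fix p and z :: complex assume p: "p \<in> torus n (Suc N)" and z: "norm z = 1"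
    let ?p = "\<lambda>i. if i < n then z * p i else undefined"
    have z0: "z \<noteq> 0" using z by auto
    have "qW_kernel q n ?p = qW_kernel q n p"
      unfolding qW_kernel_def by (intro prod.cong refl) (auto simp: lt_pairs_def qW_factor_def z0)
    moreover have "(\<Prod>i<n. ?p i powi (- conj_part lam i)) = z powi d * (\<Prod>i<n. p i powi (- conj_part lam i))"
      by (simp add: d_def prod_power_int[OF z0, symmetric] power_int_mult_distrib prod.distrib)
    ultimately show "qW_kernel q n ?p * (\<Prod>i<n. ?p i powi (- conj_part lam i)) =
      z powi d * (qW_kernel q n p * (\<Prod>i<n. p i powi (- conj_part lam i)))" by simp
  qed (use N in simp)
  hence "\<forall>\<^sub>F N in sequentially. tcoef n (Suc N) (qW_kernel q n) (conj_part lam) = 0"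
    using eventually_gt_at_top[of "nat \<bar>d\<bar>"] by (rule eventually_mono[rotated])
  thus ?thesis using False by (simp add: tendsto_eventually)
qed

section \<open>Alternants and the Schur kernel\<close>

definition alternant :: "nat \<Rightarrow> (nat \<Rightarrow> nat) \<Rightarrow> (nat \<Rightarrow> complex) \<Rightarrow> complex" where
  "alternant n k p = (\<Sum>s | s permutes {..<n}. of_int (sign s) * (\<Prod>i<n. p i ^ k (s i)))"

lemma alternant_permute:
  assumes t: "t permutes {..<n}" shows "alternant n k (p \<circ> t) = of_int (sign t) * alternant n k p"
proof -
  have pt: "permutation t" using t permutation_permutes by blast
  have "alternant n k (p \<circ> t) = (\<Sum>s | s permutes {..<n}. of_int (sign t) * (of_int (sign (s \<circ> Hilbert_Choice.inv t)) * (\<Prod>i<n. p i ^ k ((s \<circ> Hilbert_Choice.inv t) i))))"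
    unfolding alternant_def
  proof (intro sum.cong refl)
    fix s assume s: "s \<in> {s. s permutes {..<n}}"
    have ps: "permutation s" using s permutation_permutes by blast
    have "(\<Prod>i<n. p i ^ k ((s \<circ> Hilbert_Choice.inv t) i)) = (\<Prod>i<n. p (t i) ^ k ((s \<circ> Hilbert_Choice.inv t) (t i)))"
      using prod.permute[OF t, of "\<lambda>i. p i ^ k ((s \<circ> Hilbert_Choice.inv t) i)"] by (simp add: o_def)
    also have "\<dots> = (\<Prod>i<n. (p \<circ> t) i ^ k (s i))"
      using permutes_inverses(2)[OF t] by simp
    finally have 1: "(\<Prod>i<n. p i ^ k ((s \<circ> Hilbert_Choice.inv t) i)) = (\<Prod>i<n. (p \<circ> t) i ^ k (s i))" .
    have "sign (s \<circ> Hilbert_Choice.inv t) = sign s * sign t"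
      using sign_compose[OF ps permutation_inverse[OF pt]] sign_inverse[OF pt] by simp
    hence 2: "sign t * sign (s \<circ> Hilbert_Choice.inv t) = sign s" using sign_idempotent[of t] by (simp add: mult_ac)
    show "of_int (sign s) * (\<Prod>i<n. (p \<circ> t) i ^ k (s i)) =
      of_int (sign t) * (of_int (sign (s \<circ> Hilbert_Choice.inv t)) * (\<Prod>i<n. p i ^ k ((s \<circ> Hilbert_Choice.inv t) i)))"
      unfolding 1 by (simp add: mult.assoc[symmetric] 2 flip: of_int_mult)
  qed
  also have "\<dots> = of_int (sign t) * (\<Sum>s | s permutes {..<n}. (of_int (sign (s \<circ> Hilbert_Choice.inv t)) * (\<Prod>i<n. p i ^ k ((s \<circ> Hilbert_Choice.inv t) i))))"
    by (simp add: sum_distrib_left)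
  also have "(\<Sum>s | s permutes {..<n}. (of_int (sign (s \<circ> Hilbert_Choice.inv t)) * (\<Prod>i<n. p i ^ k ((s \<circ> Hilbert_Choice.inv t) i)))) = alternant n k p"
    unfolding alternant_def
    by (rule sum.reindex_bij_witness[where i = "\<lambda>s. s \<circ> t" and j = "\<lambda>s. s \<circ> Hilbert_Choice.inv t"])
       (use t in \<open>auto simp: o_assoc[symmetric] permutes_inv_o permutes_compose permutes_inv\<close>)
  finally show ?thesis .
qed

text \<open>Column heights shifted by n - 1, ..., 1, 0, as in the bialternant formula for the Schur
  polynomial of the conjugate partition.\<close>

definition staircase :: "nat \<Rightarrow> (nat \<Rightarrow> nat) \<Rightarrow> nat \<Rightarrow> nat" where
  "staircase n lam j = card {i. j < lam i} + (n - Suc j)"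

text \<open>For \<open>k = staircase n rho\<close> this is the Schur polynomial of the conjugate of
  \<open>rho\<close> times the \<open>q = 0\<close> case of \<open>qW_kernel\<close>, since the
  monomial turns each Vandermonde factor x - y into 1 - y/x. In this form the coefficients can be
  read off.\<close>

definition schur_kernel :: "nat \<Rightarrow> (nat \<Rightarrow> nat) \<Rightarrow> (nat \<Rightarrow> complex) \<Rightarrow> complex" where
  "schur_kernel n k p = alternant n k p * (\<Prod>i<n. p i powi (- int (n - Suc i)))"

text \<open>The alternant changes sign under the swap, and the monomial, whose exponents at the two
  places differ by one, gains the factor \<open>p i / p (Suc i)\<close>.\<close>

lemma exchange_kernel_schur: "exchange_kernel 0 n (schur_kernel n k)"
  unfolding exchange_kernel_def
proof (intro allI impI)
  fix p :: "nat \<Rightarrow> complex" and i assume i: "Suc i < n" and p: "\<forall>j<n. norm (p j) = 1"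
  let ?t = "transposition i (Suc i)"
  have t: "?t permutes {..<n}" using i by (intro permutes_swap_id) auto
  have "norm (p i) = 1" "norm (p (Suc i)) = 1" using i p by auto
  hence nz: "p i \<noteq> 0" "p (Suc i) \<noteq> 0" by auto
  have "sign ?t = -1" by (simp add: sign_swap_id)
  hence a: "alternant n k (p \<circ> ?t) = - alternant n k p"
    using alternant_permute[OF t, of k p] by simp
  define P where "P p' = (\<Prod>j<n. p' j powi (- int (n - Suc j)))" for p' :: "nat \<Rightarrow> complex"
  define a where "a = n - Suc (Suc i)"
  have "- int (n - Suc i) = - int a - 1" using i by (simp add: a_def)
  hence e: "x powi (- int (n - Suc i)) = x powi (- int a) / x" if "x \<noteq> 0" for x :: complex
    using that by (simp only: power_int_diff power_int_1_right simp_thms)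
  have D: "P p' = p' i powi (- int (n - Suc i)) * (p' (Suc i) powi (- int a) * (\<Prod>j\<in>{..<n} - {i} - {Suc i}. p' j powi (- int (n - Suc j))))" for p'
    unfolding P_def a_def using i by (subst prod.remove[of _ i], simp, simp, subst prod.remove[of _ "Suc i"]) auto
  have "(\<Prod>j\<in>{..<n} - {i} - {Suc i}. (p \<circ> ?t) j powi (- int (n - Suc j))) = (\<Prod>j\<in>{..<n} - {i} - {Suc i}. p j powi (- int (n - Suc j)))"
    by (intro prod.cong) (auto simp: Transposition.transpose_def)
  hence "P (p \<circ> ?t) * (1 / p i) = P p * (1 / p (Suc i))"
    unfolding D using nz by (simp add: e mult_ac)
  hence "(- alternant n k p) * P (p \<circ> ?t) * (1 / p i) = - (alternant n k p * P p) * (1 / p (Suc i))"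
    by (metis mult.assoc mult_minus_left)
  thus "schur_kernel n k (p \<circ> ?t) * (1 / p i - of_real 0 / p (Suc i)) = - schur_kernel n k p * (1 / p (Suc i) - of_real 0 / p i)"
    unfolding schur_kernel_def a P_def[symmetric] by (simp only: of_real_0 div_0 diff_zero)
qed

text \<open>The monomial has exponent zero at the last point, so the kernel is a polynomial there.
  The radii 2 and 3 are arbitrary.\<close>

lemma schur_kernel_last:
  obtains phi :: "(nat \<Rightarrow> complex) \<Rightarrow> complex \<Rightarrow> complex" where
    "\<And>g. g \<in> unit_tuples n \<Longrightarrow> phi g holomorphic_on ball 0 3"
    "bdd_on (unit_tuples n \<times> {u. norm u = 2}) (\<lambda>(g, u). phi g u)"
    "\<And>g u. g \<in> unit_tuples n \<Longrightarrow> norm u = 1 \<Longrightarrow> schur_kernel (Suc n) k (g(n := u)) = phi g u"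
proof
  define phi where "phi = (\<lambda>(g :: nat \<Rightarrow> complex) (u :: complex). (\<Sum>s | s permutes {..<Suc n}. of_int (sign s) * ((\<Prod>i<n. g i ^ k (s i)) * u ^ k (s n)))
       * (\<Prod>i<n. g i powi (- int (Suc n - Suc i))))"
  show "phi g holomorphic_on ball 0 3" if "g \<in> unit_tuples n" for g
    unfolding phi_def by (intro holomorphic_intros)
  show "bdd_on (unit_tuples n \<times> {u. norm u = 2}) (\<lambda>(g, u). phi g u)" (is "bdd_on ?S _")
    unfolding phi_def case_prod_unfold
  proof (intro bdd_on_mult bdd_on_sum bdd_on_prod bdd_on_const)
    fix s i assume "i \<in> {..<n}"
    thus "bdd_on ?S (\<lambda>x. fst x i ^ k (s i))" by (intro bdd_onI[of _ _ 1]) (auto simp: unit_tuples_def norm_power)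
  next
    fix s
    show "bdd_on ?S (\<lambda>x. snd x ^ k (s n))" by (intro bdd_onI[of _ _ "2 ^ k (s n)"]) (auto simp: norm_power)
  next
    fix i assume "i \<in> {..<n}"
    thus "bdd_on ?S (\<lambda>x. fst x i powi (- int (Suc n - Suc i)))" by (intro bdd_onI[of _ _ 1]) (auto simp: unit_tuples_def norm_power_int)
  qed (auto intro: finite_permutations)
  show "schur_kernel (Suc n) k (g(n := u)) = phi g u" for g u
    by (simp add: schur_kernel_def alternant_def phi_def)
qed

lemma tavg_monomial:
  assumes e: "\<And>i. i < n \<Longrightarrow> nat \<bar>e i\<bar> < N" and N: "0 < N"
  shows "tavg n N (\<lambda>p. \<Prod>i<n. p i powi e i) = of_bool (\<forall>i<n. e i = 0)"
proof (cases "\<forall>i<n. e i = 0")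
  case True
  hence "(\<Prod>i<n. p i powi e i) = 1" for p :: "nat \<Rightarrow> complex" by simp
  thus ?thesis using N card_torus[OF N, of "{..<n}"] True by (simp add: tavg_def torus_def)
next
  case False
  then obtain i where i: "i < n" "e i \<noteq> 0" by blast
  have "(\<Sum>u | u ^ N = (1::complex). u powi e i) = 0"
  proof (cases "0 < e i")
    case True
    thus ?thesis using sum_roots_unity_power[of "nat (e i)" N] e[OF i(1)] by (simp add: power_int_def)
  next
    case neg: False
    have "(\<Sum>u | u ^ N = (1::complex). u powi e i) = (\<Sum>u | u ^ N = (1::complex). u ^ nat (- e i))"
      by (rule sum.reindex_bij_witness[where i = inverse and j = inverse])
         (use neg i in \<open>auto simp: power_int_def power_inverse\<close>)
    thus ?thesis using sum_roots_unity_power[of "nat (- e i)" N] e[OF i(1)] i neg by simp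
  qed
  hence "(\<Prod>i<n. \<Sum>u | u ^ N = (1::complex). u powi e i) = 0" using i by (intro prod_zero) auto
  moreover have "(\<Prod>i<n. \<Sum>u | u ^ N = (1::complex). u powi e i) = (\<Sum>p\<in>torus n N. \<Prod>i<n. p i powi e i)"
    unfolding torus_def by (rule prod_sum_PiE) (use N in \<open>auto intro: finite_roots_unity\<close>)
  ultimately show ?thesis using False by (simp add: tavg_def)
qed

lemma staircase_strict:
  assumes "is_partition lam" "i < j" "j < n" shows "staircase n lam j < staircase n lam i"
proof -
  have "card {k. j < lam k} \<le> card {k. i < lam k}"
    using assms by (intro card_mono finite_rows) auto
  thus ?thesis using assms by (simp add: staircase_def)
qed

text \<open>If \<open>lam i < rho i\<close>, then the column \<open>lam i\<close> has at most
  \<open>i\<close> boxes in \<open>lam\<close> but more than \<open>i\<close> in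
  \<open>rho\<close>.\<close>

lemma staircase_inj:
  assumes "is_partition lam" "lam 0 \<le> n" "is_partition rho" "rho 0 \<le> n"
    and eq: "\<And>i. i < n \<Longrightarrow> staircase n lam i = staircase n rho i"
  shows "lam = rho"
proof -
  have False if p: "is_partition lam" "is_partition rho" "rho 0 \<le> n"
     and eq: "\<And>i. i < n \<Longrightarrow> staircase n lam i = staircase n rho i" and i: "lam i < rho i" for lam rho i
  proof -
    let ?j = "lam i"
    have jn: "?j < n" using i p(3) is_partition_antimono[OF p(2), of 0 i] by simp
    have "{k. ?j < lam k} \<subseteq> {..<i}"
      using is_partition_antimono[OF p(1), of i] by (auto simp: not_le[symmetric])
    hence "card {k. ?j < lam k} \<le> i" using card_mono[of "{..<i}"] by fastforce
    moreover have "{..i} \<subseteq> {k. ?j < rho k}"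
      using i is_partition_antimono[OF p(2), of _ i] by (auto intro: less_le_trans)
    hence "Suc i \<le> card {k. ?j < rho k}" using card_mono[OF finite_rows[OF p(2)], of "{..i}" ?j] by simp
    ultimately show False using eq[OF jn] by (simp add: staircase_def)
  qed
  from this[of lam rho] this[of rho lam] assms show ?thesis by (metis ext nat_neq_iff)
qed

text \<open>Such an \<open>s\<close> is increasing, hence \<open>i \<le> s i\<close>, and since
  \<open>s\<close> preserves the sum of all indices no inequality can be strict.\<close>

lemma strict_perm_unique:
  fixes k l :: "nat \<Rightarrow> nat"
  assumes k: "\<And>i j. i < j \<Longrightarrow> j < n \<Longrightarrow> k j < k i" and l: "\<And>i j. i < j \<Longrightarrow> j < n \<Longrightarrow> l j < l i"
    and s: "s permutes {..<n}" and eq: "\<And>i. i < n \<Longrightarrow> k (s i) = l i"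
  shows "s = id"
proof -
  have mono: "s i < s j" if "i < j" "j < n" for i j
  proof -
    have "s i < n" "s j < n" using permutes_in_image[OF s] that by auto
    moreover have "k (s j) < k (s i)" using eq l[OF that] that by simp
    ultimately show ?thesis using k[of "s j" "s i"] by (metis less_asym nat_neq_iff)
  qed
  have ge: "i \<le> s i" if "i < n" for i
    using that
  proof (induction i)
    case (Suc i)
    thus ?case using mono[of i "Suc i"] by simp
  qed simp
  have "s i = i" for i
  proof (cases "i < n")
    case True
    have "(\<Sum>i<n. s i) = (\<Sum>i<n. i)" using sum.permute[OF s, of "\<lambda>i. i"] by simp
    hence "(\<Sum>i<n. i) = (\<Sum>i<n. s i)" ..
    from sum_mono_inv[OF this] ge True show ?thesis by (metis finite_lessThan lessThan_iff)
  next
    case False thus ?thesis using s by (simp add: permutes_not_in)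
  qed
  thus ?thesis by auto
qed

text \<open>A term of the alternant survives only if \<open>s\<close> matches two strictly
  decreasing sequences, which forces \<open>s = id\<close> and equal partitions. The value is exact
  once \<open>N\<close> exceeds \<open>M\<close>, a crude bound for all exponents involved that
  excludes aliasing.\<close>

lemma tendsto_tcoef_schur_kernel:
  assumes rho: "is_partition rho" "rho 0 \<le> n" and lam: "is_partition lam" "lam 0 \<le> n"
  shows "(\<lambda>N. tcoef n (Suc N) (schur_kernel n (staircase n rho)) (conj_part lam)) \<longlonglongrightarrow> (if lam = rho then 1 else 0)"
proof -
  let ?k = "staircase n rho" and ?l = "staircase n lam"
  define M where "M = (\<Sum>i<n. ?k i) + (\<Sum>i<n. ?l i)"
  have "tcoef n (Suc N) (schur_kernel n ?k) (conj_part lam) = (if lam = rho then 1 else 0)" if N: "M < N" for N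
  proof -
    have mono: "alternant n ?k p * (\<Prod>i<n. p i powi (- int (n - Suc i))) * (\<Prod>i<n. p i powi (- conj_part lam i))
       = (\<Sum>s | s permutes {..<n}. of_int (sign s) * (\<Prod>i<n. p i powi (int (?k (s i)) - int (?l i))))"
      if p: "p \<in> torus n (Suc N)" for p
      unfolding alternant_def sum_distrib_right
    proof (intro sum.cong refl)
      fix s
      have "p i powi (int (?k (s i)) - int (?l i)) = p i ^ ?k (s i) * p i powi (- int (n - Suc i)) * p i powi (- conj_part lam i)" if "i < n" for i
      proof -
        have nz: "p i \<noteq> 0" using torus_nz[OF p _ that] by simp
        have "int (?k (s i)) - int (?l i) = int (?k (s i)) + (- int (n - Suc i)) + (- conj_part lam i)"
          by (simp add: staircase_def conj_part_def)
        hence "p i powi (int (?k (s i)) - int (?l i)) = p i powi (int (?k (s i)) + (- int (n - Suc i)) + (- conj_part lam i))"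
          by (rule arg_cong)
        also have "\<dots> = p i powi int (?k (s i)) * p i powi (- int (n - Suc i)) * p i powi (- conj_part lam i)"
          using nz by (simp only: power_int_add simp_thms)
        finally show ?thesis by simp
      qed
      thus "of_int (sign s) * (\<Prod>i<n. p i ^ ?k (s i)) * (\<Prod>i<n. p i powi (- int (n - Suc i))) * (\<Prod>i<n. p i powi (- conj_part lam i))
        = of_int (sign s) * (\<Prod>i<n. p i powi (int (?k (s i)) - int (?l i)))"
        by (simp add: prod.distrib mult.assoc)
    qed
    have S: "(\<Sum>p\<in>torus n (Suc N). alternant n ?k p * (\<Prod>i<n. p i powi (- int (n - Suc i))) * (\<Prod>i<n. p i powi (- conj_part lam i)))
       = (\<Sum>p\<in>torus n (Suc N). \<Sum>s | s permutes {..<n}. of_int (sign s) * (\<Prod>i<n. p i powi (int (?k (s i)) - int (?l i))))"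
      by (intro sum.cong refl mono)
    have "tcoef n (Suc N) (schur_kernel n ?k) (conj_part lam) =
      (\<Sum>s | s permutes {..<n}. of_int (sign s) * tavg n (Suc N) (\<lambda>p. \<Prod>i<n. p i powi (int (?k (s i)) - int (?l i))))"
      unfolding tcoef_def tavg_def schur_kernel_def S
      by (subst sum.swap) (simp add: sum_divide_distrib sum_distrib_left)
    also have "\<dots> = (\<Sum>s | s permutes {..<n}. of_int (sign s) * of_bool (\<forall>i<n. int (?k (s i)) - int (?l i) = 0))"
    proof (intro sum.cong refl arg_cong2[where f = times] tavg_monomial)
      fix s i assume s: "s \<in> {s. s permutes {..<n}}" and i: "i < n"
      have "s i < n" using s i permutes_in_image[of s "{..<n}" i] by simp
      hence "?k (s i) \<le> (\<Sum>i<n. ?k i)" "?l i \<le> (\<Sum>i<n. ?l i)"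
        using i by (auto intro!: member_le_sum)
      thus "nat \<bar>int (?k (s i)) - int (?l i)\<bar> < Suc N" using N by (simp add: M_def)
    qed simp
    also have "\<dots> = (\<Sum>s\<in>{id}. of_int (sign s) * of_bool (\<forall>i<n. int (?k (s i)) - int (?l i) = 0))"
    proof (rule sum.mono_neutral_right)
      show "\<forall>s\<in>{s. s permutes {..<n}} - {id}. of_int (sign s) * of_bool (\<forall>i<n. int (?k (s i)) - int (?l i) = 0) = (0::complex)"
        using strict_perm_unique[OF staircase_strict[OF rho(1)] staircase_strict[OF lam(1)]] by auto
    qed (auto intro: finite_permutations permutes_id)
    also have "\<dots> = (if lam = rho then 1 else 0)"
      using staircase_inj[OF lam rho] by auto
    finally show ?thesis .
  qed
  hence "\<forall>\<^sub>F N in sequentially. tcoef n (Suc N) (schur_kernel n ?k) (conj_part lam) = (if lam = rho then 1 else 0)"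
    using eventually_gt_at_top[of M] by (rule eventually_mono[rotated])
  thus ?thesis by (rule tendsto_eventually)
qed

section \<open>The Cauchy determinant\<close>

text \<open>After the last row has cleared the last column, the new entries factor because c_in c_nj
  - c_nn c_ij = (x_i - x_n)(y_j - y_n). What is left is the smaller Cauchy matrix with rescaled rows
  and columns.\<close>

lemma cauchy_det_mat:
  fixes x y :: "nat \<Rightarrow> 'a :: field"
  assumes "\<And>i j. i < n \<Longrightarrow> j < n \<Longrightarrow> 1 - x i * y j \<noteq> 0"
  shows "det (mat n n (\<lambda>(i, j). 1 / (1 - x i * y j))) =
    (\<Prod>j<n. \<Prod>i<j. (x j - x i) * (y j - y i)) / (\<Prod>i<n. \<Prod>j<n. 1 - x i * y j)"
  using assms
proof (induction n)
  case 0
  have "det (mat 0 0 (\<lambda>(i, j). 1 / (1 - x i * y j))) = 1" by (rule det_dim_zero) simp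
  thus ?case by simp
next
  case (Suc n)
  define c where "c i j = 1 - x i * y j" for i j
  have nz: "c i j \<noteq> 0" if "i < Suc n" "j < Suc n" for i j using Suc.prems[OF that] by (simp add: c_def)
  define A where "A = mat (Suc n) (Suc n) (\<lambda>(i, j). 1 / c i j)"
  \<comment> \<open>Left multiplication by \<open>L\<close> subtracts \<open>c n n / c i n\<close>
    times row \<open>n\<close> from row \<open>i\<close>, which makes the entry in column
    \<open>n\<close> zero.\<close>
  define L where "L = mat (Suc n) (Suc n) (\<lambda>(i, j). if i = j then 1 else if i < n \<and> j = n then - (c n n / c i n) else 0)"
  define M where "M = mat (Suc n) (Suc n) (\<lambda>(i, j). if i = n then 1 / c n j else 1 / c i j - c n n / c i n * (1 / c n j))"
  have LA: "L * A = M"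
  proof (rule eq_matI)
    fix i j assume ij: "i < dim_row M" "j < dim_col M"
    hence ij: "i < Suc n" "j < Suc n" by (auto simp: M_def)
    have "(L * A) $$ (i, j) = (\<Sum>k<Suc n. L $$ (i, k) * A $$ (k, j))"
      using ij by (simp add: L_def A_def scalar_prod_def lessThan_atLeast0)
    also have "\<dots> = (\<Sum>k\<in>(if i = n then {n} else {i, n}). L $$ (i, k) * A $$ (k, j))"
      using ij by (intro sum.mono_neutral_right) (auto simp: L_def)
    also have "\<dots> = M $$ (i, j)" using ij by (auto simp: L_def A_def M_def)
    finally show "(L * A) $$ (i, j) = M $$ (i, j)" .
  qed (auto simp: L_def A_def M_def)
  have "upper_triangular L" by (auto simp: L_def)
  hence "det L = prod_list (diag_mat L)" by (rule det_upper_triangular[of L "Suc n"]) (simp add: L_def)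
  also have "diag_mat L = replicate (Suc n) 1"
    by (intro nth_equalityI) (auto simp: diag_mat_def L_def simp del: replicate_Suc upt_Suc)
  finally have detL: "det L = 1" by simp
  have "det A = det M"
    using det_mult[of L "Suc n" A] LA detL by (simp add: L_def A_def)
  also have "\<dots> = (\<Sum>i<Suc n. M $$ (i, n) * cofactor M i n)"
    by (rule laplace_expansion_column) (auto simp: M_def)
  also have "\<dots> = (\<Sum>i\<in>{n}. M $$ (i, n) * cofactor M i n)"
    using nz by (intro sum.mono_neutral_right) (auto simp: M_def)
  also have "\<dots> = 1 / c n n * det (mat_delete M n n)"
    by (simp add: M_def cofactor_def)
  also have "mat_delete M n n = mat n n (\<lambda>(i, j). (x i - x n) / c i n * ((y j - y n) / c n j) * (1 / c i j))"
  proof (rule eq_matI)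
    fix i j assume ij: "i < dim_row (mat n n (\<lambda>(i, j). (x i - x n) / c i n * ((y j - y n) / c n j) * (1 / c i j)))"
      "j < dim_col (mat n n (\<lambda>(i, j). (x i - x n) / c i n * ((y j - y n) / c n j) * (1 / c i j)))"
    hence ij: "i < n" "j < n" by auto
    have "1 / c i j - c n n / c i n * (1 / c n j) = (c i n * c n j - c n n * c i j) / (c i n * c n j * c i j)"
      using nz[of i j] nz[of i n] nz[of n j] ij by (simp add: field_simps)
    also have "c i n * c n j - c n n * c i j = (x i - x n) * (y j - y n)"
      by (simp add: c_def algebra_simps)
    finally show "mat_delete M n n $$ (i, j) = mat n n (\<lambda>(i, j). (x i - x n) / c i n * ((y j - y n) / c n j) * (1 / c i j)) $$ (i, j)"
      using ij by (simp add: mat_delete_def M_def)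
  qed (auto simp: mat_delete_def M_def)
  also have "det (mat n n (\<lambda>(i, j). (x i - x n) / c i n * ((y j - y n) / c n j) * (1 / c i j))) =
     (\<Prod>i<n. (x i - x n) / c i n) * (\<Prod>j<n. (y j - y n) / c n j) * det (mat n n (\<lambda>(i, j). 1 / c i j))"
  proof -
    have "(\<Prod>i = 0..<n. (x i - x n) / c i n * ((y (p i) - y n) / c n (p i)) * (1 / c i (p i))) =
      (\<Prod>i<n. (x i - x n) / c i n) * (\<Prod>j<n. (y j - y n) / c n j) * (\<Prod>i = 0..<n. 1 / c i (p i))"
      if "p permutes {0..<n}" for p
      using prod.permute[OF that, of "\<lambda>j. (y j - y n) / c n j"]
      by (simp only: prod.distrib lessThan_atLeast0 o_def)
    moreover have "p i < n" if "p permutes {0..<n}" "i < n" for p i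
      using permutes_in_image[OF that(1), of i] that(2) by simp
    ultimately show ?thesis
      by (simp add: det_def sum_distrib_left mult_ac cong: prod.cong_simp)
  qed
  also have "det (mat n n (\<lambda>(i, j). 1 / c i j)) = (\<Prod>j<n. \<Prod>i<j. (x j - x i) * (y j - y i)) / (\<Prod>i<n. \<Prod>j<n. c i j)"
    unfolding c_def using Suc.prems by (intro Suc.IH) auto
  finally have "det A = 1 / c n n * ((\<Prod>i<n. (x i - x n) / c i n) * (\<Prod>j<n. (y j - y n) / c n j) *
     ((\<Prod>j<n. \<Prod>i<j. (x j - x i) * (y j - y i)) / (\<Prod>i<n. \<Prod>j<n. c i j)))" .
  also have "\<dots> = ((\<Prod>i<n. (x i - x n) * (y i - y n)) * (\<Prod>j<n. \<Prod>i<j. (x j - x i) * (y j - y i))) /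
     (c n n * (\<Prod>i<n. c i n) * (\<Prod>j<n. c n j) * (\<Prod>i<n. \<Prod>j<n. c i j))"
    by (simp add: prod_dividef prod.distrib)
  also have "(\<Prod>i<n. (x i - x n) * (y i - y n)) = (\<Prod>i<n. (x n - x i) * (y n - y i))"
    by (intro prod.cong) (auto simp: algebra_simps)
  also have "c n n * (\<Prod>i<n. c i n) * (\<Prod>j<n. c n j) * (\<Prod>i<n. \<Prod>j<n. c i j) = (\<Prod>i<Suc n. \<Prod>j<Suc n. c i j)"
    by (simp add: prod.distrib mult_ac)
  finally show ?case by (simp add: A_def c_def mult_ac)
qed

lemma cauchy_det:
  fixes x y :: "nat \<Rightarrow> 'a :: field"
  assumes "\<And>i j. i < n \<Longrightarrow> j < n \<Longrightarrow> 1 - x i * y j \<noteq> 0"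
  shows "(\<Sum>s | s permutes {..<n}. of_int (sign s) * (\<Prod>i<n. 1 / (1 - x i * y (s i)))) =
    (\<Prod>j<n. \<Prod>i<j. (x j - x i) * (y j - y i)) / (\<Prod>i<n. \<Prod>j<n. 1 - x i * y j)"
proof -
  have "p i < n" if "p permutes {0..<n}" "i < n" for p i
    using permutes_in_image[OF that(1), of i] that(2) by simp
  hence "det (mat n n (\<lambda>(i, j). 1 / (1 - x i * y j))) =
    (\<Sum>s | s permutes {..<n}. of_int (sign s) * (\<Prod>i<n. 1 / (1 - x i * y (s i))))"
    by (simp add: det_def lessThan_atLeast0 cong: prod.cong_simp)
  thus ?thesis using cauchy_det_mat[OF assms] by simp
qed

section \<open>Symmetrization of the kernels\<close>

text \<open>The monic polynomials \<open>f\<close> and \<open>h\<close> have the same degree, so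
  \<open>f - h\<close> has degree below \<open>card S\<close> and coincides with its Lagrange
  interpolant at the points \<open>p b\<close>. There \<open>h\<close> vanishes, so the interpolant
  is \<open>L\<close>, built from values of \<open>f\<close> alone. Comparing values at 0 and
  cancelling the product \<open>P\<close> gives the claim.\<close>

lemma lagrange_sum:
  fixes p :: "'i \<Rightarrow> complex" and q :: complex
  assumes S: "finite S" "inj_on p S" "\<And>i. i \<in> S \<Longrightarrow> p i \<noteq> 0" and q: "q \<noteq> 1"
  shows "(\<Sum>b\<in>S. \<Prod>j\<in>S - {b}. (p b - q * p j) / (p b - p j)) = (1 - q ^ card S) / (1 - q)"
proof (cases "S = {}")
  case False
  define f where "f = (\<Prod>j\<in>S. [:- (q * p j), 1:])"
  define h where "h = (\<Prod>j\<in>S. [:- p j, 1:])"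
  define c where "c b = poly f (p b) / (\<Prod>j\<in>S - {b}. p b - p j)" for b
  define L where "L = (\<Sum>b\<in>S. Polynomial.smult (c b) (\<Prod>j\<in>S - {b}. [:- p j, 1:]))"
  let ?d = "f - h - L"
  have deg: "degree f = card S" "degree h = card S" unfolding f_def h_def
    by (subst degree_prod_sum_eq; simp)+
  have lead: "lead_coeff f = 1" "lead_coeff h = 1"
    unfolding f_def h_def by (simp_all add: lead_coeff_prod)
  have card0: "0 < card S" using False S by (simp add: card_gt_0_iff)
  have "degree (f - h) < card S"
  proof (rule degree_lessI)
    show "f - h \<noteq> 0 \<or> 0 < card S" using card0 by simp
    show "\<forall>k\<ge>card S. coeff (f - h) k = 0"
      using deg lead by (metis coeff_diff coeff_eq_0 diff_self le_neq_implies_less)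
  qed
  moreover have "degree L < card S"
  proof -
    have "degree (Polynomial.smult (c b) (\<Prod>j\<in>S - {b}. [:- p j, 1:])) \<le> card S - 1" if "b \<in> S" for b
    proof -
      have "degree (\<Prod>j\<in>S - {b}. [:- p j, 1:]) = card S - 1"
        by (subst degree_prod_sum_eq) (use S that in simp_all)
      thus ?thesis using degree_smult_le[of "c b"] by metis
    qed
    hence "degree L \<le> card S - 1" unfolding L_def by (intro degree_sum_le S(1)) auto
    thus ?thesis using card0 by simp
  qed
  ultimately have degd: "degree ?d < card S"
    using degree_diff_le_max[of "f - h" L] by linarith
  have root: "poly ?d (p a) = 0" if a: "a \<in> S" for a
  proof -
    have "poly h (p a) = 0" using a S(1) unfolding h_def poly_prod by (intro prod_zero) auto
    moreover have "poly L (p a) = (\<Sum>b\<in>{a}. c b * (\<Prod>j\<in>S - {b}. p a - p j))"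
    proof -
      have "poly L (p a) = (\<Sum>b\<in>S. c b * (\<Prod>j\<in>S - {b}. p a - p j))"
        by (simp add: L_def poly_sum poly_prod)
      also have "\<dots> = (\<Sum>b\<in>{a}. c b * (\<Prod>j\<in>S - {b}. p a - p j))"
      proof (rule sum.mono_neutral_right)
        show "\<forall>b\<in>S - {a}. c b * (\<Prod>j\<in>S - {b}. p a - p j) = 0"
        proof
          fix b assume b: "b \<in> S - {a}"
          have "(\<Prod>j\<in>S - {b}. p a - p j) = 0" using a b S(1) by (intro prod_zero) auto
          thus "c b * (\<Prod>j\<in>S - {b}. p a - p j) = 0" by simp
        qed
      qed (use S a in auto)
      finally show ?thesis .
    qed
    moreover have "(\<Prod>j\<in>S - {a}. p a - p j) \<noteq> 0"
      using S(1,2) a by (auto simp: inj_on_def)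
    ultimately show ?thesis by (simp add: c_def)
  qed
  have "?d = 0"
  proof (rule ccontr)
    assume d0: "?d \<noteq> 0"
    have "card S = card (p ` S)" using card_image[OF S(2)] by simp
    also have "\<dots> \<le> card {x. poly ?d x = 0}" using root by (intro card_mono poly_roots_finite[OF d0]) auto
    also have "\<dots> \<le> degree ?d" by (rule card_poly_roots_bound[OF d0])
    finally show False using degd by simp
  qed
  hence e0: "poly f 0 - poly h 0 = poly L 0" by (metis diff_eq_eq add_0 poly_diff)
  define P where "P = (\<Prod>j\<in>S. - p j)"
  have P0: "P \<noteq> 0" using S by (simp add: P_def)
  have f0: "poly f 0 = q ^ card S * P"
    by (simp add: f_def poly_prod P_def prod.distrib[symmetric] flip: prod_constant)
  have h0: "poly h 0 = P" by (simp add: h_def poly_prod P_def)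
  have "c b * (\<Prod>j\<in>S - {b}. - p j) = - (1 - q) * P * (\<Prod>j\<in>S - {b}. (p b - q * p j) / (p b - p j))" if b: "b \<in> S" for b
  proof -
    have "poly f (p b) = (1 - q) * p b * (\<Prod>j\<in>S - {b}. p b - q * p j)"
      unfolding f_def poly_prod by (subst prod.remove[OF S(1) b]) (simp add: algebra_simps)
    moreover have "P = - p b * (\<Prod>j\<in>S - {b}. - p j)" unfolding P_def by (rule prod.remove[OF S(1) b])
    ultimately show ?thesis by (simp add: c_def prod_dividef) (simp add: minus_divide_left algebra_simps)
  qed
  hence L0: "poly L 0 = - (1 - q) * P * (\<Sum>b\<in>S. \<Prod>j\<in>S - {b}. (p b - q * p j) / (p b - p j))"
    by (simp add: L_def poly_sum poly_prod sum_distrib_left)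
  have "P * (q ^ card S - 1) = P * (- (1 - q) * (\<Sum>b\<in>S. \<Prod>j\<in>S - {b}. (p b - q * p j) / (p b - p j)))"
    using e0 unfolding f0 h0 L0 by (simp add: algebra_simps)
  hence "q ^ card S - 1 = - (1 - q) * (\<Sum>b\<in>S. \<Prod>j\<in>S - {b}. (p b - q * p j) / (p b - p j))"
    using P0 by simp
  thus ?thesis using q by (simp add: field_simps)
qed simp

text \<open>Indexed by a set instead of \<open>n\<close>, because the symmetrization takes out an
  arbitrary point.\<close>

definition full_factor :: "real \<Rightarrow> nat set \<Rightarrow> (nat \<Rightarrow> complex) \<Rightarrow> complex" where
  "full_factor q S p = (\<Prod>i\<in>S. \<Prod>j\<in>S - {i}. qW_factor q (p i) (p j))"

lemma full_factor_insert:
  assumes "finite S" "b \<notin> S"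
  shows "full_factor q (insert b S) p =
    full_factor q S p * (\<Prod>j\<in>S. qW_factor q (p j) (p b)) * (\<Prod>j\<in>S. qW_factor q (p b) (p j))"
proof -
  have "(\<Prod>i\<in>S. \<Prod>j\<in>insert b S - {i}. qW_factor q (p i) (p j)) = (\<Prod>i\<in>S. qW_factor q (p i) (p b) * (\<Prod>j\<in>S - {i}. qW_factor q (p i) (p j)))"
  proof (intro prod.cong refl)
    fix i assume "i \<in> S"
    hence "insert b S - {i} = insert b (S - {i})" using assms by auto
    thus "(\<Prod>j\<in>insert b S - {i}. qW_factor q (p i) (p j)) = qW_factor q (p i) (p b) * (\<Prod>j\<in>S - {i}. qW_factor q (p i) (p j))"
      using assms by simp
  qed
  moreover have "insert b S - {b} = S" using assms by auto
  ultimately show ?thesis using assms unfolding full_factor_def by (simp add: prod.distrib mult_ac)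
qed

lemma full_factor_reindex:
  assumes t: "bij_betw t A B" shows "full_factor q A (p \<circ> t) = full_factor q B p"
proof -
  have "(\<Prod>j\<in>A - {i}. qW_factor q (p (t i)) (p (t j))) = (\<Prod>j\<in>B - {t i}. qW_factor q (p (t i)) (p j))" if i: "i \<in> A" for i
  proof (rule prod.reindex_bij_betw)
    have "t ` (A - {i}) = B - {t i}"
      using t i inj_on_image_set_diff[of t A A "{i}"] by (auto simp: bij_betw_def)
    thus "bij_betw t (A - {i}) (B - {t i})"
      using t by (auto simp: bij_betw_def elim: inj_on_subset)
  qed
  hence "full_factor q A (p \<circ> t) = (\<Prod>i\<in>A. \<Prod>j\<in>B - {t i}. qW_factor q (p (t i)) (p j))"
    unfolding full_factor_def o_def by (rule prod.cong[OF refl])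
  also have "\<dots> = full_factor q B p"
    unfolding full_factor_def by (rule prod.reindex_bij_betw[OF t])
  finally show ?thesis .
qed

text \<open>Permutations are grouped by the point \<open>p b\<close> that lands in the last place.
  The induction hypothesis handles the others, and the factors of \<open>full_factor\<close> missing
  at \<open>b\<close> appear inverted as the summand of \<open>lagrange_sum\<close>. Its value (1 -
  q^(n+1)) / (1 - q) is the next factor of the constant.\<close>

lemma sum_qW_kernel_permute_inj:
  assumes q: "0 \<le> q" "q < 1" and p: "\<And>i. i < n \<Longrightarrow> norm (p i) = 1" and inj: "inj_on p {..<n}"
  shows "(\<Sum>s | s permutes {..<n}. qW_kernel q n (p \<circ> s)) = of_real (qpoch q q n / (1 - q) ^ n) * full_factor q {..<n} p"
  using p inj
proof (induction n arbitrary: p)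
  case 0
  have "{s. s permutes {..<0::nat}} = {id}" by auto
  thus ?case by (simp add: qW_kernel_def lt_pairs_def full_factor_def)
next
  case (Suc n)
  let ?f = "qW_factor q" and ?S = "\<lambda>b. {..<Suc n} - {b}"
  have ins: "{..<Suc n} = insert n {..<n}" by auto
  let ?c = "of_real (qpoch q q n / (1 - q) ^ n) :: complex"
  have main: "(\<Sum>s | s permutes {..<n}. qW_kernel q (Suc n) (p \<circ> (transposition n b \<circ> s))) =
     ?c * full_factor q {..<Suc n} p * (\<Prod>j\<in>?S b. (p b - of_real q * p j) / (p b - p j))" if b: "b \<in> {..<Suc n}" for b
  proof -
    define p' where "p' = p \<circ> transposition n b"
    have t: "bij_betw (transposition n b) {..<n} (?S b)"
      by (rule bij_betw_byWitness[where f' = "transposition n b"])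
         (use b in \<open>auto simp: Transposition.transpose_def split: if_splits\<close>)
    have p'u: "norm (p' i) = 1" if "i < n" for i
      using Suc.prems(1) b that by (auto simp: p'_def Transposition.transpose_def)
    have p'i: "inj_on p' {..<n}" unfolding p'_def
      using t Suc.prems(2) by (intro comp_inj_on) (auto simp: bij_betw_def elim: inj_on_subset)
    have p'n: "p' n = p b" by (simp add: p'_def)
    have "(\<Sum>s | s permutes {..<n}. qW_kernel q (Suc n) (p \<circ> (transposition n b \<circ> s))) =
       (\<Sum>s | s permutes {..<n}. qW_kernel q n (p' \<circ> s) * (\<Prod>j\<in>?S b. ?f (p j) (p b)))"
    proof (intro sum.cong refl)
      fix s assume s: "s \<in> {s. s permutes {..<n}}"
      have "s n = n" using s permutes_not_in[of s "{..<n}" n] by simp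
      hence "qW_kernel q (Suc n) (p' \<circ> s) = qW_kernel q n (p' \<circ> s) * (\<Prod>i<n. ?f ((p' \<circ> s) i) (p b))"
        unfolding qW_kernel_Suc by (simp add: p'n)
      also have "(\<Prod>i<n. ?f ((p' \<circ> s) i) (p b)) = (\<Prod>i<n. ?f (p' i) (p b))"
        using s by (intro prod_permute) simp
      also have "\<dots> = (\<Prod>j\<in>?S b. ?f (p j) (p b))"
        unfolding p'_def o_def by (rule prod.reindex_bij_betw[OF t])
      finally have K: "qW_kernel q (Suc n) (p' \<circ> s) = qW_kernel q n (p' \<circ> s) * (\<Prod>j\<in>?S b. ?f (p j) (p b))" .
      have "p \<circ> (transposition n b \<circ> s) = p' \<circ> s" unfolding p'_def by (rule o_assoc)
      thus "qW_kernel q (Suc n) (p \<circ> (transposition n b \<circ> s)) = qW_kernel q n (p' \<circ> s) * (\<Prod>j\<in>?S b. ?f (p j) (p b))"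
        unfolding K[symmetric] by (rule arg_cong)
    qed
    also have "\<dots> = ?c * full_factor q {..<n} p' * (\<Prod>j\<in>?S b. ?f (p j) (p b))"
      by (simp only: sum_distrib_right[symmetric] Suc.IH[OF p'u p'i])
    also have "full_factor q {..<n} p' = full_factor q (?S b) p"
      unfolding p'_def by (rule full_factor_reindex[OF t])
    also have "?c * full_factor q (?S b) p * (\<Prod>j\<in>?S b. ?f (p j) (p b)) =
       ?c * full_factor q {..<Suc n} p * (\<Prod>j\<in>?S b. (p b - of_real q * p j) / (p b - p j))"
    proof -
      have "full_factor q (insert b (?S b)) p = full_factor q (?S b) p * (\<Prod>j\<in>?S b. ?f (p j) (p b)) * (\<Prod>j\<in>?S b. ?f (p b) (p j))"
        by (rule full_factor_insert) auto
      moreover have "insert b (?S b) = {..<Suc n}" using b by auto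
      moreover have "(\<Prod>j\<in>?S b. ?f (p b) (p j)) * (\<Prod>j\<in>?S b. (p b - of_real q * p j) / (p b - p j)) = 1"
        unfolding prod.distrib[symmetric]
      proof (rule prod.neutral, rule ballI)
        fix j assume j: "j \<in> ?S b"
        have n1: "norm (p b) = 1" "norm (p j) = 1" using Suc.prems(1) b j by auto
        hence nz: "p b \<noteq> 0" by auto
        have d: "p b \<noteq> p j" using Suc.prems(2) b j by (auto simp: inj_on_def)
        have "1 - of_real q * (p j / p b) \<noteq> 0" using n1 by (intro one_minus_nz q) (simp add: norm_divide)
        hence "p b - of_real q * p j \<noteq> 0" using nz by (auto simp: field_simps)
        thus "?f (p b) (p j) * ((p b - of_real q * p j) / (p b - p j)) = 1"
          using nz d by (simp add: qW_factor_def divide_simps)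
      qed
      ultimately show ?thesis by (simp add: mult.assoc)
    qed
    finally show ?thesis .
  qed
  have "(\<Sum>s | s permutes {..<Suc n}. qW_kernel q (Suc n) (p \<circ> s)) =
     (\<Sum>b\<in>{..<Suc n}. \<Sum>s | s permutes {..<n}. qW_kernel q (Suc n) (p \<circ> (transposition n b \<circ> s)))"
    unfolding ins by (rule sum_over_permutations_insert) auto
  also have "\<dots> = ?c * full_factor q {..<Suc n} p * (\<Sum>b\<in>{..<Suc n}. \<Prod>j\<in>?S b. (p b - of_real q * p j) / (p b - p j))"
    unfolding sum_distrib_left by (intro sum.cong refl main)
  also have "(\<Sum>b\<in>{..<Suc n}. \<Prod>j\<in>?S b. (p b - of_real q * p j) / (p b - p j)) = (1 - of_real q ^ card {..<Suc n}) / (1 - of_real q)"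
  proof (rule lagrange_sum)
    fix i assume "i \<in> {..<Suc n}"
    hence "norm (p i) = 1" using Suc.prems(1) by simp
    thus "p i \<noteq> 0" by auto
  qed (use q Suc.prems in auto)
  also have "?c * full_factor q {..<Suc n} p * ((1 - of_real q ^ card {..<Suc n}) / (1 - of_real q)) =
      of_real (qpoch q q (Suc n) / (1 - q) ^ Suc n) * full_factor q {..<Suc n} p"
    by (simp add: qpoch_Suc mult_ac)
  finally show ?case .
qed

text \<open>Interpolation needs distinct points. If two points coincide, every kernel on the left
  and the product on the right contain a factor 1 - 1.\<close>

lemma sum_qW_kernel_permute:
  assumes q: "0 \<le> q" "q < 1" and p: "\<And>i. i < n \<Longrightarrow> norm (p i) = 1"
  shows "(\<Sum>s | s permutes {..<n}. qW_kernel q n (p \<circ> s)) = of_real (qpoch q q n / (1 - q) ^ n) * full_factor q {..<n} p"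
proof (cases "inj_on p {..<n}")
  case False
  then obtain a b where ab: "a < n" "b < n" "a \<noteq> b" "p a = p b" by (auto simp: inj_on_def)
  have f0: "qW_factor q (p a) (p b) = 0" using ab p[of b] by (auto simp: qW_factor_def)
  have "full_factor q {..<n} p = 0"
    unfolding full_factor_def using ab f0 by (intro prod_zero bexI[of _ a] bexI[of _ b]) auto
  moreover have "qW_kernel q n (p \<circ> s) = 0" if s: "s permutes {..<n}" for s
  proof -
    obtain i j where ij: "s i = a" "s j = b" using permutes_surj[OF s] by (metis surjD)
    hence ijn: "i < n" "j < n" "i \<noteq> j" using ab permutes_in_image[OF s] by (metis lessThan_iff)+
    define x where "x = (min i j, max i j)"
    have "x \<in> lt_pairs n" using ijn by (auto simp: lt_pairs_def x_def)
    moreover have "(\<lambda>(i, j). qW_factor q ((p \<circ> s) i) ((p \<circ> s) j)) x = 0"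
      using ij ab f0 by (auto simp: x_def min_def max_def)
    ultimately show ?thesis unfolding qW_kernel_def by (intro prod_zero) auto
  qed
  ultimately show ?thesis by simp
qed (use sum_qW_kernel_permute_inj assms in blast)

text \<open>The Cauchy determinant at \<open>x i = q * p i\<close> and \<open>y j = 1 / p j\<close>:
  the diagonal of the denominator gives \<open>(1 - q) ^ n\<close>, and each pair in the numerator
  gives one \<open>q\<close>. The number of pairs is written as the staircase sum so that it cancels
  against \<open>sum_staircase\<close>.\<close>

lemma cauchy_det_full_factor:
  assumes q: "0 < q" "q < 1" and p: "\<And>i. i < n \<Longrightarrow> norm (p i) = 1"
  shows "(\<Sum>s | s permutes {..<n}. of_int (sign s) * (\<Prod>i<n. 1 / (1 - of_real q * (p i / p (s i))))) =
    of_real (q ^ (\<Sum>i<n. n - Suc i) / (1 - q) ^ n) * full_factor q {..<n} p"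
proof -
  let ?x = "\<lambda>i. of_real q * p i" and ?y = "\<lambda>i. 1 / p i"
  have nz: "p i \<noteq> 0" if "i < n" for i using p[OF that] by auto
  have den: "1 - ?x i * ?y j \<noteq> 0" if "i < n" "j < n" for i j
    using one_minus_nz[of q "p i / p j"] q p that by (simp add: norm_divide)
  have "(\<Sum>s | s permutes {..<n}. of_int (sign s) * (\<Prod>i<n. 1 / (1 - of_real q * (p i / p (s i))))) =
     (\<Prod>j<n. \<Prod>i<j. (?x j - ?x i) * (?y j - ?y i)) / (\<Prod>i<n. \<Prod>j<n. 1 - ?x i * ?y j)"
    using cauchy_det[of n ?x ?y, OF den] by simp
  also have "(\<Prod>i<n. \<Prod>j<n. 1 - ?x i * ?y j) = of_real ((1 - q) ^ n) * (\<Prod>i<n. \<Prod>j\<in>{..<n} - {i}. 1 - of_real q * (p i / p j))"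
  proof -
    have "(\<Prod>j<n. 1 - ?x i * ?y j) = of_real (1 - q) * (\<Prod>j\<in>{..<n} - {i}. 1 - of_real q * (p i / p j))" if "i < n" for i
      using that nz[OF that] by (subst prod.remove[of _ i]) auto
    thus ?thesis by (simp add: prod.distrib)
  qed
  also have "(\<Prod>i<n. \<Prod>j\<in>{..<n} - {i}. 1 - of_real q * (p i / p j)) = (\<Prod>i<n. \<Prod>j\<in>{..<n} - {i}. 1 - of_real q * (p j / p i))"
  proof -
    have "(\<Prod>i<n. \<Prod>j\<in>{j\<in>{..<n}. j \<noteq> i}. 1 - of_real q * (p i / p j)) = (\<Prod>j<n. \<Prod>i\<in>{i\<in>{..<n}. j \<noteq> i}. 1 - of_real q * (p i / p j))"
      by (rule prod.swap_restrict) auto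
    moreover have "{j\<in>{..<n}. j \<noteq> i} = {..<n} - {i}" "{j\<in>{..<n}. i \<noteq> j} = {..<n} - {i}" for i by auto
    ultimately show ?thesis by simp
  qed
  also have "(\<Prod>j<n. \<Prod>i<j. (?x j - ?x i) * (?y j - ?y i)) = of_real (q ^ (\<Sum>i<n. n - Suc i)) * (\<Prod>i<n. \<Prod>j\<in>{..<n} - {i}. 1 - p j / p i)"
  proof -
    have 1: "(?x j - ?x i) * (?y j - ?y i) = of_real q * ((1 - p j / p i) * (1 - p i / p j))" if "j < n" "i < j" for i j
      using nz[of i] nz[of j] that by (simp add: field_simps)
    have 2: "(\<Prod>j<n. \<Prod>i<j. (?x j - ?x i) * (?y j - ?y i)) = (\<Prod>j<n. \<Prod>i<j. of_real q * ((1 - p j / p i) * (1 - p i / p j)))"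
      using 1 by (intro prod.cong refl) auto
    have 3: "(\<Prod>j<m. \<Prod>i<j. of_real q * (g j i * g i j)) = of_real (q ^ (\<Sum>i<m. m - Suc i)) * (\<Prod>i<m. \<Prod>j\<in>{..<m} - {i}. g j i)"
      for m and g :: "nat \<Rightarrow> nat \<Rightarrow> complex"
    proof (induction m)
      case (Suc m)
      have s: "(\<Sum>i<Suc m. Suc m - Suc i) = (\<Sum>i<m. m - Suc i) + m"
      proof -
        have "(\<Sum>i<Suc m. Suc m - Suc i) = (\<Sum>i<m. m - i)" by simp
        also have "\<dots> = (\<Sum>i<m. (m - Suc i) + 1)" by (intro sum.cong) auto
        finally show ?thesis by (simp only: sum.distrib) simp
      qed
      have e: "{..<Suc m} - {i} = insert m ({..<m} - {i})" if "i < m" for i using that by auto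
      have "(\<Prod>i<Suc m. \<Prod>j\<in>{..<Suc m} - {i}. g j i) = (\<Prod>i<m. g m i * (\<Prod>j\<in>{..<m} - {i}. g j i)) * (\<Prod>j<m. g j m)"
      proof -
        have "{..<Suc m} - {m} = {..<m}" by auto
        moreover have "(\<Prod>j\<in>{..<Suc m} - {i}. g j i) = g m i * (\<Prod>j\<in>{..<m} - {i}. g j i)" if "i < m" for i
          unfolding e[OF that] by simp
        ultimately show ?thesis by simp
      qed
      moreover have "(\<Prod>i<m. of_real q * (g m i * g i m)) = of_real (q ^ m) * ((\<Prod>i<m. g m i) * (\<Prod>i<m. g i m))"
        by (simp add: prod.distrib)
      ultimately show ?case unfolding s
        by (simp only: prod.lessThan_Suc[of "\<lambda>j. \<Prod>i<j. of_real q * (g j i * g i j)"] Suc.IH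
             prod.distrib[of "g m"] power_add of_real_mult mult_ac)
    qed simp
    show ?thesis unfolding 2 by (rule 3[where m = n and g = "\<lambda>j i. 1 - p j / p i"])
  qed
  finally show ?thesis unfolding full_factor_def qW_factor_def by (simp add: prod_dividef)
qed

section \<open>Summation over partitions\<close>

text \<open>Tannery's theorem, in the form that transfers the value of the sums to the limit
  family.\<close>

lemma has_sum_dominated:
  fixes f :: "nat \<Rightarrow> 'a \<Rightarrow> complex"
  assumes lim: "\<And>x. x \<in> A \<Longrightarrow> (\<lambda>N. f N x) \<longlonglongrightarrow> g x"
    and bound: "\<And>N x. x \<in> A \<Longrightarrow> norm (f N x) \<le> b x" and b: "b summable_on A"
    and sums: "\<And>N. (f N has_sum S N) A" and S: "S \<longlonglongrightarrow> s"
  shows "(g has_sum s) A"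
proof -
  have gb: "norm (g x) \<le> b x" if "x \<in> A" for x
    using tendsto_norm[OF lim[OF that]] bound[OF that] by (intro LIMSEQ_le_const2) auto
  have g: "g summable_on A"
    by (rule abs_summable_summable[OF summable_on_comparison_test[OF b]]) (use gb in auto)
  have "S \<longlonglongrightarrow> infsum g A"
  proof (rule tendstoI)
    fix e :: real assume e: "0 < e"
    \<comment> \<open>Outside \<open>F\<close> the differences are at most \<open>2 * b\<close> and
      add up to at most a quarter of \<open>e\<close>; on the finite set \<open>F\<close> their sum
      is eventually below half of \<open>e\<close>.\<close>
    obtain F where F: "finite F" "F \<subseteq> A" and bF: "norm (sum b F - infsum b A) \<le> e / 8"
      using infsum_finite_approximation[OF b, of "e / 8"] e by (auto simp: dist_norm)
    have bAF: "b summable_on (A - F)" using summable_on_subset_banach[OF b] by blast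
    have "infsum b A = sum b F + infsum b (A - F)"
      using infsum_Diff[OF b summable_on_finite[OF F(1)] F(2)] infsum_finite[OF F(1), of b] by simp
    hence tail: "infsum b (A - F) \<le> e / 8" using bF by (simp add: abs_le_iff)
    have "(\<lambda>N. \<Sum>x\<in>F. norm (f N x - g x)) \<longlonglongrightarrow> (\<Sum>x\<in>F. norm (g x - g x))"
      using F by (intro tendsto_intros lim) auto
    hence "(\<lambda>N. \<Sum>x\<in>F. norm (f N x - g x)) \<longlonglongrightarrow> 0" by simp
    hence "\<forall>\<^sub>F N in sequentially. (\<Sum>x\<in>F. norm (f N x - g x)) < e / 2"
      using e by (intro order_tendstoD) auto
    thus "\<forall>\<^sub>F N in sequentially. dist (S N) (infsum g A) < e"
    proof eventually_elim
      case (elim N)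
      define d where "d x = f N x - g x" for x
      have hd: "(d has_sum (S N - infsum g A)) A"
        unfolding d_def using has_sum_add[OF sums[of N] has_sum_uminusI[OF has_sum_infsum[OF g]]] by simp
      hence ds: "d summable_on A" by (rule has_sum_imp_summable)
      have dAF: "d summable_on (A - F)" using summable_on_subset_banach[OF ds] by blast
      have db: "norm (d x) \<le> 2 * b x" if "x \<in> A - F" for x
        using norm_triangle_ineq4[of "f N x" "g x"] gb[of x] bound[of x N] that by (simp add: d_def)
      have "S N - infsum g A = infsum d A"
        using infsumI[OF hd] by simp
      also have "\<dots> = sum d F + infsum d (A - F)"
        using infsum_Diff[OF ds summable_on_finite[OF F(1)] F(2)] infsum_finite[OF F(1), of d] by simp
      finally have "norm (S N - infsum g A) \<le> norm (sum d F) + norm (infsum d (A - F))"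
        by (simp add: norm_triangle_ineq)
      also have "norm (sum d F) \<le> (\<Sum>x\<in>F. norm (d x))" by (rule norm_sum)
      also have "norm (infsum d (A - F)) \<le> infsum (\<lambda>x. 2 * b x) (A - F)"
        by (rule norm_infsum_le[OF has_sum_infsum[OF dAF] has_sum_infsum]) (use db bAF in \<open>auto intro: summable_on_cmult_right\<close>)
      also have "\<dots> = 2 * infsum b (A - F)" by (rule infsum_cmult_right')
      finally show ?case using elim tail e unfolding dist_norm d_def by linarith
    qed
  qed
  hence "infsum g A = s" using S LIMSEQ_unique by blast
  thus ?thesis using has_sum_infsum[OF g] by simp
qed

lemma has_sum_finite_sum:
  fixes f :: "'i \<Rightarrow> 'a \<Rightarrow> complex"
  assumes "finite I" "\<And>i. i \<in> I \<Longrightarrow> (f i has_sum s i) A"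
  shows "((\<lambda>x. \<Sum>i\<in>I. f i x) has_sum (\<Sum>i\<in>I. s i)) A"
  using assms by (induction I rule: finite_induct) (auto intro: has_sum_add)

lemma prod_geometric:
  fixes z :: "nat \<Rightarrow> complex"
  assumes "\<And>i. i < n \<Longrightarrow> norm (z i) < 1"
  shows "((\<lambda>l. \<Prod>i<n. z i ^ l i) has_sum (\<Prod>i<n. 1 / (1 - z i))) (PiE {..<n} (\<lambda>_. UNIV))"
    and "(\<lambda>l. norm (\<Prod>i<n. z i ^ l i)) summable_on (PiE {..<n} (\<lambda>_. UNIV :: nat set))"
proof -
  have hs: "((\<lambda>k. z i ^ k) has_sum (1 / (1 - z i))) UNIV" "(\<lambda>k. norm (z i ^ k)) summable_on UNIV" if "i < n" for i
  proof -
    have g: "summable (\<lambda>k. norm (z i ^ k))" using assms[OF that] by (simp add: norm_power)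
    show "((\<lambda>k. z i ^ k) has_sum (1 / (1 - z i))) UNIV"
      using norm_summable_imp_has_sum[OF g geometric_sums[OF assms[OF that]]] .
    show "(\<lambda>k. norm (z i ^ k)) summable_on UNIV"
      using g by (intro norm_summable_imp_summable_on) simp
  qed
  have "Infinite_Set_Sum.abs_summable_on (\<lambda>l. \<Prod>i\<in>{..<n}. z i ^ l i) (PiE {..<n} (\<lambda>_. UNIV :: nat set))"
    by (rule abs_summable_on_prod_PiE) (use hs in \<open>auto simp: abs_summable_equivalent\<close>)
  thus abs: "(\<lambda>l. norm (\<Prod>i<n. z i ^ l i)) summable_on (PiE {..<n} (\<lambda>_. UNIV :: nat set))"
    by (simp only: abs_summable_equivalent)
  have "infsum (\<lambda>l. \<Prod>i<n. z i ^ l i) (PiE {..<n} (\<lambda>_. UNIV)) = (\<Prod>i<n. infsum (\<lambda>k. z i ^ k) UNIV)"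
    by (rule infsum_prod_PiE_abs) (use hs in auto)
  also have "\<dots> = (\<Prod>i<n. 1 / (1 - z i))" using hs by (intro prod.cong) (auto intro: infsumI)
  finally show "((\<lambda>l. \<Prod>i<n. z i ^ l i) has_sum (\<Prod>i<n. 1 / (1 - z i))) (PiE {..<n} (\<lambda>_. UNIV))"
    using has_sum_infsum[OF abs_summable_summable[OF abs]] by simp
qed

section \<open>Sorting exponent vectors into partitions\<close>

lemma alternant_cong: "(\<And>i. i < n \<Longrightarrow> k i = l i) \<Longrightarrow> alternant n k p = alternant n l p"
  unfolding alternant_def
proof (intro sum.cong refl arg_cong2[where f = times] prod.cong)
  fix s i assume "\<And>i. i < n \<Longrightarrow> k i = l i" "s \<in> {s. s permutes {..<n}}" "i \<in> {..<n}"
  thus "p i ^ k (s i) = p i ^ l (s i)" using permutes_in_image[of s "{..<n}" i] by simp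
qed

lemma alternant_comp:
  assumes t: "t permutes {..<n}" shows "alternant n (k \<circ> t) p = of_int (sign t) * alternant n k p"
proof -
  have pt: "permutation t" using t permutation_permutes by blast
  have "alternant n (k \<circ> t) p = (\<Sum>s | s permutes {..<n}. of_int (sign t) * (of_int (sign (t \<circ> s)) * (\<Prod>i<n. p i ^ k ((t \<circ> s) i))))"
    unfolding alternant_def
  proof (intro sum.cong refl)
    fix s assume s: "s \<in> {s. s permutes {..<n}}"
    have ps: "permutation s" using s permutation_permutes by blast
    have "sign t * sign (t \<circ> s) = sign s"
      using sign_compose[OF pt ps] sign_idempotent[of t] by (simp add: mult.assoc[symmetric])
    thus "of_int (sign s) * (\<Prod>i<n. p i ^ (k \<circ> t) (s i)) =
      of_int (sign t) * (of_int (sign (t \<circ> s)) * (\<Prod>i<n. p i ^ k ((t \<circ> s) i)))"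
      by (simp add: mult.assoc[symmetric] flip: of_int_mult)
  qed
  also have "\<dots> = of_int (sign t) * (\<Sum>s | s permutes {..<n}. (of_int (sign (t \<circ> s)) * (\<Prod>i<n. p i ^ k ((t \<circ> s) i))))"
    by (simp add: sum_distrib_left)
  also have "(\<Sum>s | s permutes {..<n}. (of_int (sign (t \<circ> s)) * (\<Prod>i<n. p i ^ k ((t \<circ> s) i)))) = alternant n k p"
    unfolding alternant_def
    by (rule sum.reindex_bij_witness[where i = "\<lambda>s. Hilbert_Choice.inv t \<circ> s" and j = "\<lambda>s. t \<circ> s"])
       (use t in \<open>auto simp: o_assoc permutes_inv_o permutes_compose permutes_inv\<close>)
  finally show ?thesis .
qed

lemma alternant_not_inj:
  assumes "\<not> inj_on l {..<n}" shows "alternant n l p = 0"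
proof -
  obtain a b where ab: "a < n" "b < n" "a \<noteq> b" "l a = l b" using assms by (auto simp: inj_on_def)
  let ?t = "transposition a b"
  have t: "?t permutes {..<n}" using ab by (intro permutes_swap_id) auto
  have "l \<circ> ?t = l" using ab by (auto simp: fun_eq_iff Transposition.transpose_def)
  moreover have "sign ?t = -1" using ab by (simp add: sign_swap_id)
  ultimately show ?thesis using alternant_comp[OF t, of l p] by simp
qed

text \<open>Passing from \<open>s\<close> to its inverse, which has the same sign, moves the
  permutation from the exponents to the points.\<close>

lemma alternant_inverse:
  "(\<Sum>s | s permutes {..<n}. of_int (sign s) * (\<Prod>i<n. (1 / p (s i)) ^ l i)) = alternant n l (\<lambda>i. 1 / p i)"
proof -
  have "alternant n l (\<lambda>i. 1 / p i) = (\<Sum>s | s permutes {..<n}. of_int (sign (Hilbert_Choice.inv s)) * (\<Prod>i<n. (1 / p i) ^ l (Hilbert_Choice.inv s i)))"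
    unfolding alternant_def
    by (rule sum.reindex_bij_witness[where i = "Hilbert_Choice.inv" and j = "Hilbert_Choice.inv"])
       (auto simp: permutes_inv_inv permutes_inv)
  also have "\<dots> = (\<Sum>s | s permutes {..<n}. of_int (sign s) * (\<Prod>i<n. (1 / p (s i)) ^ l i))"
  proof (intro sum.cong refl arg_cong2[where f = times])
    fix s assume s: "s \<in> {s. s permutes {..<n}}"
    show "of_int (sign (Hilbert_Choice.inv s)) = (of_int (sign s) :: complex)"
      using s permutation_permutes[of s] by (auto simp: sign_inverse)
    show "(\<Prod>i<n. (1 / p i) ^ l (Hilbert_Choice.inv s i)) = (\<Prod>i<n. (1 / p (s i)) ^ l i)"
      using prod.permute[of s "{..<n}" "\<lambda>i. (1 / p i) ^ l (Hilbert_Choice.inv s i)"] s by (simp add: o_def permutes_inverses)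
  qed
  finally show ?thesis ..
qed

definition parts_le :: "nat \<Rightarrow> (nat \<Rightarrow> nat) set" where
  "parts_le n = {rho. is_partition rho \<and> rho 0 \<le> n}"

lemma partition_of_strict:
  assumes k: "\<And>i j. i < j \<Longrightarrow> j < n \<Longrightarrow> k j < k i"
  obtains rho where "rho \<in> parts_le n" "\<And>i. i < n \<Longrightarrow> staircase n rho i = k i"
proof
  define v where "v j = k j - (n - Suc j)" for j
  define rho where "rho i = card {j. j < n \<and> i < v j}" for i
  \<comment> \<open>A strictly decreasing sequence of naturals lies above the staircase, so the
    truncated subtraction in \<open>v\<close> is exact. The heights \<open>v\<close> are then weakly
    decreasing, and \<open>rho\<close> is their conjugate.\<close>
  have low: "n - Suc j \<le> k j" if "j < n" for j
    using that
  proof (induction "n - Suc j" arbitrary: j)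
    case (Suc m)
    hence j: "Suc j < n" "m = n - Suc (Suc j)" by auto
    have "n - Suc (Suc j) \<le> k (Suc j)" using Suc.hyps(1)[OF j(2) j(1)] .
    thus ?case using k[of j "Suc j"] j by simp
  qed simp
  have anti: "v j \<le> v i" if "i \<le> j" "j < n" for i j
    using that
  proof (induction j)
    case (Suc j)
    show ?case
    proof (cases "i \<le> j")
      case True
      have "v (Suc j) \<le> v j" using k[of j "Suc j"] Suc.prems low[of j] low[of "Suc j"] by (simp add: v_def)
      thus ?thesis using Suc True by simp
    qed (use Suc.prems in \<open>simp add: le_Suc_eq\<close>)
  qed simp
  have iff: "j < rho i \<longleftrightarrow> i < v j" if j: "j < n" for i j
  proof
    assume i: "i < v j"
    hence "{..j} \<subseteq> {j. j < n \<and> i < v j}" using anti j by (auto intro: less_le_trans)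
    hence "Suc j \<le> rho i" unfolding rho_def using card_mono[of "{j. j < n \<and> i < v j}" "{..j}"] by simp
    thus "j < rho i" by simp
  next
    assume jr: "j < rho i"
    show "i < v j"
    proof (rule ccontr)
      assume "\<not> i < v j"
      have "{j. j < n \<and> i < v j} \<subseteq> {..<j}"
      proof
        fix j' assume "j' \<in> {j. j < n \<and> i < v j}"
        thus "j' \<in> {..<j}" using anti[of j j'] \<open>\<not> i < v j\<close> by (cases "j' < j") auto
      qed
      hence "rho i \<le> j" unfolding rho_def using card_mono[of "{..<j}"] by fastforce
      thus False using jr by simp
    qed
  qed
  have "is_partition rho"
  proof (rule is_partitionI)
    show "rho (Suc i) \<le> rho i" for i unfolding rho_def by (intro card_mono) auto
    \<comment> \<open>The sum of all heights bounds each of them and so serves as the index of an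
      empty row.\<close>
    have "{j. j < n \<and> (\<Sum>j<n. v j) < v j} = {}"
      using member_le_sum[of _ "{..<n}" v] by (auto simp: not_less[symmetric])
    thus "rho (\<Sum>j<n. v j) = 0" unfolding rho_def by (metis card.empty)
  qed
  moreover have "rho 0 \<le> n" unfolding rho_def using card_mono[of "{..<n}" "{j. j < n \<and> 0 < v j}"] by auto
  ultimately show "rho \<in> parts_le n" by (simp add: parts_le_def)
  show "staircase n rho i = k i" if i: "i < n" for i
  proof -
    have "{j. i < rho j} = {..<v i}" using iff[OF i] by auto
    thus ?thesis using low[OF i] by (simp add: staircase_def v_def)
  qed
qed

lemma strict_sorting:
  fixes l :: "nat \<Rightarrow> nat"
  assumes "inj_on l {..<n}"
  obtains k s where "\<And>i j. i < j \<Longrightarrow> j < n \<Longrightarrow> k j < k i" "s permutes {..<n}" "\<And>i. i < n \<Longrightarrow> k (s i) = l i"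
proof -
  define xs where "xs = rev (sorted_list_of_set (l ` {..<n}))"
  have len: "length xs = n" using assms by (simp add: xs_def card_image)
  have dist: "distinct xs" and set: "set xs = l ` {..<n}" by (simp_all add: xs_def)
  have "sorted_wrt (>) xs"
    unfolding xs_def using strict_sorted_list_of_set[of "l ` {..<n}"] by (simp add: sorted_wrt_rev)
  hence k: "xs ! j < xs ! i" if "i < j" "j < n" for i j
    using that len by (auto simp: sorted_wrt_iff_nth_less)
  have bx: "bij_betw (\<lambda>i. xs ! i) {..<n} (l ` {..<n})"
    using bij_betw_nth[OF dist] len set by simp
  have bl: "bij_betw l {..<n} (l ` {..<n})" using assms by (simp add: bij_betw_def)
  define s where "s i = (if i < n then inv_into {..<n} (\<lambda>i. xs ! i) (l i) else i)" for i
  have bs: "bij_betw (inv_into {..<n} (\<lambda>i. xs ! i) \<circ> l) {..<n} {..<n}"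
    by (rule bij_betw_trans[OF bl bij_betw_inv_into[OF bx]])
  hence "bij_betw s {..<n} {..<n}" by (rule bij_betw_cong[THEN iffD1, rotated]) (simp add: s_def)
  hence "s permutes {..<n}" by (rule bij_imp_permutes) (simp add: s_def)
  moreover have "xs ! (s i) = l i" if "i < n" for i
    using that bij_betw_inv_into_right[OF bx, of "l i"] by (simp add: s_def)
  ultimately show ?thesis using that k by blast
qed

text \<open>An exponent vector without repetitions is, in exactly one way, a permutation of a
  strictly decreasing one. This converts a free sum over exponent vectors into a sum over partitions
  and permutations.\<close>

lemma bij_betw_strict_perm:
  "bij_betw (\<lambda>(rho, s). restrict (staircase n rho \<circ> s) {..<n}) (parts_le n \<times> {s. s permutes {..<n}})
     {l \<in> PiE {..<n} (\<lambda>_. UNIV). inj_on l {..<n}}" (is "bij_betw ?F ?A ?B")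
  unfolding bij_betw_def
proof
  have strict: "staircase n rho j < staircase n rho i" if "rho \<in> parts_le n" "i < j" "j < n" for rho i j
    using staircase_strict that by (simp add: parts_le_def)
  show "inj_on ?F ?A"
  proof (rule inj_onI, clarify)
    fix rho s rho' s'
    assume r: "rho \<in> parts_le n" "rho' \<in> parts_le n" and s: "s permutes {..<n}" "s' permutes {..<n}"
      and eq: "restrict (staircase n rho \<circ> s) {..<n} = restrict (staircase n rho' \<circ> s') {..<n}"
    have e: "staircase n rho (s i) = staircase n rho' (s' i)" if "i < n" for i
      using fun_cong[OF eq, of i] that by simp
    let ?t = "s' \<circ> Hilbert_Choice.inv s"
    have "?t = id"
    proof (rule strict_perm_unique[of n "staircase n rho'" "staircase n rho"])
      show "?t permutes {..<n}" using s by (intro permutes_compose permutes_inv)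
      show "staircase n rho' (?t i) = staircase n rho i" if "i < n" for i
      proof -
        have "Hilbert_Choice.inv s i < n" using permutes_in_image[OF permutes_inv[OF s(1)], of i] that by simp
        from e[OF this] show ?thesis using permutes_inverses(1)[OF s(1)] by simp
      qed
    qed (use strict r in auto)
    hence "s' = s" using s by (metis comp_id fun.map_comp o_assoc permutes_inv_o(2) id_comp)
    moreover have "rho = rho'"
    proof (rule staircase_inj[of _ n])
      fix i assume i: "i < n"
      have "Hilbert_Choice.inv s i < n" using permutes_in_image[OF permutes_inv[OF s(1)], of i] i by simp
      from e[OF this] show "staircase n rho i = staircase n rho' i"
        using permutes_inverses(1)[OF s(1)] \<open>s' = s\<close> by simp
    qed (use r in \<open>auto simp: parts_le_def\<close>)
    ultimately show "rho = rho' \<and> s = s'" by simp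
  qed
  show "?F ` ?A = ?B"
  proof (intro equalityI subsetI)
    fix l assume "l \<in> ?F ` ?A"
    then obtain rho s where l: "l = restrict (staircase n rho \<circ> s) {..<n}" and r: "rho \<in> parts_le n" and s: "s permutes {..<n}"
      by auto
    have "inj_on (staircase n rho) {..<n}"
      using strict[OF r] by (auto simp: inj_on_def) (metis less_irrefl nat_neq_iff)
    hence "inj_on (staircase n rho \<circ> s) {..<n}"
      using s by (intro comp_inj_on) (auto simp: permutes_inj_on permutes_image)
    thus "l \<in> ?B" unfolding l by (simp add: inj_on_restrict_eq)
  next
    fix l assume l: "l \<in> ?B"
    obtain k s where k: "\<And>i j. i < j \<Longrightarrow> j < n \<Longrightarrow> k j < k i" and s: "s permutes {..<n}" and e: "\<And>i. i < n \<Longrightarrow> k (s i) = l i"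
      using strict_sorting[of l n] l by blast
    obtain rho where r: "rho \<in> parts_le n" "\<And>i. i < n \<Longrightarrow> staircase n rho i = k i"
      using partition_of_strict[of n k] k by blast
    have "l = ?F (rho, s)"
    proof
      fix i show "l i = ?F (rho, s) i"
      proof (cases "i < n")
        case True
        have "s i < n" using permutes_in_image[OF s, of i] True by simp
        thus ?thesis using True r(2) e by simp
      next
        case False
        thus ?thesis using l by (auto simp: PiE_iff extensional_def)
      qed
    qed
    thus "l \<in> ?F ` ?A" using r(1) s by blast
  qed
qed

lemma sum_staircase:
  assumes "rho \<in> parts_le n"
  shows "(\<Sum>i<n. staircase n rho i) = psize rho + (\<Sum>i<n. n - Suc i)"
proof -
  have p: "is_partition rho" "rho 0 \<le> n" using assms by (auto simp: parts_le_def)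
  obtain r where r: "rho r = 0" using is_partition_eventually_0[OF p(1)] by blast
  have rn: "rho i \<le> n" for i using is_partition_antimono[OF p(1), of 0 i] p(2) by simp
  have "(\<Sum>j<n. card {i. j < rho i}) = (\<Sum>j<n. \<Sum>i<r. of_bool (j < rho i))"
  proof (intro sum.cong refl)
    fix j
    have "{i. j < rho i} = {i\<in>{..<r}. j < rho i}"
      using is_partition_antimono[OF p(1), of r] r by (auto simp: not_le[symmetric])
    thus "card {i. j < rho i} = (\<Sum>i<r. of_bool (j < rho i))" by (simp add: Int_def)
  qed
  also have "\<dots> = (\<Sum>i<r. \<Sum>j<n. of_bool (j < rho i))" by (rule sum.swap)
  also have "\<dots> = (\<Sum>i<r. rho i)"
  proof (intro sum.cong refl)
    fix i
    have "{j\<in>{..<n}. j < rho i} = {..<rho i}" using rn[of i] by auto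
    thus "(\<Sum>j<n. of_bool (j < rho i)) = rho i" by (simp add: Int_def)
  qed
  also have "\<dots> = psize rho" using psize_eq[OF p(1) r] by simp
  finally show ?thesis unfolding staircase_def sum.distrib by simp
qed

text \<open>The staircase embeds these partitions into exponent vectors, where the sum is a product
  of geometric series; it changes the exponent of \<open>q\<close> only by a constant.\<close>

lemma summable_on_psize:
  fixes q :: real
  assumes "0 < q" "q < 1" shows "(\<lambda>rho. q ^ psize rho) summable_on parts_le n"
proof -
  let ?F = "\<lambda>rho. restrict (staircase n rho \<circ> id) {..<n}"
  let ?L = "PiE {..<n} (\<lambda>_. UNIV :: nat set)"
  have "(\<lambda>l. norm (\<Prod>i<n. complex_of_real q ^ l i)) summable_on ?L"
    by (rule prod_geometric(2)) (use assms in simp)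
  hence 1: "(\<lambda>l. \<Prod>i<n. q ^ l i) summable_on ?L"
    by (rule summable_on_cong[THEN iffD1, rotated]) (use assms in \<open>simp add: prod_norm[symmetric] norm_power\<close>)
  have inj: "inj_on ?F (parts_le n)"
  proof (rule inj_onI)
    fix rho rho' assume "rho \<in> parts_le n" "rho' \<in> parts_le n" "?F rho = ?F rho'"
    hence "(rho, id) = (rho', id)"
      using inj_onD[OF bij_betw_imp_inj_on[OF bij_betw_strict_perm[of n]], of "(rho, id)" "(rho', id)"]
      by (simp add: permutes_id)
    thus "rho = rho'" by simp
  qed
  have "?F ` parts_le n \<subseteq> ?L" by (intro image_subsetI) (simp add: PiE_iff)
  hence "(\<lambda>l. \<Prod>i<n. q ^ l i) summable_on (?F ` parts_le n)"
    by (rule summable_on_subset_banach[OF 1])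
  hence "((\<lambda>l. \<Prod>i<n. q ^ l i) \<circ> ?F) summable_on parts_le n"
    using summable_on_reindex[OF inj] by blast
  moreover have "((\<lambda>l. \<Prod>i<n. q ^ l i) \<circ> ?F) rho = q ^ psize rho * q ^ (\<Sum>i<n. n - Suc i)" if "rho \<in> parts_le n" for rho
    using sum_staircase[OF that] by (simp add: power_sum[symmetric] power_add[symmetric])
  ultimately have "(\<lambda>rho. q ^ psize rho * q ^ (\<Sum>i<n. n - Suc i)) summable_on parts_le n"
    by (subst (asm) summable_on_cong) auto
  thus ?thesis using assms by (subst (asm) summable_on_cmult_left') auto
qed

abbreviation alternant_sq :: "nat \<Rightarrow> (nat \<Rightarrow> nat) \<Rightarrow> (nat \<Rightarrow> complex) \<Rightarrow> complex" where
  "alternant_sq n rho p \<equiv> alternant n (staircase n rho) p * alternant n (staircase n rho) (\<lambda>i. 1 / p i)"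

text \<open>Cauchy-Binet carried out on series: every term of the Cauchy determinant is expanded
  geometrically over \<open>l\<close>, exponent vectors with a repetition cancel in the alternant,
  and the others are sorted. Sorting yields one alternant in \<open>p\<close> from the sum over
  permutations and one in \<open>1 / p\<close> from the determinant.\<close>

lemma has_sum_alternants:
  assumes q: "0 < q" "q < 1" and p: "\<And>i. i < n \<Longrightarrow> norm (p i) = 1"
  shows "((\<lambda>rho. of_real (q ^ psize rho) * alternant_sq n rho p)
     has_sum (full_factor q {..<n} p / of_real ((1 - q) ^ n))) (parts_le n)"
proof -
  let ?L = "PiE {..<n} (\<lambda>_. UNIV :: nat set)"
  let ?C = "\<Sum>i<n. n - Suc i"
  define h where "h l = of_real (q ^ (\<Sum>i<n. l i)) * ((\<Prod>i<n. p i ^ l i) * alternant n l (\<lambda>i. 1 / p i))" for l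
  have h_eq: "h l = (\<Sum>s | s permutes {..<n}. of_int (sign s) * (\<Prod>i<n. (of_real q * (p i / p (s i))) ^ l i))" for l
    unfolding h_def alternant_inverse[symmetric] sum_distrib_left
    by (intro sum.cong refl) (simp add: prod.distrib[symmetric] power_mult_distrib power_divide power_sum prod_dividef field_simps)
  have "(h has_sum (\<Sum>s | s permutes {..<n}. of_int (sign s) * (\<Prod>i<n. 1 / (1 - of_real q * (p i / p (s i)))))) ?L"
    unfolding h_eq
  proof (intro has_sum_finite_sum has_sum_cmult_right prod_geometric(1))
    fix s i assume s: "s \<in> {s. s permutes {..<n}}" and i: "i < n"
    have "s i < n" using s i permutes_in_image[of s "{..<n}" i] by simp
    thus "norm (of_real q * (p i / p (s i))) < 1" using p i q by (simp add: norm_mult norm_divide)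
  qed (auto intro: finite_permutations)
  hence "(h has_sum (of_real (q ^ ?C / (1 - q) ^ n) * full_factor q {..<n} p)) ?L"
    by (subst (asm) cauchy_det_full_factor[OF q]) (use p in auto)
  hence "(h has_sum (of_real (q ^ ?C / (1 - q) ^ n) * full_factor q {..<n} p)) {l \<in> ?L. inj_on l {..<n}}"
    by (rule has_sum_cong_neutral[THEN iffD1, rotated 3]) (auto simp: h_def alternant_not_inj)
  hence "((\<lambda>x. h ((\<lambda>(rho, s). restrict (staircase n rho \<circ> s) {..<n}) x)) has_sum (of_real (q ^ ?C / (1 - q) ^ n) * full_factor q {..<n} p))
     (parts_le n \<times> {s. s permutes {..<n}})"
    by (subst has_sum_reindex_bij_betw[OF bij_betw_strict_perm])
  hence "((\<lambda>rho. of_real (q ^ (psize rho + ?C)) * alternant_sq n rho p)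
     has_sum (of_real (q ^ ?C / (1 - q) ^ n) * full_factor q {..<n} p)) (parts_le n)"
  proof (rule has_sum_SigmaD)
    fix rho assume r: "rho \<in> parts_le n"
    let ?k = "staircase n rho"
    have e: "h (restrict (?k \<circ> s) {..<n}) = of_real (q ^ (psize rho + ?C)) * alternant n ?k (\<lambda>i. 1 / p i) * (of_int (sign s) * (\<Prod>i<n. p i ^ ?k (s i)))"
      if s: "s permutes {..<n}" for s
    proof -
      have "alternant n (restrict (?k \<circ> s) {..<n}) (\<lambda>i. 1 / p i) = alternant n (?k \<circ> s) (\<lambda>i. 1 / p i)"
        by (rule alternant_cong) simp
      moreover have "(\<Sum>i<n. ?k (s i)) = psize rho + ?C"
        using sum.permute[OF s, of ?k] sum_staircase[OF r] by (simp add: o_def)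
      ultimately show ?thesis unfolding h_def by (simp add: alternant_comp[OF s])
    qed
    have "((\<lambda>s. h (restrict (?k \<circ> s) {..<n})) has_sum (\<Sum>s | s permutes {..<n}. h (restrict (?k \<circ> s) {..<n}))) {s. s permutes {..<n}}"
      by (intro has_sum_finite finite_permutations) simp
    moreover have "(\<Sum>s | s permutes {..<n}. h (restrict (?k \<circ> s) {..<n})) =
       of_real (q ^ (psize rho + ?C)) * (alternant n ?k p * alternant n ?k (\<lambda>i. 1 / p i))"
      by (simp add: e sum_distrib_left[symmetric] alternant_def[of n ?k p])
    ultimately show "((\<lambda>s. h (case (rho, s) of (rho, s) \<Rightarrow> restrict (staircase n rho \<circ> s) {..<n})) has_sum
       of_real (q ^ (psize rho + ?C)) * (alternant n ?k p * alternant n ?k (\<lambda>i. 1 / p i))) {s. s permutes {..<n}}"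
      by simp
  qed
  \<comment> \<open>Removes the constant power of \<open>q\<close> that the staircase puts on both
    sides.\<close>
  note scaled = has_sum_cmult_right[OF this, of "of_real (1 / q ^ ?C)"]
  have "of_real (1 / q ^ ?C) * (of_real (q ^ (psize rho + ?C)) * x) = of_real (q ^ psize rho) * x" for rho and x :: complex
    using q by (simp add: power_add)
  moreover have "of_real (1 / q ^ ?C) * (of_real (q ^ ?C / (1 - q) ^ n) * x) = x / of_real ((1 - q) ^ n)" for x :: complex
    using q by simp
  ultimately show ?thesis using scaled by (simp only:)
qed

section \<open>Identity (a)\<close>

lemma qpoch_0_0: "qpoch 0 0 k = 1"
  by (simp add: qpoch_def)

lemma qW_weight_0: "qW_weight 0 n mu = 1"
  by (simp add: qW_weight_def qpoch_0_0)

lemma norm_tavg_le: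
  assumes "0 < N" "\<And>p. p \<in> torus n N \<Longrightarrow> norm (F p) \<le> B" shows "norm (tavg n N F) \<le> B"
proof -
  have "norm (\<Sum>p\<in>torus n N. F p) \<le> (\<Sum>p\<in>torus n N. B)" by (rule sum_norm_le) (rule assms(2))
  also have "\<dots> = real N ^ n * B" using card_torus[OF assms(1), of "{..<n}"] by (simp add: torus_def)
  finally show ?thesis unfolding tavg_def using assms(1) by (simp add: norm_divide norm_power field_simps)
qed

lemma tavg_symmetrize:
  "tavg n N F = tavg n N (\<lambda>p. \<Sum>s | s permutes {..<n}. F (p \<circ> s)) / fact n"
proof -
  have "(\<Sum>p\<in>torus n N. \<Sum>s | s permutes {..<n}. F (p \<circ> s)) = (\<Sum>s | s permutes {..<n}. \<Sum>p\<in>torus n N. F (p \<circ> s))"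
    by (rule sum.swap)
  also have "\<dots> = (\<Sum>s | s permutes {..<n}. \<Sum>p\<in>torus n N. F p)"
    by (intro sum.cong refl sum_torus_permute) simp
  also have "\<dots> = fact n * (\<Sum>p\<in>torus n N. F p)"
    using card_permutations[of "{..<n}" n] by simp
  finally show ?thesis by (simp add: tavg_def)
qed

lemma partition_0_in_box: "(\<lambda>_. 0) \<in> part_box n 0"
  by (auto simp: part_box_def intro!: is_partitionI[of _ 0])

abbreviation qW_pair_sum :: "real \<Rightarrow> nat \<Rightarrow> real list \<Rightarrow> real list \<Rightarrow> real" where
  "qW_pair_sum q n xs ys \<equiv>
     \<Sum>mu\<in>part_box n (length ys). qW_weight q n mu * skew_qW q ys mu empty_part * skew_qW q xs mu empty_part"

text \<open>At the empty partition all exponents are zero, so the coefficient is the plain average,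
  and its weight is \<open>1 / qpoch q q n\<close>; this is the origin of the divisor.\<close>

lemma qW_sum_limit:
  assumes q: "0 < q" "q < 1" and ys: "\<forall>y\<in>set ys. y \<noteq> 0"
  shows "(\<lambda>N. tavg n (Suc N) (\<lambda>p. prod_neg n ys p * (prod_pos n xs p * qW_kernel q n p)) / of_real (qpoch q q n)) \<longlonglongrightarrow>
    of_real (qW_pair_sum q n xs ys)"
proof -
  let ?z = "\<lambda>_::nat. 0::nat"
  let ?B = "\<lambda>p. prod_pos n xs p * qW_kernel q n p"
  have q0: "0 \<le> q" using q by simp
  have ex: "exchange_kernel q n ?B"
    by (rule exchange_kernel_mult[OF exchange_kernel_qW[OF q0 q(2)] prod_pos_permute])
  have lim: "(\<lambda>N. tcoef n (Suc N) ?B (conj_part mu)) \<longlonglongrightarrow> of_real (skew_qW q xs mu ?z)"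
    if "is_partition mu" "mu 0 \<le> n" for mu
  proof (rule tendsto_skew_qW[OF q0 q(2) exchange_kernel_qW[OF q0 q(2)] _ _ that])
    fix lam assume "is_partition lam" "lam 0 \<le> n"
    thus "(\<lambda>N. tcoef n (Suc N) (qW_kernel q n) (conj_part lam)) \<longlonglongrightarrow> (if lam = ?z then 1 else 0)"
      by (rule tendsto_tcoef_qW_kernel[OF q])
  next
    fix xs v assume n: "0 < n" and v: "v (n - 1) < (0::int)"
    then obtain n' where n': "n = Suc n'" by (cases n) auto
    obtain r R phi where "1 < r" "r < R"
      "\<And>g. g \<in> unit_tuples n' \<Longrightarrow> phi g holomorphic_on ball 0 R"
      "bdd_on (unit_tuples n' \<times> {u. norm u = r}) (\<lambda>(g, u). phi g u)"
      "\<And>g u. g \<in> unit_tuples n' \<Longrightarrow> norm u = 1 \<Longrightarrow> qW_kernel q (Suc n') (g(n' := u)) = phi g u"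
      by (rule qW_kernel_last[OF q, of n']) blast
    hence "(\<lambda>N. tcoef (Suc n') N (\<lambda>p. prod_pos (Suc n') xs p * qW_kernel q (Suc n') p) v) \<longlonglongrightarrow> 0"
      by (rule tendsto_tcoef_neg[where v = v]) (use v in \<open>simp_all add: n'\<close>)
    thus "(\<lambda>N. tcoef n (Suc N) (\<lambda>p. prod_pos n xs p * qW_kernel q n p) v) \<longlonglongrightarrow> 0"
      unfolding n' by (rule LIMSEQ_Suc)
  qed
  have w: "qW_weight q n ?z = 1 / qpoch q q n" by (simp add: qW_weight_def)
  have "tavg n (Suc N) (\<lambda>p. prod_neg n ys p * ?B p) / of_real (qpoch q q n) =
     (\<Sum>mu\<in>part_box n (length ys). of_real (qW_weight q n mu * skew_qW q ys mu ?z) * tcoef n (Suc N) ?B (conj_part mu))" for N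
    using sum_weight_skew_qW[OF q0 q(2) _ ex partition_0_in_box ys, of "Suc N"] w
    by (simp add: tcoef_def conj_part_zero)
  moreover have "(\<lambda>N. \<Sum>mu\<in>part_box n (length ys). of_real (qW_weight q n mu * skew_qW q ys mu ?z) * tcoef n (Suc N) ?B (conj_part mu))
     \<longlonglongrightarrow> (\<Sum>mu\<in>part_box n (length ys). of_real (qW_weight q n mu * skew_qW q ys mu ?z) * of_real (skew_qW q xs mu ?z))"
    by (intro tendsto_intros lim) (auto simp: part_box_def)
  ultimately show ?thesis by simp
qed

lemma schur_sum_limit:
  assumes ys: "\<forall>y\<in>set ys. y \<noteq> 0" and rho: "rho \<in> part_box n l"
  shows "(\<lambda>N. tcoef n (Suc N) (\<lambda>p. prod_neg n ys p * (prod_pos n xs p * schur_kernel n (staircase n rho) p)) (conj_part rho)) \<longlonglongrightarrow>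
    of_real (\<Sum>lam\<in>part_box n (l + length ys). skew_qW 0 ys lam rho * skew_qW 0 xs lam rho)"
proof -
  let ?K = "schur_kernel n (staircase n rho)"
  let ?B = "\<lambda>p. prod_pos n xs p * ?K p"
  have ex: "exchange_kernel 0 n ?B"
    by (rule exchange_kernel_mult[OF exchange_kernel_schur prod_pos_permute])
  have lim: "(\<lambda>N. tcoef n (Suc N) ?B (conj_part mu)) \<longlonglongrightarrow> of_real (skew_qW 0 xs mu rho)"
    if "is_partition mu" "mu 0 \<le> n" for mu
  proof (rule tendsto_skew_qW[OF _ _ exchange_kernel_schur _ _ that])
    fix lam assume "is_partition lam" "lam 0 \<le> n"
    thus "(\<lambda>N. tcoef n (Suc N) ?K (conj_part lam)) \<longlonglongrightarrow> (if lam = rho then 1 else 0)"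
      using rho by (intro tendsto_tcoef_schur_kernel) (auto simp: part_box_def)
  next
    fix xs v assume n: "0 < n" and v: "v (n - 1) < (0::int)"
    then obtain n' where n': "n = Suc n'" by (cases n) auto
    obtain phi where phi: "\<And>g. g \<in> unit_tuples n' \<Longrightarrow> phi g holomorphic_on ball 0 3"
      "bdd_on (unit_tuples n' \<times> {u. norm u = 2}) (\<lambda>(g, u). phi g u)"
      "\<And>g u. g \<in> unit_tuples n' \<Longrightarrow> norm u = 1 \<Longrightarrow> schur_kernel (Suc n') (staircase n rho) (g(n' := u)) = phi g u"
      by (rule schur_kernel_last[of n' "staircase n rho"]) blast
    have "(\<lambda>N. tcoef (Suc n') N (\<lambda>p. prod_pos (Suc n') xs p * schur_kernel (Suc n') (staircase n rho) p) v) \<longlonglongrightarrow> 0"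
      by (rule tendsto_tcoef_neg[OF _ _ phi]) (use v n' in simp_all)
    thus "(\<lambda>N. tcoef n (Suc N) (\<lambda>p. prod_pos n xs p * ?K p) v) \<longlonglongrightarrow> 0"
      unfolding n' by (rule LIMSEQ_Suc)
  qed simp_all
  have "tcoef n (Suc N) (\<lambda>p. prod_neg n ys p * ?B p) (conj_part rho) =
     (\<Sum>mu\<in>part_box n (l + length ys). of_real (skew_qW 0 ys mu rho) * tcoef n (Suc N) ?B (conj_part mu))" for N
    using sum_weight_skew_qW[of 0 "Suc N" n ?B rho l ys] ex rho ys by (simp add: qW_weight_0)
  moreover have "(\<lambda>N. \<Sum>mu\<in>part_box n (l + length ys). of_real (skew_qW 0 ys mu rho) * tcoef n (Suc N) ?B (conj_part mu))
     \<longlonglongrightarrow> (\<Sum>mu\<in>part_box n (l + length ys). of_real (skew_qW 0 ys mu rho) * of_real (skew_qW 0 xs mu rho))"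
    by (intro tendsto_intros lim) (auto simp: part_box_def)
  ultimately show ?thesis by simp
qed

text \<open>The least empty row of \<open>rho\<close> determines a finite box outside of which the
  skew functions of \<open>ys\<close> vanish.\<close>

definition schur_pair_sum :: "nat \<Rightarrow> real list \<Rightarrow> real list \<Rightarrow> (nat \<Rightarrow> nat) \<Rightarrow> real" where
  "schur_pair_sum n xs ys rho =
     (\<Sum>lam\<in>part_box n ((LEAST r. rho r = 0) + length ys). skew_qW 0 ys lam rho * skew_qW 0 xs lam rho)"

lemma Least_row: "rho \<in> parts_le n \<Longrightarrow> rho \<in> part_box n (LEAST r. rho r = 0)"
  using is_partition_eventually_0[of rho] LeastI[of "\<lambda>r. rho r = 0"] unfolding parts_le_def part_box_def by blast

text \<open>Reading off the coefficient multiplies the alternant by a single monomial in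
  \<open>1 / p\<close>. Symmetrizing transfers the sign of the alternant to that monomial, whose
  signed sum is the second alternant.\<close>

lemma tcoef_schur_symmetrized:
  assumes rho: "rho \<in> parts_le n" and N: "0 < N" and G: "\<And>p s. s permutes {..<n} \<Longrightarrow> G (p \<circ> s) = G p"
  shows "tcoef n N (\<lambda>p. G p * schur_kernel n (staircase n rho) p) (conj_part rho) =
     tavg n N (\<lambda>p. G p * alternant_sq n rho p) / fact n"
proof -
  let ?k = "staircase n rho"
  have e: "G p * schur_kernel n ?k p * (\<Prod>i<n. p i powi (- conj_part rho i)) = G p * (alternant n ?k p * (\<Prod>i<n. (1 / p i) ^ ?k i))"
    if p: "p \<in> torus n N" for p
  proof -
    have "p i powi (- int (n - Suc i)) * p i powi (- conj_part rho i) = (1 / p i) ^ ?k i" if "i < n" for i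
    proof -
      have nz: "p i \<noteq> 0" using torus_nz[OF p N that] .
      have "- int (n - Suc i) + - conj_part rho i = - int (?k i)" by (simp add: staircase_def conj_part_def)
      hence "p i powi (- int (n - Suc i)) * p i powi (- conj_part rho i) = p i powi (- int (?k i))"
        using nz power_int_add[of "p i" "- int (n - Suc i)" "- conj_part rho i"] by simp
      thus ?thesis by (simp add: power_int_minus power_one_over inverse_eq_divide)
    qed
    thus ?thesis unfolding schur_kernel_def by (simp add: mult.assoc prod.distrib[symmetric])
  qed
  have "tcoef n N (\<lambda>p. G p * schur_kernel n ?k p) (conj_part rho) = tavg n N (\<lambda>p. G p * (alternant n ?k p * (\<Prod>i<n. (1 / p i) ^ ?k i)))"
    unfolding tcoef_def tavg_def by (simp add: e)
  also have "\<dots> = tavg n N (\<lambda>p. \<Sum>s | s permutes {..<n}. G (p \<circ> s) * (alternant n ?k (p \<circ> s) * (\<Prod>i<n. (1 / (p \<circ> s) i) ^ ?k i))) / fact n"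
    by (rule tavg_symmetrize)
  also have "(\<lambda>p. \<Sum>s | s permutes {..<n}. G (p \<circ> s) * (alternant n ?k (p \<circ> s) * (\<Prod>i<n. (1 / (p \<circ> s) i) ^ ?k i))) =
     (\<lambda>p. G p * (alternant n ?k p * alternant n ?k (\<lambda>i. 1 / p i)))"
  proof
    fix p
    have "(\<Sum>s | s permutes {..<n}. G (p \<circ> s) * (alternant n ?k (p \<circ> s) * (\<Prod>i<n. (1 / (p \<circ> s) i) ^ ?k i)))
      = (\<Sum>s | s permutes {..<n}. G p * alternant n ?k p * (of_int (sign s) * (\<Prod>i<n. (1 / p (s i)) ^ ?k i)))"
      by (intro sum.cong refl) (simp add: G alternant_permute mult_ac)
    also have "\<dots> = G p * (alternant n ?k p * alternant n ?k (\<lambda>i. 1 / p i))"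
      unfolding sum_distrib_left[symmetric] alternant_inverse by (simp only: mult.assoc)
    finally show "(\<Sum>s | s permutes {..<n}. G (p \<circ> s) * (alternant n ?k (p \<circ> s) * (\<Prod>i<n. (1 / (p \<circ> s) i) ^ ?k i))) =
       G p * (alternant n ?k p * alternant n ?k (\<lambda>i. 1 / p i))" .
  qed
  finally show ?thesis .
qed

lemma norm_alternant_le:
  assumes "\<And>i. i < n \<Longrightarrow> norm (p i) = 1" shows "norm (alternant n k p) \<le> fact n"
proof -
  have "norm (alternant n k p) \<le> (\<Sum>s | s permutes {..<n}. 1)"
    unfolding alternant_def
    by (intro sum_norm_le) (simp add: norm_mult assms norm_power sign_def flip: prod_norm)
  also have "\<dots> = fact n" using card_permutations[of "{..<n}" n] by simp
  finally show ?thesis .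
qed

text \<open>For fixed N the sum over \<open>rho\<close> is taken inside the finite average; then N
  grows. The interchange is licensed by the majorant \<open>q ^ psize rho\<close> times a constant:
  alternants on the unit torus are bounded by \<open>fact n\<close>, and the symmetric factor
  \<open>G\<close> by \<open>C\<close>.\<close>

lemma has_sum_schur_pair:
  assumes q: "0 < q" "q < 1" and ys: "\<forall>y\<in>set ys. y \<noteq> 0"
  shows "((\<lambda>rho. q ^ psize rho * schur_pair_sum n xs ys rho) has_sum
    qW_pair_sum q n xs ys) (parts_le n)"
proof -
  define G where "G p = prod_neg n ys p * prod_pos n xs p" for p
  have G: "G (p \<circ> s) = G p" if "s permutes {..<n}" for p s
    using that by (simp only: G_def prod_neg_permute prod_pos_permute)
  have "bdd_on (unit_tuples n) G"
    unfolding G_def prod_neg_def prod_pos_def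
    by (intro bdd_on_mult bdd_on_prod_list bdd_on_prod bdd_on_add bdd_on_const bdd_onI[where B = 1])
       (auto simp: unit_tuples_def norm_power_int norm_inverse)
  then obtain C where C: "\<And>p. p \<in> unit_tuples n \<Longrightarrow> norm (G p) \<le> C" unfolding bdd_on_def by blast
  define V where "V N rho = of_real (q ^ psize rho) * tcoef n (Suc N) (\<lambda>p. G p * schur_kernel n (staircase n rho) p) (conj_part rho)" for N rho
  have V: "V N rho = tavg n (Suc N) (\<lambda>p. G p * (of_real (q ^ psize rho) * alternant_sq n rho p)) / fact n"
    if "rho \<in> parts_le n" for N rho
    unfolding V_def using tcoef_schur_symmetrized[OF that, of "Suc N" G, OF _ G]
    by (simp add: tavg_def sum_distrib_left mult_ac)
  have "((\<lambda>rho. of_real (q ^ psize rho * schur_pair_sum n xs ys rho) :: complex) has_sum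
    of_real (qW_pair_sum q n xs ys)) (parts_le n)"
  proof (rule has_sum_dominated)
    fix rho assume rho: "rho \<in> parts_le n"
    have "(\<lambda>N. tcoef n (Suc N) (\<lambda>p. G p * schur_kernel n (staircase n rho) p) (conj_part rho)) \<longlonglongrightarrow> of_real (schur_pair_sum n xs ys rho)"
      using schur_sum_limit[OF ys Least_row[OF rho], of xs] unfolding schur_pair_sum_def G_def mult.assoc .
    thus "(\<lambda>N. V N rho) \<longlonglongrightarrow> of_real (q ^ psize rho * schur_pair_sum n xs ys rho)"
      unfolding V_def of_real_mult by (intro tendsto_intros)
    show "norm (V N rho) \<le> q ^ psize rho * (C * (fact n * fact n))" for N
    proof -
      have "norm (tavg n (Suc N) (\<lambda>p. G p * (of_real (q ^ psize rho) * alternant_sq n rho p)))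
         \<le> q ^ psize rho * (C * (fact n * fact n))"
      proof (rule norm_tavg_le)
        fix p assume p: "p \<in> torus n (Suc N)"
        have u: "norm (p i) = 1" if "i < n" for i using torus_norm[OF p _ that] by simp
        have 1: "norm (G p) \<le> C" using torus_unit[OF _ p] by (intro C) simp
        have 2: "norm (alternant n (staircase n rho) p) * norm (alternant n (staircase n rho) (\<lambda>i. 1 / p i)) \<le> fact n * fact n"
          using u by (intro mult_mono norm_alternant_le) (auto simp: norm_divide)
        have 3: "norm (G p) * (norm (alternant n (staircase n rho) p) * norm (alternant n (staircase n rho) (\<lambda>i. 1 / p i))) \<le> C * (fact n * fact n)"
          using order_trans[OF norm_ge_zero 1] by (intro mult_mono[OF 1 2]) auto
        have "norm (G p * (of_real (q ^ psize rho) * alternant_sq n rho p))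
           = q ^ psize rho * (norm (G p) * (norm (alternant n (staircase n rho) p) * norm (alternant n (staircase n rho) (\<lambda>i. 1 / p i))))"
          using q by (simp add: norm_mult norm_power mult_ac)
        also have "\<dots> \<le> q ^ psize rho * (C * (fact n * fact n))" using 3 q by (intro mult_left_mono) auto
        finally show "norm (G p * (of_real (q ^ psize rho) * alternant_sq n rho p)) \<le> \<dots>" .
      qed simp
      moreover have "norm (z / fact n) \<le> norm z" for z :: complex
        by (simp add: norm_divide divide_le_eq mult_left_le mult_le_cancel_left1 fact_ge_1)
      ultimately show ?thesis unfolding V[OF rho] using order_trans by blast
    qed
  next
    show "(\<lambda>rho. q ^ psize rho * (C * (fact n * fact n))) summable_on parts_le n"
      by (rule summable_on_cmult_left[OF summable_on_psize[OF q]])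
  next
    fix N
    have "((\<lambda>rho. tavg n (Suc N) (\<lambda>p. G p * (of_real (q ^ psize rho) * alternant_sq n rho p)) / fact n)
      has_sum (tavg n (Suc N) (\<lambda>p. G p * (full_factor q {..<n} p / of_real ((1 - q) ^ n))) / fact n)) (parts_le n)"
      unfolding tavg_def divide_inverse[of _ "of_nat (Suc N) ^ n"] divide_inverse[of _ "fact n"]
      using finite_torus[of "Suc N" n] torus_norm[of _ n "Suc N"]
      by (intro has_sum_cmult_left has_sum_finite_sum has_sum_cmult_right has_sum_alternants[OF q]) auto
    \<comment> \<open>The two sides meet here: since \<open>G\<close> is symmetric, the q-Whittaker
      kernel may be replaced by its symmetrization, a multiple of the same
      \<open>full_factor\<close>.\<close>
    also have "tavg n (Suc N) (\<lambda>p. G p * (full_factor q {..<n} p / of_real ((1 - q) ^ n))) / fact n =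
      tavg n (Suc N) (\<lambda>p. G p * qW_kernel q n p) / of_real (qpoch q q n)"
    proof -
      have qn: "qpoch q q n \<noteq> 0" using qpoch_pos[of q n] q by simp
      have "tavg n (Suc N) (\<lambda>p. G p * qW_kernel q n p) = tavg n (Suc N) (\<lambda>p. \<Sum>s | s permutes {..<n}. G (p \<circ> s) * qW_kernel q n (p \<circ> s)) / fact n"
        by (rule tavg_symmetrize)
      also have "tavg n (Suc N) (\<lambda>p. \<Sum>s | s permutes {..<n}. G (p \<circ> s) * qW_kernel q n (p \<circ> s)) =
         of_real (qpoch q q n) * tavg n (Suc N) (\<lambda>p. G p * (full_factor q {..<n} p / of_real ((1 - q) ^ n)))"
      proof -
        have "(\<Sum>s | s permutes {..<n}. G (p \<circ> s) * qW_kernel q n (p \<circ> s)) =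
            of_real (qpoch q q n) * (G p * (full_factor q {..<n} p / of_real ((1 - q) ^ n)))" if p: "p \<in> torus n (Suc N)" for p
        proof -
          have u: "norm (p i) = 1" if "i < n" for i using torus_norm[OF p _ that] by simp
          have "(\<Sum>s | s permutes {..<n}. G (p \<circ> s) * qW_kernel q n (p \<circ> s)) = G p * (\<Sum>s | s permutes {..<n}. qW_kernel q n (p \<circ> s))"
            unfolding sum_distrib_left by (intro sum.cong refl) (simp add: G)
          thus ?thesis using sum_qW_kernel_permute[of q n p] q u by simp
        qed
        thus ?thesis unfolding tavg_def by (simp add: sum_distrib_left)
      qed
      finally show ?thesis using qn by simp
    qed
    finally show "(V N has_sum (tavg n (Suc N) (\<lambda>p. G p * qW_kernel q n p) / of_real (qpoch q q n))) (parts_le n)"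
      by (subst has_sum_cong[OF V])
  next
    show "(\<lambda>N. tavg n (Suc N) (\<lambda>p. G p * qW_kernel q n p) / of_real (qpoch q q n)) \<longlonglongrightarrow>
      of_real (qW_pair_sum q n xs ys)"
      using qW_sum_limit[OF q ys, of n xs] unfolding G_def mult.assoc .
  qed
  thus ?thesis by (simp only: has_sum_of_real_iff)
qed

section \<open>Identification with Schur and q-Whittaker polynomials\<close>

lemma skew_qW_not_subset:
  assumes "\<not> psubseteq rho lam" shows "skew_qW q xs lam rho = 0"
  using assms
proof (induction xs arbitrary: lam)
  case (Cons x xs)
  have "skew_qW q xs mu rho = 0" if "interlace mu lam" for mu
    using that Cons.prems by (intro Cons.IH) (auto simp: psubseteq_def interlace_def intro: le_trans)
  thus ?case by simp
qed (auto simp: psubseteq_def)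

lemma qw_psi_0: "qw_psi 0 lam mu = 1"
  by (simp add: qw_psi_def qbinom_def qpoch_0_0)

lemma schur_rev_eq: "is_partition lam \<Longrightarrow> schur_rev xs lam rho = skew_qW 0 xs lam rho"
proof (induction xs arbitrary: lam)
  case (Cons x xs)
  have "(\<Sum>nu | is_partition nu \<and> interlace nu lam \<and> psubseteq rho nu. x ^ (psize lam - psize nu) * schur_rev xs nu rho)
    = (\<Sum>nu | is_partition nu \<and> interlace nu lam \<and> psubseteq rho nu. x ^ (psize lam - psize nu) * skew_qW 0 xs nu rho)"
    by (intro sum.cong refl) (simp add: Cons.IH)
  also have "\<dots> = (\<Sum>nu | interlace nu lam. x ^ (psize lam - psize nu) * skew_qW 0 xs nu rho)"
    using interlaced_is_partition Cons.prems
    by (intro sum.mono_neutral_left finite_interlaced) (auto simp: skew_qW_not_subset)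
  finally show ?case by (simp add: qw_psi_0)
qed simp

lemma qwP_rev_eq: "is_partition lam \<Longrightarrow> qwP_rev q xs lam = skew_qW q xs lam empty_part"
proof (induction xs arbitrary: lam)
  case (Cons x xs)
  have "{mu. is_partition mu \<and> interlace mu lam} = {mu. interlace mu lam}"
    using interlaced_is_partition Cons.prems by blast
  thus ?case using Cons.IH interlaced_is_partition Cons.prems by simp
qed (auto simp: fun_eq_iff)

lemma qw_psi_nonneg:
  assumes "0 \<le> q" "q < 1" shows "0 \<le> qw_psi q lam mu"
proof -
  have "0 \<le> qbinom q a b" for a b
    using qpoch_pos[OF assms] by (simp add: qbinom_def less_imp_le)
  thus ?thesis unfolding qw_psi_def by (intro prod_nonneg) auto
qed

lemma skew_qW_nonneg:
  assumes "0 \<le> q" "q < 1" "\<forall>x\<in>set xs. 0 \<le> x" shows "0 \<le> skew_qW q xs lam rho"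
  using assms by (induction xs arbitrary: lam) (auto intro!: sum_nonneg mult_nonneg_nonneg qw_psi_nonneg)

lemma finite_subpartitions:
  assumes "is_partition lam" shows "finite {rho. is_partition rho \<and> psubseteq rho lam}"
proof -
  obtain r where "lam r = 0" using is_partition_eventually_0[OF assms] by blast
  hence "{rho. is_partition rho \<and> psubseteq rho lam} \<subseteq> part_box (lam 0) r"
    by (auto simp: part_box_def psubseteq_def) (metis le_0_eq)
  thus ?thesis using finite_part_box finite_subset by blast
qed

text \<open>Interchanges the order of summation over \<open>rho\<close> and \<open>lam\<close>. For
  fixed \<open>rho\<close> the sum over \<open>lam\<close> is finite and its values are summable, so
  nonnegativity gives joint summability.\<close>

lemma has_sum_schur:
  assumes q: "0 < q" "q < 1" and xs: "\<forall>x\<in>set xs. 0 < x" and ys: "\<forall>y\<in>set ys. 0 < y"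
  shows "((\<lambda>lam. \<Sum>rho | is_partition rho \<and> psubseteq rho lam. q ^ psize rho * skew_qW 0 xs lam rho * skew_qW 0 ys lam rho) has_sum
    qW_pair_sum q n xs ys) (parts_le n)"
proof -
  let ?T = "qW_pair_sum q n xs ys"
  define f where "f = (\<lambda>(rho, lam). q ^ psize rho * skew_qW 0 xs lam rho * skew_qW 0 ys lam rho)"
  have f0: "0 \<le> f (rho, lam)" for rho lam
    using q xs ys by (auto simp: f_def intro!: mult_nonneg_nonneg skew_qW_nonneg)
  have inner: "((\<lambda>lam. f (rho, lam)) has_sum (q ^ psize rho * schur_pair_sum n xs ys rho)) (parts_le n)" if rho: "rho \<in> parts_le n" for rho
  proof -
    let ?P = "part_box n ((LEAST r. rho r = 0) + length ys)"
    have "((\<lambda>lam. f (rho, lam)) has_sum (\<Sum>lam\<in>?P. f (rho, lam))) ?P"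
      by (intro has_sum_finite finite_part_box)
    moreover have "f (rho, lam) = 0" if "lam \<in> parts_le n - ?P" for lam
      using that skew_qW_eq_0[of lam rho "LEAST r. rho r = 0" ys 0] Least_row[OF rho]
      by (auto simp: f_def parts_le_def part_box_def)
    ultimately have "((\<lambda>lam. f (rho, lam)) has_sum (\<Sum>lam\<in>?P. f (rho, lam))) (parts_le n)"
      by (subst has_sum_cong_neutral[where T = ?P and g = "\<lambda>lam. f (rho, lam)"]) (auto simp: parts_le_def part_box_def)
    moreover have "(\<Sum>lam\<in>?P. f (rho, lam)) = q ^ psize rho * schur_pair_sum n xs ys rho"
      by (simp add: f_def schur_pair_sum_def sum_distrib_left mult_ac)
    ultimately show ?thesis by simp
  qed
  have tot: "((\<lambda>rho. q ^ psize rho * schur_pair_sum n xs ys rho) has_sum ?T) (parts_le n)"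
    by (rule has_sum_schur_pair[OF q]) (use ys in auto)
  have summ: "f summable_on (parts_le n \<times> parts_le n)"
    by (rule summable_on_SigmaI[OF inner]) (use tot f0 in \<open>auto dest: has_sum_imp_summable\<close>)
  have "(f has_sum ?T) (parts_le n \<times> parts_le n)"
    by (rule has_sum_SigmaI[where f = f, OF _ tot summ]) (rule inner)
  hence "((\<lambda>(x, y). f (y, x)) has_sum ?T) (parts_le n \<times> parts_le n)"
    by (simp only: has_sum_swap[of f])
  thus ?thesis
  proof (rule has_sum_SigmaD)
    fix lam assume lam: "lam \<in> parts_le n"
    let ?R = "{rho. is_partition rho \<and> psubseteq rho lam}"
    have "((\<lambda>rho. f (rho, lam)) has_sum (\<Sum>rho\<in>?R. f (rho, lam))) ?R"
      using lam by (intro has_sum_finite finite_subpartitions) (simp add: parts_le_def)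
    moreover have "f (rho, lam) = 0" if "rho \<in> parts_le n - ?R" for rho
      using that by (auto simp: f_def parts_le_def skew_qW_not_subset)
    moreover have "?R \<subseteq> parts_le n" using lam by (auto simp: parts_le_def psubseteq_def intro: le_trans)
    ultimately have "((\<lambda>rho. f (rho, lam)) has_sum (\<Sum>rho\<in>?R. f (rho, lam))) (parts_le n)"
      by (subst has_sum_cong_neutral[where T = ?R and g = "\<lambda>rho. f (rho, lam)"]) auto
    thus "((\<lambda>rho. case (lam, rho) of (x, y) \<Rightarrow> f (y, x)) has_sum
       (\<Sum>rho\<in>?R. q ^ psize rho * skew_qW 0 xs lam rho * skew_qW 0 ys lam rho)) (parts_le n)"
      by (simp add: f_def)
  qed
qed

text \<open>Telescopes, since 1/(q;q)_{m+1} - 1/(q;q)_m = q^(m+1)/(q;q)_{m+1}.\<close>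

lemma sum_P_chi:
  assumes "0 < q" "q < 1" shows "(\<Sum>k\<le>m. P_chi q k) = qpoch_inf q q / qpoch q q m"
proof (induction m)
  case 0
  show ?case by (simp add: P_chi_def)
next
  case (Suc m)
  have pos: "qpoch q q m \<noteq> 0" "qpoch q q (Suc m) \<noteq> 0" using qpoch_pos[of q] assms by (auto simp: less_imp_neq[THEN not_sym])
  hence "1 - q * q ^ m \<noteq> 0" by (simp add: qpoch_Suc)
  thus ?case using Suc pos by (simp add: P_chi_def qpoch_Suc divide_simps) (simp add: algebra_simps)
qed

text \<open>The common value is \<open>?c * ?T\<close>. On the q-Whittaker side the cumulative law
  of chi completes the factor of \<open>qW_Q\<close> to \<open>qW_weight\<close>, and since
  \<open>mu\<close> has at most \<open>length bs\<close> rows that sum is finite. The lists are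
  reversed as in \<open>qW_P\<close> and \<open>skew_schur\<close>.\<close>

lemma identity_a_value:
  assumes q: "0 < q" "q < 1" and as: "\<forall>a\<in>set as. 0 < a" and bs: "\<forall>b\<in>set bs. 0 < b"
  obtains p where
    "((\<lambda>mu. M_qW q as bs mu * (if mu 0 \<le> n then (\<Sum>k\<le>n - mu 0. P_chi q k) else 0)) has_sum p) partitions"
    "((\<lambda>lam. M_pS q as bs lam * (if lam 0 \<le> n then 1 else 0)) has_sum p) partitions"
proof
  let ?xs = "rev as" and ?ys = "rev bs"
  let ?T = "qW_pair_sum q n ?xs ?ys"
  let ?c = "qpoch_inf q q * cauchy_prod q as bs"
  define F where "F mu = M_qW q as bs mu * (if mu 0 \<le> n then (\<Sum>k\<le>n - mu 0. P_chi q k) else 0)" for mu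
  have F: "F mu = ?c * (qW_weight q n mu * skew_qW q ?ys mu empty_part * skew_qW q ?xs mu empty_part)" if "is_partition mu" "mu 0 \<le> n" for mu
    using that by (simp add: F_def M_qW_def qW_P_def qW_Q_def qwP_rev_eq qW_weight_def sum_P_chi[OF q])
  have "(F has_sum (\<Sum>mu\<in>part_box n (length ?ys). F mu)) (part_box n (length ?ys))"
    by (intro has_sum_finite finite_part_box)
  moreover have "(\<Sum>mu\<in>part_box n (length ?ys). F mu) = ?c * ?T"
    unfolding sum_distrib_left by (intro sum.cong refl F) (auto simp: part_box_def)
  moreover have "F mu = 0" if mu: "mu \<in> partitions - part_box n (length ?ys)" for mu
  proof (cases "mu 0 \<le> n")
    case True
    hence "mu (0 + length ?ys) \<noteq> 0" "is_partition mu" using mu by (auto simp: partitions_def part_box_def)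
    hence "skew_qW q ?ys mu empty_part = 0" by (intro skew_qW_eq_0[of _ _ 0]) auto
    thus ?thesis using F[OF \<open>is_partition mu\<close> True] by simp
  qed (simp add: F_def)
  ultimately have "(F has_sum (?c * ?T)) partitions"
    by (subst has_sum_cong_neutral[where T = "part_box n (length ?ys)" and g = F]) (auto simp: partitions_def part_box_def)
  thus "((\<lambda>mu. M_qW q as bs mu * (if mu 0 \<le> n then (\<Sum>k\<le>n - mu 0. P_chi q k) else 0)) has_sum (?c * ?T)) partitions"
    unfolding F_def .
  have "((\<lambda>lam. ?c * (\<Sum>rho | is_partition rho \<and> psubseteq rho lam. q ^ psize rho * skew_qW 0 ?xs lam rho * skew_qW 0 ?ys lam rho)) has_sum (?c * ?T)) (parts_le n)"
    by (intro has_sum_cmult_right has_sum_schur[OF q]) (use as bs in auto)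
  thus "((\<lambda>lam. M_pS q as bs lam * (if lam 0 \<le> n then 1 else 0)) has_sum (?c * ?T)) partitions"
    by (rule has_sum_cong_neutral[THEN iffD1, rotated 3])
       (auto simp: parts_le_def partitions_def M_pS_def skew_schur_def schur_rev_eq)
qed

section \<open>The shift by chi and S\<close>

lemma tendsto_qpoch:
  assumes "0 < q" "q < 1" shows "(\<lambda>n. qpoch x q n) \<longlonglongrightarrow> qpoch_inf x q"
proof -
  have "summable (\<lambda>j. norm ((1 - x * q ^ j) - 1))"
    using assms by (simp add: abs_mult power_abs summable_mult)
  hence "convergent_prod (\<lambda>j. 1 - x * q ^ j)"
    by (intro abs_convergent_prod_imp_convergent_prod) (simp only: abs_convergent_prod_conv_summable)
  hence "(\<lambda>n. \<Prod>j\<le>n. 1 - x * q ^ j) \<longlonglongrightarrow> qpoch_inf x q"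
    unfolding qpoch_inf_def by (rule convergent_prod_LIMSEQ)
  hence "(\<lambda>n. qpoch x q (Suc n)) \<longlonglongrightarrow> qpoch_inf x q"
    by (simp only: qpoch_def lessThan_Suc_atMost)
  thus ?thesis by (rule LIMSEQ_imp_Suc)
qed

lemma qpoch_Suc_head: "qpoch x q (Suc n) = (1 - x) * qpoch (x * q) q n"
  unfolding qpoch_def prod.lessThan_Suc_shift by (simp add: mult.assoc)

lemma qpoch_inf_step:
  assumes "0 < q" "q < 1" shows "qpoch_inf x q = (1 - x) * qpoch_inf (x * q) q"
proof (rule LIMSEQ_unique)
  show "(\<lambda>n. qpoch x q (Suc n)) \<longlonglongrightarrow> qpoch_inf x q" by (rule LIMSEQ_Suc[OF tendsto_qpoch[OF assms]])
  show "(\<lambda>n. qpoch x q (Suc n)) \<longlonglongrightarrow> (1 - x) * qpoch_inf (x * q) q"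
    unfolding qpoch_Suc_head by (intro tendsto_intros tendsto_qpoch[OF assms])
qed

lemma qpoch_inf_ge_1:
  assumes "0 < q" "q < 1" "x \<le> 0" shows "1 \<le> qpoch_inf x q"
proof (rule LIMSEQ_le_const[OF tendsto_qpoch[OF assms(1,2)]])
  have "1 \<le> qpoch x q n" for n
    unfolding qpoch_def using assms by (intro prod_ge_1) (auto simp: mult_le_0_iff)
  thus "\<exists>N. \<forall>n\<ge>N. 1 \<le> qpoch x q n" by blast
qed

lemma qpoch_inf_pos:
  assumes q: "0 < q" "q < 1" and x: "0 \<le> x" "x < 1"
  shows "0 < qpoch_inf x q" "qpoch_inf x q \<le> qpoch x q n"
proof -
  have f: "0 < 1 - x * q ^ j" "1 - x * q ^ j \<le> 1" for j
  proof -
    have "x * q ^ j \<le> x * 1" using q x by (intro mult_left_mono power_le_one) auto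
    thus "0 < 1 - x * q ^ j" using x by simp
    show "1 - x * q ^ j \<le> 1" using q x by simp
  qed
  have nn: "0 \<le> qpoch x q n" for n unfolding qpoch_def by (intro prod_nonneg) (use f in \<open>auto intro: less_imp_le\<close>)
  have dec: "decseq (qpoch x q)"
    by (rule decseq_SucI) (use nn f in \<open>auto simp: qpoch_Suc intro: mult_left_le\<close>)
  show "qpoch_inf x q \<le> qpoch x q n" by (rule decseq_ge[OF dec tendsto_qpoch[OF q]])
  have "summable (\<lambda>j. norm ((1 - x * q ^ j) - 1))"
    using q by (simp add: abs_mult power_abs summable_mult)
  hence cp: "convergent_prod (\<lambda>j. 1 - x * q ^ j)"
    by (intro abs_convergent_prod_imp_convergent_prod) (simp only: abs_convergent_prod_conv_summable)
  have "1 - x * q ^ j \<noteq> 0" for j using f(1)[of j] by simp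
  hence "qpoch_inf x q \<noteq> 0" unfolding qpoch_inf_def by (rule prodinf_nonzero[OF cp])
  moreover have "0 \<le> qpoch_inf x q" by (rule LIMSEQ_le_const[OF tendsto_qpoch[OF q]]) (use nn in blast)
  ultimately show "0 < qpoch_inf x q" by simp
qed

text \<open>The recursion for the coefficients says E(w) = (1 + w) E(w q). Iterating it extracts the
  product, and continuity at 0 evaluates the remaining factor as E(0) = 1. The exponent j(j-1)/2 is
  kept as a sum to stay within naturals.\<close>

lemma euler_identity:
  fixes q z :: real
  assumes q: "0 < q" "q < 1" and z: "0 \<le> z"
  shows "((\<lambda>j. q ^ (\<Sum>i<j. i) / qpoch q q j * z ^ j) has_sum qpoch_inf (- z) q) UNIV"
proof -
  define c where "c j = q ^ (\<Sum>i<j. i) / qpoch q q j" for j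
  have pos: "0 < qpoch q q j" for j using qpoch_pos[of q j] q by simp
  have c0: "0 < c j" for j using pos q by (simp add: c_def)
  have cS: "c (Suc j) * (1 - q ^ Suc j) = c j * q ^ j" for j
  proof -
    have "1 - q * q ^ j \<noteq> 0" using pos[of "Suc j"] pos[of j] by (auto simp: qpoch_Suc)
    thus ?thesis using pos[of j] by (simp add: c_def qpoch_Suc power_add)
  qed
  have sm: "summable (\<lambda>j. c j * w ^ j)" for w
  proof -
    \<comment> \<open>Bounds the ratio of consecutive terms, since 1 - q^(j+1) is at least 1 -
      q.\<close>
    have "(\<lambda>j. \<bar>w\<bar> / (1 - q) * q ^ j) \<longlonglongrightarrow> \<bar>w\<bar> / (1 - q) * 0"
      using q by (intro tendsto_intros LIMSEQ_power_zero) simp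
    hence "\<forall>\<^sub>F j in sequentially. \<bar>w\<bar> / (1 - q) * q ^ j < 1 / 2" by (intro order_tendstoD) auto
    then obtain J where J: "\<And>j. J \<le> j \<Longrightarrow> \<bar>w\<bar> / (1 - q) * q ^ j < 1 / 2"
      by (auto simp: eventually_sequentially)
    show ?thesis
    proof (rule summable_ratio_test[of "1/2" J])
      fix j assume j: "J \<le> j"
      have "1 - q \<le> 1 - q ^ Suc j" using q power_le_one[of q j] by (simp add: mult_left_le)
      hence "c (Suc j) * (1 - q) \<le> c (Suc j) * (1 - q ^ Suc j)" using c0[of "Suc j"] by simp
      hence "c (Suc j) * (1 - q) \<le> c j * q ^ j" unfolding cS .
      hence "c (Suc j) \<le> c j * q ^ j / (1 - q)" using q by (simp add: pos_le_divide_eq)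
      hence "c (Suc j) * \<bar>w\<bar> \<le> c j * (\<bar>w\<bar> / (1 - q) * q ^ j)"
        using mult_right_mono[of "c (Suc j)" "c j * q ^ j / (1 - q)" "\<bar>w\<bar>"] by (simp add: mult_ac)
      also have "\<dots> \<le> c j * (1 / 2)" using J[OF j] c0[of j] by (intro mult_left_mono) auto
      finally have "c (Suc j) * \<bar>w\<bar> * \<bar>w\<bar> ^ j \<le> c j * (1 / 2) * \<bar>w\<bar> ^ j" by (rule mult_right_mono) simp
      thus "norm (c (Suc j) * w ^ Suc j) \<le> 1 / 2 * norm (c j * w ^ j)"
        using c0 by (simp add: abs_mult power_abs less_imp_le mult_ac abs_of_pos)
    qed simp
  qed
  define E where "E w = (\<Sum>j. c j * w ^ j)" for w
  have step: "E w = (1 + w) * E (w * q)" for w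
  proof -
    have "E w - E (w * q) = (\<Sum>j. c j * w ^ j - c j * (w * q) ^ j)"
      unfolding E_def by (rule suminf_diff[OF sm sm])
    also have "\<dots> = (\<Sum>j. c (Suc j) * w ^ Suc j - c (Suc j) * (w * q) ^ Suc j)"
      using suminf_split_head[OF summable_diff[OF sm[of w] sm[of "w * q"]]] by simp
    also have "(\<lambda>j. c (Suc j) * w ^ Suc j - c (Suc j) * (w * q) ^ Suc j) = (\<lambda>j. w * (c j * (w * q) ^ j))"
    proof
      fix j
      have "c (Suc j) * w ^ Suc j - c (Suc j) * (w * q) ^ Suc j = (c (Suc j) * (1 - q ^ Suc j)) * w ^ Suc j"
        by (simp add: algebra_simps power_mult_distrib)
      thus "c (Suc j) * w ^ Suc j - c (Suc j) * (w * q) ^ Suc j = w * (c j * (w * q) ^ j)"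
        unfolding cS by (simp add: power_mult_distrib mult_ac)
    qed
    also have "(\<Sum>j. w * (c j * (w * q) ^ j)) = w * E (w * q)" unfolding E_def by (rule suminf_mult[OF sm])
    finally show ?thesis by (simp add: algebra_simps)
  qed
  have iter: "E w = qpoch (- w) q n * E (w * q ^ n)" for w n
  proof (induction n)
    case (Suc n)
    thus ?case using step[of "w * q ^ n"] by (simp add: qpoch_Suc mult_ac)
  qed simp
  have cont: "isCont E 0"
    unfolding E_def by (rule isCont_powser[of c 1]) (use sm[of 1] in auto)
  have "(\<lambda>n. z * q ^ n) \<longlonglongrightarrow> z * 0" using q by (intro tendsto_intros LIMSEQ_power_zero) simp
  hence "(\<lambda>n. E (z * q ^ n)) \<longlonglongrightarrow> E 0" using isCont_tendsto_compose[OF cont] by simp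
  moreover have "E 0 = 1"
    using suminf_finite[of "{0}" "\<lambda>j. c j * 0 ^ j"] by (simp add: E_def c_def)
  ultimately have "(\<lambda>n. qpoch (- z) q n * E (z * q ^ n)) \<longlonglongrightarrow> qpoch_inf (- z) q * 1"
    by (intro tendsto_mult tendsto_qpoch[OF q]) simp
  hence "E z = qpoch_inf (- z) q" using iter[of z] LIMSEQ_unique[OF tendsto_const] by simp
  hence sums: "(\<lambda>j. c j * z ^ j) sums qpoch_inf (- z) q" using sm[of z] by (simp add: E_def sums_iff)
  have "summable (\<lambda>j. norm (c j * z ^ j))"
    using sm[of z] c0 z by (simp add: abs_mult less_imp_le)
  from norm_summable_imp_has_sum[OF this sums] show ?thesis unfolding c_def .
qed

text \<open>The left side does not depend on \<open>m\<close>. Passing from \<open>m\<close> to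
  \<open>m + 1\<close>, one product gains the factor 1 + v/t, the other loses 1 + t u, and the
  prefactor gains t u; as u v = 1, these cancel. At \<open>m = 0\<close> the two products form the
  theta function.\<close>

lemma theta_quasi_periodic:
  assumes q: "0 < q" "q < 1" and t: "0 < t"
  shows "t powi m * q powr (real_of_int m ^ 2 / 2) * qpoch_inf (- (q powr (1/2 - real_of_int m) / t)) q
     * qpoch_inf (- t * q powr (1/2 + real_of_int m)) q = qtheta q (- t * q powr (1/2))"
proof -
  define Phi where "Phi m = t powi m * q powr (real_of_int m ^ 2 / 2) * qpoch_inf (- (q powr (1/2 - real_of_int m) / t)) q
     * qpoch_inf (- t * q powr (1/2 + real_of_int m)) q" for m
  have Phi_step: "Phi (m + 1) = Phi m" for m
  proof -
    define u where "u = q powr (1/2 + real_of_int m)"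
    define v where "v = q powr (1/2 - real_of_int (m + 1))"
    have u0: "0 < u" and v0: "0 < v" using q by (simp_all add: u_def v_def)
    have uv: "u * v = 1" unfolding u_def v_def using q by (simp flip: powr_add)
    have q1: "q powr 1 = q" using q by simp
    have "v * q powr 1 = q powr (1/2 - real_of_int m)" unfolding v_def powr_add[symmetric] by simp
    hence vq: "v * q = q powr (1/2 - real_of_int m)" unfolding q1 .
    have "u * q powr 1 = q powr (1/2 + real_of_int (m + 1))" unfolding u_def powr_add[symmetric] by (simp add: add_ac)
    hence uq: "q powr (1/2 + real_of_int (m + 1)) = u * q" unfolding q1 by (rule sym)
    have e1: "qpoch_inf (- (v / t)) q = (1 + v / t) * qpoch_inf (- (q powr (1/2 - real_of_int m) / t)) q"
      using qpoch_inf_step[OF q, of "- (v / t)"] by (simp add: vq[symmetric])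
    have e2: "qpoch_inf (- t * u) q = (1 + t * u) * qpoch_inf (- t * q powr (1/2 + real_of_int (m + 1))) q"
      unfolding uq using qpoch_inf_step[OF q, of "- t * u"] by (simp add: mult.assoc)
    have e3: "q powr (real_of_int (m + 1) ^ 2 / 2) = q powr (real_of_int m ^ 2 / 2) * u"
      unfolding u_def powr_add[symmetric] by (simp add: power2_eq_square field_simps)
    have e4: "t powi (m + 1) = t powi m * t" using t by (simp add: power_int_add)
    have e5: "t * u * (1 + v / t) = 1 + t * u" using uv t by (simp add: field_simps)
    have "Phi (m + 1) = t powi m * q powr (real_of_int m ^ 2 / 2) * (t * u * (1 + v / t)) * qpoch_inf (- (q powr (1/2 - real_of_int m) / t)) q
      * qpoch_inf (- t * q powr (1/2 + real_of_int (m + 1))) q"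
      unfolding Phi_def e3 e4 v_def[symmetric] e1 by (simp only: mult_ac)
    also have "\<dots> = t powi m * q powr (real_of_int m ^ 2 / 2) * qpoch_inf (- (q powr (1/2 - real_of_int m) / t)) q
      * ((1 + t * u) * qpoch_inf (- t * q powr (1/2 + real_of_int (m + 1))) q)"
      unfolding e5 by (simp only: mult_ac)
    also have "\<dots> = Phi m" unfolding e2[symmetric] unfolding Phi_def u_def ..
    finally show ?thesis .
  qed
  have "Phi m = Phi 0"
  proof (induction m rule: int_induct[where k = 0])
    case (step2 i)
    thus ?case using Phi_step[of "i - 1"] by simp
  qed (use Phi_step in auto)
  also have "Phi 0 = qtheta q (- t * q powr (1/2))"
  proof -
    have "q / (- t * q powr (1/2)) = - (q powr (1/2) / t)"
    proof -
      have "q powr (1/2) * q powr (1/2) = q" using q by (simp flip: powr_add)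
      hence "q / q powr (1/2) = q powr (1/2)" using q by (simp add: field_simps)
      thus ?thesis using t by (simp add: field_simps)
    qed
    thus ?thesis using q by (simp add: Phi_def qtheta_def mult.commute)
  qed
  finally show ?thesis unfolding Phi_def .
qed

lemma qtheta_pos:
  assumes "0 < q" "q < 1" "0 < t" shows "0 < qtheta q (- t * q powr (1/2))"
proof -
  have "1 \<le> qpoch_inf (- t * q powr (1/2)) q" "1 \<le> qpoch_inf (q / (- t * q powr (1/2))) q"
    using assms by (auto intro!: qpoch_inf_ge_1 simp: divide_le_0_iff mult_le_0_iff)
  thus ?thesis unfolding qtheta_def by (intro mult_pos_pos) auto
qed

lemma P_S_nonneg:
  assumes "0 < q" "q < 1" "0 < t" shows "0 \<le> P_S q t l"
  unfolding P_S_def using assms qtheta_pos[OF assms] qpoch_inf_pos(1)[of q q]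
  by (intro divide_nonneg_pos mult_nonneg_nonneg mult_pos_pos) auto

text \<open>With l = m - j, expanding the square in the law of S leaves q^(j(j-1)/2) z^j with z =
  q^(1/2 - m)/t, while the cumulative law of chi supplies 1/(q;q)_j. This is Euler's series, and
  quasi-periodicity cancels its value against the theta function in the normalization.\<close>

lemma has_sum_chi_S:
  assumes q: "0 < q" "q < 1" and t: "0 < t"
  shows "((\<lambda>l. P_S q t l * (\<Sum>k\<le>nat (m - l). P_chi q k)) has_sum (1 / qpoch_inf (- t * q powr (1/2 + real_of_int m)) q)) {l. l \<le> m}"
proof -
  define z where "z = q powr (1/2 - real_of_int m) / t"
  define K where "K = t powi m * q powr (real_of_int m ^ 2 / 2) / qtheta q (- t * q powr (1/2))"
  have z0: "0 < z" using q t by (simp add: z_def)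
  have th: "0 < qtheta q (- t * q powr (1/2))" by (rule qtheta_pos[OF q t])
  have qi: "0 < qpoch_inf q q" using qpoch_inf_pos(1)[of q q] q by simp
  have summand: "P_S q t (m - int j) * (\<Sum>k\<le>nat (m - (m - int j)). P_chi q k) = K * (q ^ (\<Sum>i<j. i) / qpoch q q j * z ^ j)" for j
  proof -
    have s: "real (\<Sum>i<j. i) = real j * (real j - 1) / 2"
      by (induction j) (auto simp: field_simps)
    have "q powr (real_of_int (m - int j) ^ 2 / 2) = q powr (real_of_int m ^ 2 / 2) * (q powr (1/2 - real_of_int m)) ^ j * q ^ (\<Sum>i<j. i)"
    proof -
      have "(q powr (1/2 - real_of_int m)) ^ j = q powr (real j * (1/2 - real_of_int m))"
        using q by (simp add: powr_realpow[symmetric] powr_powr mult.commute)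
      moreover have "q ^ (\<Sum>i<j. i) = q powr (real j * (real j - 1) / 2)"
        using q powr_realpow[of q "\<Sum>i<j. i"] unfolding s by simp
      moreover have "real_of_int (m - int j) ^ 2 / 2 = real_of_int m ^ 2 / 2 + real j * (1/2 - real_of_int m) + real j * (real j - 1) / 2"
        by (simp add: power2_eq_square field_simps)
      ultimately show ?thesis by (simp only: powr_add)
    qed
    moreover have "t powi (m - int j) = t powi m * (1 / t) ^ j"
      using t by (simp add: power_int_diff power_one_over)
    moreover have "z ^ j = (q powr (1/2 - real_of_int m)) ^ j * (1 / t) ^ j"
      by (simp add: z_def power_divide power_one_over)
    ultimately show ?thesis using qi th
      by (simp add: P_S_def K_def sum_P_chi[OF q] mult_ac)
  qed
  have "((\<lambda>j. K * (q ^ (\<Sum>i<j. i) / qpoch q q j * z ^ j)) has_sum (K * qpoch_inf (- z) q)) UNIV"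
    by (intro has_sum_cmult_right euler_identity[OF q]) (use z0 in simp)
  hence "((\<lambda>j. P_S q t (m - int j) * (\<Sum>k\<le>nat (m - (m - int j)). P_chi q k)) has_sum (K * qpoch_inf (- z) q)) UNIV"
    unfolding summand .
  hence "((\<lambda>l. P_S q t l * (\<Sum>k\<le>nat (m - l). P_chi q k)) has_sum (K * qpoch_inf (- z) q)) {l. l \<le> m}"
    by (subst (asm) has_sum_reindex_bij_witness[where i = "\<lambda>l. nat (m - l)" and j = "\<lambda>j. m - int j" and T = "{l. l \<le> m}"
        and h = "\<lambda>l. P_S q t l * (\<Sum>k\<le>nat (m - l). P_chi q k)" and s' = "K * qpoch_inf (- z) q"]) auto
  moreover have "K * qpoch_inf (- z) q = 1 / qpoch_inf (- t * q powr (1/2 + real_of_int m)) q"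
  proof -
    have "1 \<le> qpoch_inf (- t * q powr (1/2 + real_of_int m)) q"
      using q t by (intro qpoch_inf_ge_1) (auto simp: mult_le_0_iff)
    thus ?thesis using theta_quasi_periodic[OF q t, of m] th
      by (simp add: K_def z_def field_simps)
  qed
  ultimately show ?thesis by simp
qed

text \<open>The cumulative law of chi is at least \<open>qpoch_inf q q\<close>, so the preceding sum
  dominates.\<close>

lemma summable_P_S:
  assumes q: "0 < q" "q < 1" and t: "0 < t"
  shows "P_S q t summable_on {l. l \<le> m}"
proof (rule summable_on_comparison_test)
  have qi: "0 < qpoch_inf q q" using qpoch_inf_pos(1)[of q q] q by simp
  show "(\<lambda>l. P_S q t l * (\<Sum>k\<le>nat (m - l). P_chi q k) * (1 / qpoch_inf q q)) summable_on {l. l \<le> m}"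
    by (intro summable_on_cmult_left has_sum_imp_summable[OF has_sum_chi_S[OF q t]])
  fix l
  have "qpoch q q k \<le> 1" for k
    unfolding qpoch_def using q by (intro prod_le_1) (auto simp: mult_le_one power_le_one)
  hence "1 \<le> 1 / qpoch q q (nat (m - l))" using qpoch_pos[of q "nat (m - l)"] q by simp
  hence "P_S q t l * 1 \<le> P_S q t l * (1 / qpoch q q (nat (m - l)))"
    by (intro mult_left_mono P_S_nonneg[OF q t])
  thus "P_S q t l \<le> P_S q t l * (\<Sum>k\<le>nat (m - l). P_chi q k) * (1 / qpoch_inf q q)"
    using qi by (simp add: sum_P_chi[OF q])
  show "0 \<le> P_S q t l" by (rule P_S_nonneg[OF q t])
qed

section \<open>Finite total mass of the q-Whittaker measure\<close>

lemma poly_geometric_bounded: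
  fixes g :: real assumes "0 \<le> g" "g < 1"
  obtains K where "\<And>k. (real k + 1) ^ d * g ^ k \<le> K"
proof -
  have "summable (\<lambda>k. (real k + 1) ^ d * g ^ k)"
  proof -
    have "(\<lambda>k. ((real k + 2) / (real k + 1)) ^ d * g) \<longlonglongrightarrow> 1 ^ d * g"
      by (intro tendsto_intros) real_asymp
    moreover obtain c where c: "g < c" "c < 1" using dense[OF assms(2)] by blast
    ultimately have "\<forall>\<^sub>F k in sequentially. ((real k + 2) / (real k + 1)) ^ d * g < c"
      by (intro order_tendstoD) auto
    then obtain J where J: "\<And>k. J \<le> k \<Longrightarrow> ((real k + 2) / (real k + 1)) ^ d * g < c"
      by (auto simp: eventually_sequentially)
    show ?thesis
    proof (rule summable_ratio_test[OF c(2), of J])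
      fix k assume "J \<le> k"
      hence "((real k + 2) / (real k + 1)) ^ d * g * ((real k + 1) ^ d * g ^ k) \<le> c * ((real k + 1) ^ d * g ^ k)"
        using J[of k] assms by (intro mult_right_mono) auto
      moreover have "((real k + 2) / (real k + 1)) ^ d * g * ((real k + 1) ^ d * g ^ k) = (real (Suc k) + 1) ^ d * g ^ Suc k"
        by (simp add: power_divide add_ac)
      ultimately show "norm ((real (Suc k) + 1) ^ d * g ^ Suc k) \<le> c * norm ((real k + 1) ^ d * g ^ k)"
        using assms by (simp add: abs_mult)
    qed
  qed
  hence "Bseq (\<lambda>k. (real k + 1) ^ d * g ^ k)" using summable_LIMSEQ_zero convergentI convergent_imp_Bseq by blast
  then obtain K where "\<And>k. norm ((real k + 1) ^ d * g ^ k) \<le> K" unfolding Bseq_def by blast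
  hence "(real k + 1) ^ d * g ^ k \<le> K" for k using abs_le_D1 by (metis real_norm_def)
  thus ?thesis using that by blast
qed

lemma card_interlaced_le:
  assumes "is_partition mu" "mu R = 0"
  shows "card {nu. interlace nu mu} \<le> (mu 0 + 1) ^ R"
proof -
  have z: "nu i = 0" if "interlace nu mu" "R \<le> i" for nu i
    using that is_partition_antimono[OF assms(1), of R i] assms(2) unfolding interlace_def by (metis le_0_eq)
  have "inj_on (\<lambda>nu. restrict nu {..<R}) {nu. interlace nu mu}"
  proof (rule inj_onI)
    fix nu nu' assume n: "nu \<in> {nu. interlace nu mu}" "nu' \<in> {nu. interlace nu mu}" "restrict nu {..<R} = restrict nu' {..<R}"
    show "nu = nu'"
    proof
      fix i show "nu i = nu' i"
        using fun_cong[OF n(3), of i] z[of nu i] z[of nu' i] n(1,2) by (cases "i < R") auto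
    qed
  qed
  moreover have "(\<lambda>nu. restrict nu {..<R}) ` {nu. interlace nu mu} \<subseteq> PiE {..<R} (\<lambda>_. {..mu 0})"
  proof (intro image_subsetI)
    fix nu assume "nu \<in> {nu. interlace nu mu}"
    hence "nu i \<le> mu i" for i by (simp add: interlace_def)
    hence "nu i \<le> mu 0" for i using is_partition_antimono[OF assms(1), of 0 i] le_trans by blast
    thus "restrict nu {..<R} \<in> PiE {..<R} (\<lambda>_. {..mu 0})" by (simp add: PiE_iff)
  qed
  moreover have "finite (PiE {..<R} (\<lambda>_. {..mu 0}))" by (intro finite_PiE) auto
  ultimately have "card {nu. interlace nu mu} \<le> card (PiE {..<R} (\<lambda>_. {..mu 0}))" by (rule card_inj_on_le)
  thus ?thesis by (simp add: card_PiE)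
qed

text \<open>Each of the \<open>length xs\<close> branching steps has polynomially many choices in
  \<open>mu 0\<close>, and each of its \<open>R\<close> q-binomials is at most
  \<open>1 / (qpoch_inf q q)^2\<close>. The powers of the variables multiply to at most
  \<open>al ^ psize mu\<close>.\<close>

lemma skew_qW_le:
  assumes q: "0 < q" "q < 1" and xs: "\<forall>x\<in>set xs. 0 \<le> x \<and> x \<le> al" and al: "0 < al"
    and mu: "is_partition mu" "mu R = 0"
  shows "skew_qW q xs mu empty_part \<le> ((real (mu 0) + 1) ^ R * (1 / (qpoch_inf q q)^2) ^ R) ^ length xs * al ^ psize mu"
  using xs mu
proof (induction xs arbitrary: mu)
  case Nil
  show ?case using al by (auto simp: psize_def)
next
  case (Cons x xs)
  let ?e = "qpoch_inf q q"
  let ?D = "1 / ?e^2"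
  let ?B = "(real (mu 0) + 1) ^ R * ?D ^ R"
  have e: "0 < ?e" "\<And>k. ?e \<le> qpoch q q k" using qpoch_inf_pos[of q q] q by auto
  have B0: "0 \<le> ?B" by simp
  have q1: "qpoch q q k \<le> 1" for k
    unfolding qpoch_def using q by (intro prod_le_1) (auto simp: mult_le_one power_le_one)
  have qb: "0 \<le> qbinom q a b" "qbinom q a b \<le> ?D" for a b
  proof -
    have p: "0 < qpoch q q k" for k using e(2)[of k] e(1) by linarith
    show "0 \<le> qbinom q a b" using p by (simp add: qbinom_def less_imp_le)
    have "?e^2 \<le> qpoch q q b * qpoch q q (a - b)"
      unfolding power2_eq_square using e p by (intro mult_mono) (auto intro: less_imp_le)
    thus "qbinom q a b \<le> ?D" unfolding qbinom_def using e(1) q1[of a] p by (intro frac_le) auto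
  qed
  have psi: "qw_psi q mu nu \<le> ?D ^ R" for nu
  proof -
    have "(\<Prod>i<R. qbinom q (mu i - mu (Suc i)) (mu i - nu i)) \<le> (\<Prod>i<R. ?D)"
      by (intro prod_mono) (use qb in auto)
    thus ?thesis using qw_psi_eq[OF Cons.prems(2,3), of q nu] q by simp
  qed
  have tm: "x ^ (psize mu - psize nu) * qw_psi q mu nu * skew_qW q xs nu empty_part \<le> ?D ^ R * ?B ^ length xs * al ^ psize mu"
    if nu: "interlace nu mu" for nu
  proof -
    have pn: "is_partition nu" using interlaced_is_partition[OF nu Cons.prems(2)] .
    have le: "nu i \<le> mu i" for i using nu by (simp add: interlace_def)
    have "skew_qW q xs nu empty_part \<le> ((real (nu 0) + 1) ^ R * ?D ^ R) ^ length xs * al ^ psize nu"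
      using Cons.prems le[of R] by (intro Cons.IH pn) auto
    also have "\<dots> \<le> ?B ^ length xs * al ^ psize nu"
      using le[of 0] al by (intro mult_right_mono power_mono) auto
    finally have 1: "skew_qW q xs nu empty_part \<le> ?B ^ length xs * al ^ psize nu" .
    have 2: "x ^ (psize mu - psize nu) \<le> al ^ (psize mu - psize nu)" using Cons.prems by (intro power_mono) auto
    have "x ^ (psize mu - psize nu) * qw_psi q mu nu * skew_qW q xs nu empty_part
       \<le> al ^ (psize mu - psize nu) * ?D ^ R * (?B ^ length xs * al ^ psize nu)"
      using 1 2 psi[of nu] al q Cons.prems B0
      by (intro mult_mono mult_nonneg_nonneg qw_psi_nonneg skew_qW_nonneg) auto
    also have "\<dots> = ?D ^ R * ?B ^ length xs * (al ^ (psize mu - psize nu) * al ^ psize nu)" by (simp only: mult_ac)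
    also have "al ^ (psize mu - psize nu) * al ^ psize nu = al ^ psize mu"
      using interlace_psize_le[OF nu Cons.prems(2)] by (simp flip: power_add)
    finally show ?thesis .
  qed
  have "skew_qW q (x # xs) mu empty_part \<le> (\<Sum>nu | interlace nu mu. ?D ^ R * ?B ^ length xs * al ^ psize mu)"
    unfolding skew_qW.simps by (intro sum_mono tm) simp
  also have "\<dots> = real (card {nu. interlace nu mu}) * (?D ^ R * ?B ^ length xs * al ^ psize mu)" by simp
  also have "\<dots> \<le> (real (mu 0) + 1) ^ R * (?D ^ R * ?B ^ length xs * al ^ psize mu)"
  proof (rule mult_right_mono)
    have "real (card {nu. interlace nu mu}) \<le> real ((mu 0 + 1) ^ R)"
      using card_interlaced_le[OF Cons.prems(2,3)] of_nat_le_iff by blast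
    thus "real (card {nu. interlace nu mu}) \<le> (real (mu 0) + 1) ^ R" by (simp add: add.commute)
    show "0 \<le> ?D ^ R * ?B ^ length xs * al ^ psize mu" using B0 al by (intro mult_nonneg_nonneg zero_le_power) auto
  qed
  also have "\<dots> = ?B ^ length (x # xs) * al ^ psize mu" by (simp add: mult_ac)
  finally show ?case .
qed

lemma summable_psize_rows:
  fixes s :: real assumes s: "0 < s" "s < 1"
  shows "(\<lambda>mu. s ^ psize mu) summable_on {mu. is_partition mu \<and> mu R = 0}"
proof -
  let ?A = "{mu. is_partition mu \<and> mu R = 0}"
  let ?F = "\<lambda>mu. restrict mu {..<R}"
  let ?L = "PiE {..<R} (\<lambda>_. UNIV :: nat set)"
  have "(\<lambda>l. norm (\<Prod>i<R. complex_of_real s ^ l i)) summable_on ?L"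
    by (rule prod_geometric(2)) (use s in simp)
  hence 1: "(\<lambda>l. \<Prod>i<R. s ^ l i) summable_on ?L"
    by (rule summable_on_cong[THEN iffD1, rotated]) (use s in \<open>simp add: prod_norm[symmetric] norm_power\<close>)
  have inj: "inj_on ?F ?A"
  proof (rule inj_onI)
    fix mu nu assume a: "mu \<in> ?A" "nu \<in> ?A" "?F mu = ?F nu"
    show "mu = nu"
    proof
      fix i show "mu i = nu i"
        using fun_cong[OF a(3), of i] is_partition_antimono[of mu R i] is_partition_antimono[of nu R i] a(1,2)
        by (cases "i < R") auto
    qed
  qed
  have "?F ` ?A \<subseteq> ?L" by (intro image_subsetI) (simp add: PiE_iff)
  hence "(\<lambda>l. \<Prod>i<R. s ^ l i) summable_on (?F ` ?A)" by (rule summable_on_subset_banach[OF 1])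
  hence "((\<lambda>l. \<Prod>i<R. s ^ l i) \<circ> ?F) summable_on ?A" using summable_on_reindex[OF inj] by blast
  thus ?thesis
    by (rule summable_on_cong[THEN iffD1, rotated]) (simp add: psize_eq[of _ R] power_sum)
qed

lemma list_bounds:
  fixes as bs :: "real list"
  assumes as: "\<forall>a\<in>set as. 0 < a" and bs: "\<forall>b\<in>set bs. 0 < b" and ab: "\<forall>a\<in>set as. \<forall>b\<in>set bs. a * b < 1"
  obtains al be where "0 < al" "\<forall>a\<in>set as. a \<le> al" "0 < be" "\<forall>b\<in>set bs. b \<le> be" "al * be < 1"
proof -
  consider "as = []" | "bs = []" | "as \<noteq> []" "bs \<noteq> []" by blast
  thus ?thesis
  proof cases
    case 1
    define be where "be = Max (insert 1 (set bs))"
    have "1 \<le> be" "\<forall>b\<in>set bs. b \<le> be" by (auto simp: be_def)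
    \<comment> \<open>For an empty list any positive bound is valid; this one makes the product
      equal to 1/2.\<close>
    thus ?thesis using 1 by (intro that[of "1 / (2 * be)" be]) auto
  next
    case 2
    define al where "al = Max (insert 1 (set as))"
    have "1 \<le> al" "\<forall>a\<in>set as. a \<le> al" by (auto simp: al_def)
    thus ?thesis using 2 by (intro that[of al "1 / (2 * al)"]) auto
  next
    case 3
    have "Max (set as) \<in> set as" "Max (set bs) \<in> set bs" using 3 by (auto intro!: Max_in)
    thus ?thesis using as bs ab by (intro that[of "Max (set as)" "Max (set bs)"]) auto
  qed
qed

lemma cauchy_prod_pos:
  assumes q: "0 < q" "q < 1" and as: "\<forall>a\<in>set as. 0 < a" and bs: "\<forall>b\<in>set bs. 0 < b"
    and ab: "\<forall>a\<in>set as. \<forall>b\<in>set bs. a * b < 1"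
  shows "0 < cauchy_prod q as bs"
proof -
  have "0 < prod_list xs" if "\<forall>x\<in>set xs. 0 < x" for xs :: "real list"
    using that by (induction xs) auto
  moreover have "0 < qpoch_inf (a * b) q" if "a \<in> set as" "b \<in> set bs" for a b
    using qpoch_inf_pos(1)[OF q, of "a * b"] as bs ab that by (simp add: less_imp_le)
  ultimately show ?thesis unfolding cauchy_prod_def by auto
qed

lemma M_qW_eq:
  assumes "is_partition mu"
  shows "M_qW q as bs mu = skew_qW q (rev as) mu empty_part * ((\<Prod>j\<in>{j. mu j \<noteq> 0}. 1 / qpoch q q (mu j - mu (Suc j))) * skew_qW q (rev bs) mu empty_part) * cauchy_prod q as bs"
  using assms by (simp add: M_qW_def qW_P_def qW_Q_def qwP_rev_eq)

lemma M_qW_nonneg: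
  assumes q: "0 < q" "q < 1" and as: "\<forall>a\<in>set as. 0 < a" and bs: "\<forall>b\<in>set bs. 0 < b"
    and ab: "\<forall>a\<in>set as. \<forall>b\<in>set bs. a * b < 1" and mu: "is_partition mu"
  shows "0 \<le> M_qW q as bs mu"
  unfolding M_qW_eq[OF mu] using q as bs cauchy_prod_pos[OF q as bs ab] qpoch_pos[of q]
  by (intro mult_nonneg_nonneg skew_qW_nonneg prod_nonneg) (auto intro: less_imp_le)

lemma M_pS_nonneg:
  assumes q: "0 < q" "q < 1" and as: "\<forall>a\<in>set as. 0 < a" and bs: "\<forall>b\<in>set bs. 0 < b"
    and ab: "\<forall>a\<in>set as. \<forall>b\<in>set bs. a * b < 1" and lam: "is_partition lam"
  shows "0 \<le> M_pS q as bs lam"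
  unfolding M_pS_def skew_schur_def schur_rev_eq[OF lam]
  using q as bs cauchy_prod_pos[OF q as bs ab] qpoch_inf_pos(1)[of q q]
  by (intro mult_nonneg_nonneg sum_nonneg skew_qW_nonneg) (auto intro: less_imp_le)

text \<open>The left side of (b) ranges over all \<open>mu\<close> without a bound on
  \<open>mu 0\<close>, so it needs a majorant. The measure is at most a polynomial in
  \<open>mu 0\<close> times \<open>(al * be) ^ psize mu\<close>, on partitions with at most
  \<open>length as\<close> rows.\<close>

lemma summable_M_qW:
  assumes q: "0 < q" "q < 1" and as: "\<forall>a\<in>set as. 0 < a" and bs: "\<forall>b\<in>set bs. 0 < b"
    and ab: "\<forall>a\<in>set as. \<forall>b\<in>set bs. a * b < 1"
  shows "M_qW q as bs summable_on partitions"
proof -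
  obtain al be where al: "0 < al" "\<forall>a\<in>set as. a \<le> al" and be: "0 < be" "\<forall>b\<in>set bs. b \<le> be" and albe: "al * be < 1"
    by (rule list_bounds[OF as bs ab])
  define R where "R = length as"
  define e where "e = qpoch_inf q q"
  have e: "0 < e" "\<And>k. e \<le> qpoch q q k" using qpoch_inf_pos[of q q] q by (auto simp: e_def)
  \<comment> \<open>The geometric factor is split as \<open>al * be = g * s\<close>: powers of
    \<open>g\<close> absorb the polynomial, and powers of \<open>s\<close> remain summable.\<close>
  obtain s where s: "al * be < s" "s < 1" using dense[OF albe] by blast
  have s0: "0 < s" using s(1) al(1) be(1) by (smt (verit) mult_pos_pos)
  define g where "g = al * be / s"
  have g: "0 \<le> g" "g < 1" using s s0 al be by (simp_all add: g_def)
  define D where "D = (1 / e^2) ^ R"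
  define d where "d = R * length as + R * length bs"
  obtain K where K: "\<And>k. (real k + 1) ^ d * g ^ k \<le> K" using poly_geometric_bounded[OF g] by blast
  define C where "C = D ^ length as * D ^ length bs * (1 / e) ^ R * cauchy_prod q as bs"
  have cp: "0 < cauchy_prod q as bs" by (rule cauchy_prod_pos[OF q as bs ab])
  have C0: "0 \<le> C" using e(1) cp by (simp add: C_def D_def)
  let ?A = "{mu. is_partition mu \<and> mu R = 0}"
  have bound: "M_qW q as bs mu \<le> C * K * s ^ psize mu" if mu: "mu \<in> ?A" for mu
  proof -
    have p: "is_partition mu" "mu R = 0" using mu by auto
    let ?m = "real (mu 0) + 1"
    have 1: "skew_qW q (rev as) mu empty_part \<le> (?m ^ R * D) ^ length as * al ^ psize mu"
      using skew_qW_le[OF q _ al(1) p, of "rev as"] al as by (simp add: D_def e_def less_imp_le)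
    have 2: "skew_qW q (rev bs) mu empty_part \<le> (?m ^ R * D) ^ length bs * be ^ psize mu"
      using skew_qW_le[OF q _ be(1) p, of "rev bs"] be bs by (simp add: D_def e_def less_imp_le)
    have 3: "(\<Prod>j\<in>{j. mu j \<noteq> 0}. 1 / qpoch q q (mu j - mu (Suc j))) \<le> (1 / e) ^ R"
    proof -
      have "(\<Prod>j\<in>{j. mu j \<noteq> 0}. 1 / qpoch q q (mu j - mu (Suc j))) = (\<Prod>j<R. 1 / qpoch q q (mu j - mu (Suc j)))"
        using qW_weight_eq[OF p, of q "mu 0"] by (simp add: qW_weight_def)
      also have "\<dots> \<le> (\<Prod>j<R. 1 / e)"
        using e by (intro prod_mono) (auto intro!: frac_le less_imp_le[OF less_le_trans[OF e(1) e(2)]])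
      finally show ?thesis by simp
    qed
    have nn: "0 \<le> skew_qW q (rev as) mu empty_part" "0 \<le> skew_qW q (rev bs) mu empty_part"
      using q as bs by (auto intro!: skew_qW_nonneg intro: less_imp_le)
    have n3: "0 \<le> (\<Prod>j\<in>{j. mu j \<noteq> 0}. 1 / qpoch q q (mu j - mu (Suc j)))"
      using qpoch_pos[of q] q by (intro prod_nonneg) (auto intro: less_imp_le)
    have m0: "0 \<le> ?m" "0 \<le> D" using e by (auto simp: D_def)
    have "M_qW q as bs mu \<le> (?m ^ R * D) ^ length as * al ^ psize mu * ((1 / e) ^ R * ((?m ^ R * D) ^ length bs * be ^ psize mu)) * cauchy_prod q as bs"
      unfolding M_qW_eq[OF p(1)] using 1 2 3 nn n3 cp e m0 al be
      by (intro mult_right_mono mult_mono mult_nonneg_nonneg zero_le_power) auto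
    also have "\<dots> = C * (?m ^ d * (al * be) ^ psize mu)"
      by (simp add: C_def d_def power_mult_distrib power_add power_mult mult_ac)
    also have "(al * be) ^ psize mu = g ^ psize mu * s ^ psize mu"
      using s0 by (simp add: g_def flip: power_mult_distrib)
    also have "C * (?m ^ d * (g ^ psize mu * s ^ psize mu)) \<le> C * (K * s ^ psize mu)"
    proof (rule mult_left_mono[OF _ C0])
      have "mu 0 \<le> psize mu"
      proof (cases "R = 0")
        case False
        thus ?thesis using psize_eq[OF p] member_le_sum[of 0 "{..<R}" mu] by simp
      qed (use p in simp)
      hence "?m ^ d * g ^ psize mu \<le> (real (psize mu) + 1) ^ d * g ^ psize mu"
        using g by (intro mult_right_mono power_mono) auto
      also have "\<dots> \<le> K" by (rule K)
      finally show "?m ^ d * (g ^ psize mu * s ^ psize mu) \<le> K * s ^ psize mu"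
        using s0 mult_right_mono[of "?m ^ d * g ^ psize mu" K "s ^ psize mu"] by (simp add: mult.assoc)
    qed
    finally show ?thesis by (simp only: mult.assoc)
  qed
  have "M_qW q as bs summable_on ?A"
    by (rule summable_on_comparison_test[OF summable_on_cmult_right[OF summable_psize_rows[OF s0 s(2), of R], of "C * K"]])
       (use bound M_qW_nonneg[OF q as bs ab] in auto)
  moreover have "M_qW q as bs mu = 0" if "mu \<in> partitions - ?A" for mu
  proof -
    have p: "is_partition mu" "mu R \<noteq> 0" using that by (auto simp: partitions_def)
    have "skew_qW q (rev as) mu empty_part = 0" using p by (intro skew_qW_eq_0[of _ _ 0]) (auto simp: R_def)
    thus ?thesis by (simp add: M_qW_eq[OF p(1)])
  qed
  ultimately show ?thesis
    by (subst summable_on_cong_neutral[where T = ?A and g = "M_qW q as bs"]) (auto simp: partitions_def)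
qed

section \<open>Identity (b)\<close>

text \<open>Two double sums are each evaluated in both orders. Summing the q-Whittaker family over
  \<open>l\<close> first gives the expectation in (b), over \<open>mu\<close> first the mixture over
  \<open>l\<close> of the left sides of (a). The right sides give the same mixture, and summing over
  \<open>l\<close> first there gives the distribution of \<open>lam 0\<close> plus S. Nonnegativity
  makes the families jointly summable.\<close>

lemma identity_b_holds:
  assumes q: "0 < q" "q < 1" and t: "0 < t"
    and as: "\<forall>a\<in>set as. 0 < a" and bs: "\<forall>b\<in>set bs. 0 < b"
    and ab: "\<forall>a\<in>set as. \<forall>b\<in>set bs. a * b < 1"
    and a: "\<And>n. identity_a q as bs n"
  shows "identity_b q t as bs n"
proof -
  define M where "M = M_qW q as bs"
  define W where "W = M_pS q as bs"
  define g where "g mu = 1 / qpoch_inf (- t * q powr (1/2 + real n - real (mu 0))) q" for mu :: "nat \<Rightarrow> nat"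
  define F where "F k mu = (if mu 0 \<le> k then (\<Sum>j\<le>k - mu 0. P_chi q j) else 0)" for k and mu :: "nat \<Rightarrow> nat"
  have "\<exists>P. \<forall>k. ((\<lambda>mu. M mu * F k mu) has_sum P k) partitions \<and> ((\<lambda>lam. W lam * (if lam 0 \<le> k then 1 else 0)) has_sum P k) partitions"
    by (intro choice allI) (use a in \<open>simp add: identity_a_def M_def W_def F_def\<close>)
  then obtain P where P1: "\<And>k. ((\<lambda>mu. M mu * F k mu) has_sum P k) partitions"
    and P2: "\<And>k. ((\<lambda>lam. W lam * (if lam 0 \<le> k then 1 else 0)) has_sum P k) partitions" by blast
  \<comment> \<open>Values of S above \<open>n\<close> leave no room for a nonnegative first row.
    Below, \<open>nat (int n - l)\<close> is exact and (a) applies at that level.\<close>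
  let ?L = "{l::int. l \<le> int n}"
  have S0: "0 \<le> P_S q t l" for l by (rule P_S_nonneg[OF q t])
  have M0: "0 \<le> M mu" if "mu \<in> partitions" for mu
    using M_qW_nonneg[OF q as bs ab] that by (simp add: M_def partitions_def)
  have W0: "0 \<le> W lam" if "lam \<in> partitions" for lam
    using M_pS_nonneg[OF q as bs ab] that by (simp add: W_def partitions_def)
  have F0: "0 \<le> F k mu" for k mu
    using qpoch_pos[of q] qpoch_inf_pos(1)[of q q] q
    by (auto simp: F_def P_chi_def intro!: sum_nonneg mult_nonneg_nonneg divide_nonneg_nonneg intro: less_imp_le)

  define f where "f = (\<lambda>(mu, l). M mu * (P_S q t l * F (nat (int n - l)) mu))"
  have inner: "((\<lambda>l. f (mu, l)) has_sum (M mu * g mu)) ?L" for mu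
  proof -
    let ?m = "int n - int (mu 0)"
    have "((\<lambda>l. P_S q t l * (\<Sum>k\<le>nat (?m - l). P_chi q k)) has_sum (1 / qpoch_inf (- t * q powr (1/2 + real_of_int ?m)) q)) {l. l \<le> ?m}"
      by (rule has_sum_chi_S[OF q t])
    also have "1/2 + real_of_int ?m = 1/2 + real n - real (mu 0)" by simp
    finally have "((\<lambda>l. P_S q t l * (\<Sum>k\<le>nat (?m - l). P_chi q k)) has_sum g mu) {l. l \<le> ?m}"
      unfolding g_def .
    hence "((\<lambda>l. P_S q t l * F (nat (int n - l)) mu) has_sum g mu) ?L"
    proof (rule has_sum_cong_neutral[THEN iffD1, rotated 3])
      fix l assume "l \<in> ?L - {l. l \<le> ?m}"
      thus "P_S q t l * F (nat (int n - l)) mu = 0" by (auto simp: F_def)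
    next
      fix l assume "l \<in> {l. l \<le> ?m} \<inter> ?L"
      hence "mu 0 \<le> nat (int n - l)" "nat (int n - l) - mu 0 = nat (?m - l)" by auto
      thus "P_S q t l * (\<Sum>k\<le>nat (?m - l). P_chi q k) = P_S q t l * F (nat (int n - l)) mu" by (simp add: F_def)
    qed auto
    thus ?thesis unfolding f_def by (auto intro: has_sum_cmult_right)
  qed
  have g: "0 \<le> g mu" "g mu \<le> 1" for mu
  proof -
    have "1 \<le> qpoch_inf (- t * q powr (1/2 + real n - real (mu 0))) q"
      using q t by (intro qpoch_inf_ge_1) (auto simp: mult_le_0_iff)
    thus "0 \<le> g mu" "g mu \<le> 1" by (simp_all add: g_def)
  qed
  \<comment> \<open>This starts the interchange: the first iterated sum exists because
    \<open>g\<close> is at most 1 and the measure is summable.\<close>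
  have "(\<lambda>mu. M mu * g mu) summable_on partitions"
    by (rule summable_on_comparison_test[OF summable_M_qW[OF q as bs ab]])
       (use M0 g in \<open>auto simp: M_def[symmetric] intro!: mult_nonneg_nonneg mult_left_le\<close>)
  then obtain p where p: "((\<lambda>mu. M mu * g mu) has_sum p) partitions" by (auto simp: summable_on_def)
  have fsum: "f summable_on (partitions \<times> ?L)"
    by (rule summable_on_SigmaI[where f = f, OF inner]) (use p M0 S0 F0 in \<open>auto dest: has_sum_imp_summable simp: f_def\<close>)
  have "(f has_sum p) (partitions \<times> ?L)"
    by (rule has_sum_SigmaI[where f = f, OF inner p fsum])
  hence "((\<lambda>(l, mu). f (mu, l)) has_sum p) (?L \<times> partitions)"
    by (simp only: has_sum_swap[of f])
  hence outer: "((\<lambda>l. P_S q t l * P (nat (int n - l))) has_sum p) ?L"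
  proof (rule has_sum_SigmaD)
    fix l
    have "((\<lambda>mu. P_S q t l * (M mu * F (nat (int n - l)) mu)) has_sum (P_S q t l * P (nat (int n - l)))) partitions"
      by (rule has_sum_cmult_right[OF P1])
    thus "((\<lambda>mu. case (l, mu) of (l, mu) \<Rightarrow> f (mu, l)) has_sum (P_S q t l * P (nat (int n - l)))) partitions"
      by (simp add: f_def mult_ac)
  qed

  define h where "h = (\<lambda>(l, lam). P_S q t l * (W lam * (if lam 0 \<le> nat (int n - l) then 1 else 0)))"
  have hin: "((\<lambda>lam. h (l, lam)) has_sum (P_S q t l * P (nat (int n - l)))) partitions" for l
    unfolding h_def prod.case by (rule has_sum_cmult_right[OF P2])
  have hsum: "h summable_on (?L \<times> partitions)"
    by (rule summable_on_SigmaI[where f = h, OF hin]) (use outer W0 S0 in \<open>auto dest: has_sum_imp_summable simp: h_def\<close>)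
  have "(h has_sum p) (?L \<times> partitions)"
    by (rule has_sum_SigmaI[where f = h, OF hin outer hsum])
  hence "((\<lambda>(lam, l). h (l, lam)) has_sum p) (partitions \<times> ?L)"
    by (simp only: has_sum_swap[of h])
  hence right: "((\<lambda>lam. W lam * infsum (P_S q t) {l. l \<le> int n - int (lam 0)}) has_sum p) partitions"
  proof (rule has_sum_SigmaD)
    fix lam :: "nat \<Rightarrow> nat"
    let ?R = "{l. l \<le> int n - int (lam 0)}"
    have "(P_S q t has_sum infsum (P_S q t) ?R) ?R"
      by (rule has_sum_infsum[OF summable_P_S[OF q t]])
    hence "((\<lambda>l. P_S q t l * (if lam 0 \<le> nat (int n - l) then 1 else 0)) has_sum infsum (P_S q t) ?R) ?L"
      by (rule has_sum_cong_neutral[THEN iffD1, rotated 3]) auto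
    from has_sum_cmult_right[OF this, of "W lam"]
    show "((\<lambda>l. case (lam, l) of (lam, l) \<Rightarrow> h (l, lam)) has_sum (W lam * infsum (P_S q t) ?R)) ?L"
      by (simp add: h_def mult_ac)
  qed
  show ?thesis unfolding identity_b_def
    by (intro exI[of _ p] conjI) (use p right in \<open>simp_all add: M_def W_def g_def\<close>)
qed

theorem theorem1p3:
  fixes q t :: real and as bs :: "real list"
  assumes "0 < q" and "q < 1" and "0 < t"
    and "\<forall>a\<in>set as. 0 < a" and "\<forall>b\<in>set bs. 0 < b"
    and "\<forall>a\<in>set as. \<forall>b\<in>set bs. a * b < 1"
  shows "(\<forall>n. identity_a q as bs n) \<and> (\<forall>n. identity_b q t as bs n)
         \<and> ((\<forall>n. identity_a q as bs n) \<longleftrightarrow> (\<forall>n. identity_b q t as bs n))"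
proof -
  have a: "identity_a q as bs n" for n
    unfolding identity_a_def by (rule identity_a_value[OF assms(1,2,4,5), of n]) blast
  \<comment> \<open>This derives (b) from (a) at all levels at once; the equivalence is then
    immediate because both families of identities hold.\<close>
  have "identity_b q t as bs n" for n
    by (rule identity_b_holds[OF assms a])
  with a show ?thesis by blast
qed

end
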